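(* Let $\alpha,\beta\in\mathbb{C}$ and let $(p(z),q(z))$ be a local analytic solution of the system $$q' = p^2 + zq + \alpha,\qquad p' = -q^2 - zp - \beta$$ in a neighbourhood of a point $z_0\in\mathbb{C}$. Let $\Gamma$ be a rectifiable path in $\mathbb{C}$ from $z_0$ to some point $z_\ast$ such that $(p(z),q(z))$ can be analytically continued along $\Gamma$ up to, but not including, the point $z_\ast$ (that is, it can be continued along $\Gamma\setminus\{z_\ast\}$ but not to $z_\ast$ itself). Then, in some coordinate chart of the space of initial conditions $\mathcal{I}$, the solution, rewritten in these coordinates, can be analytically continued to $z_\ast$, leading to a point $P\in L_3^{(\rho)}$ for some $\rho\in\{1,\omega,\bar\omega\}$, which is not covered by the original coordinate chart $(p,q)$. Moreover, writing $P$ in the coordinates $(\tilde u_{2,1},\tilde u_{2,2})$ belonging to $\rho$ (at $z=z_\ast$) as $(0,c)$ with $c\in\mathbb{C}$, the local analytic solution about $P$ corresponds to a simple pole at $z_\ast$ in the variables $(p,q)$ of the form $$q(z) = \frac{-\rho}{z-z_\ast} + \frac{\rho z_\ast}{2} + \left(\rho\left(1+\frac{z_\ast^2}{4}\right) - \frac{\alpha}{3} + \frac{2}{3}\bar\rho\beta\right)(z-z_\ast) + h(z-z_\ast)^2 + \sum_{n=3}^\infty c_n(z-z_\ast)^n,$$ $$p(z) = \frac{\bar\rho}{z-z_\ast} + \frac{\bar\rho z_\ast}{2} + \left(\bar\rho\left(1-\frac{z_\ast^2}{4}\right) - \frac{2}{3}\rho\alpha + \frac{\beta}{3}\right)(z-z_\ast)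 + k(z-z_\ast)^2 + \sum_{n=3}^\infty d_n(z-z_\ast)^n$$ (series convergent in a punctured neighbourhood of $z_\ast$, with some complex coefficients $c_n,d_n$), with the parameters $h$ and $k$ fixed by the location of $P$ via $$h = \frac{c}{2} + \left(-\frac{\alpha}{2} + \frac{7\rho}{8} + \frac{\beta\bar\rho}{2}\right)z_\ast,\qquad k = \frac{c\rho}{2} - \frac{3\bar\rho z_\ast}{8}.$$
   Context: Here $z$ is the complex independent variable, $'=d/dz$, $\alpha,\beta$ are complex constants, $\omega=\frac{-1+i\sqrt3}{2}$, and bars denote complex conjugation, so $\bar\rho=\rho^{-1}=\rho^2$ for $\rho\in\{1,\omega,\bar\omega\}$. Compactification. The phase space $\mathbb{C}^2$ of $(q,p)$ is compactified to $\mathbb{CP}^2$ with the three standard affine charts $(q,p)$, $(u_1,u_2)$, $(v_1,v_2)$ related by $[1:q:p]=[u_1:1:u_2]=[v_1:v_2:1]$, i.e. $u_1=1/q$, $u_2=p/q$, $v_1=1/p$, $v_2=q/p$. $L$ denotes the line at infinity ($u_1=0$, resp. $v_1=0$). Blow-ups. For each $z$ and each $\rho\in\{1,\omega,\bar\omega\}$ one performs three successive blow-ups (nine in total), the second and third centred at a point on the preceding exceptional curve; the space and the centres depend on $z$. (1) Blow up $(u_1,u_2)=(0,-\rho)$, with new charts $u_{1,1}=\frac{u_1}{u_2+\rho}$, $u_{1,2}=u_2+\rho$, and $u_{2,1}=u_1$, $u_{2,2}=\frac{u_2+\rho}{u_1}$. The exceptional curve is $L_1^{(\rho)}$ ($u_{1,2}=0$,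 resp. $u_{2,1}=0$). (2) Blow up the point $(u_{2,1},u_{2,2})=(0,\bar\rho z)$, with new charts $\hat u_{1,1}=\frac{u_{2,1}}{u_{2,2}-\bar\rho z}$, $\hat u_{1,2}=u_{2,2}-\bar\rho z$, and $\hat u_{2,1}=u_{2,1}$, $\hat u_{2,2}=\frac{u_{2,2}-\bar\rho z}{u_{2,1}}$. The exceptional curve is $L_2^{(\rho)}$ ($\hat u_{1,2}=0$, resp. $\hat u_{2,1}=0$). (3) Blow up the point $(\hat u_{2,1},\hat u_{2,2})=(0,\bar\rho\alpha-\rho\beta-1)$, with new charts $\tilde u_{1,1}=\frac{\hat u_{2,1}}{\hat u_{2,2}+1-\bar\rho\alpha+\rho\beta}$, $\tilde u_{1,2}=\hat u_{2,2}+1-\bar\rho\alpha+\rho\beta$, and $\tilde u_{2,1}=\hat u_{2,1}$, $\tilde u_{2,2}=\frac{\hat u_{2,2}+1-\bar\rho\alpha+\rho\beta}{\hat u_{2,1}}$. The exceptional curve is $L_3^{(\rho)}$ ($\tilde u_{1,2}=0$, resp. $\tilde u_{2,1}=0$). In terms of the original variables, $\tilde u_{2,1}=\frac1q$ and $\tilde u_{2,2}=q\,r$ with $r=1-\bar\rho\alpha+\rho\beta-\bar\rho zq+\rho q^2+qp$; inversely, $q=\frac{1}{\tilde u_{2,1}}$ and $p=-\frac{\rho}{\tilde u_{2,1}}+\bar\rho z-(1-\bar\rho\alpha+\rho\beta)\tilde u_{2,1}+\tilde u_{2,1}^2\tilde u_{2,2}$. Space of initial conditions. Let $\mathcal{S}$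 be the compact space obtained from $\mathbb{CP}^2$ by these three blow-ups at each of the three base points $(u_1,u_2)=(0,-\rho)$, $\rho\in\{1,\omega,\bar\omega\}$, covered by the coordinate charts $(q,p)$, $(u_1,u_2)$, $(v_1,v_2)$ and, for each $\rho\in\{1,\omega,\bar\omega\}$, $(u_{1,1},u_{1,2})$, $(u_{2,1},u_{2,2})$, $(\hat u_{1,1},\hat u_{1,2})$, $(\hat u_{2,1},\hat u_{2,2})$, $(\tilde u_{1,1},\tilde u_{1,2})$, $(\tilde u_{2,1},\tilde u_{2,2})$. Then $$\mathcal{I}=\mathcal{S}\setminus\left(L\cup L_1^{(1)}\cup L_1^{(\omega)}\cup L_1^{(\bar\omega)}\cup L_2^{(1)}\cup L_2^{(\omega)}\cup L_2^{(\bar\omega)}\right),$$ where $L$, $L_1^{(\rho)}$, $L_2^{(\rho)}$ denote the corresponding curves in $\mathcal{S}$ (their proper transforms under the later blow-ups). *)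

theory Defs
  imports "HOL-Complex_Analysis.Complex_Analysis"
begin

section \<open>Rectifiable paths and analytic continuation along a path\<close>

definition rectifiable_path :: "(real \<Rightarrow> complex) \<Rightarrow> bool" where
  "rectifiable_path \<gamma> \<longleftrightarrow> path \<gamma> \<and>
     (\<exists>M. \<forall>(n::nat) (t::nat \<Rightarrow> real). mono_on {..n} t \<and> t ` {..n} \<subseteq> {0..1} \<longrightarrow>
        (\<Sum>i<n. dist (\<gamma> (t i)) (\<gamma> (t (Suc i)))) \<le> M)"

text \<open>
  \<open>F\<close> is an analytic continuation of the germ of \<open>f\<close> at \<open>\<gamma> 0\<close> along \<open>\<gamma>\<close>, for the parameters
  in \<open>T\<close> (an interval starting at 0): \<open>F t\<close> is a function element at \<open>\<gamma> t\<close>, and the elements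
  at neighbouring parameters are direct continuations of each other. Continuation along
  \<open>\<gamma>\<close> up to but excluding the end point is the case \<open>T = {0..<1}\<close>; \<open>\<gamma>\<close> may intersect itself.
\<close>
definition continuation_along ::
  "(real \<Rightarrow> complex) \<Rightarrow> real set \<Rightarrow> (complex \<Rightarrow> complex) \<Rightarrow> (real \<Rightarrow> complex \<Rightarrow> complex) \<Rightarrow> bool"
  where
  "continuation_along \<gamma> T f F \<longleftrightarrow>
     (\<forall>t\<in>T. F t analytic_on {\<gamma> t}) \<and>
     (\<forall>\<^sub>F z in nhds (\<gamma> 0). F 0 z = f z) \<and>
     (\<forall>t\<in>T. \<forall>\<^sub>F s in at t within T. \<forall>\<^sub>F z in nhds (\<gamma> s). F s z = F t z)"


section \<open>The space of initial conditions\<close>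

definition omega :: complex where
  "omega = (-1 + \<i> * complex_of_real (sqrt 3)) / 2"

definition cube_roots :: "complex set" where
  "cube_roots = {1, omega, cnj omega}"

definition hom2 :: "complex \<Rightarrow> complex \<Rightarrow> (complex \<times> complex) set" where
  "hom2 x y = {(k * x, k * y) | k. k \<noteq> 0}"

definition hom3 :: "complex \<Rightarrow> complex \<Rightarrow> complex \<Rightarrow> (complex \<times> complex \<times> complex) set" where
  "hom3 x y w = {(k * x, k * y, k * w) | k. k \<noteq> 0}"

text \<open>
  Set-theoretically, blowing up a point of a surface replaces this point by the projective
  line of tangent directions at it. Accordingly a point of the surface is a point of
  \<open>CP\<^sup>2\<close>, or a direction on one of the exceptional curves. The directions are written as
  homogeneous coordinates \<open>[dx : dy]\<close> with respect to the chart containing the centre.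
\<close>
datatype point =
    CP2 "(complex \<times> complex \<times> complex) set"
  | Exc1 complex "(complex \<times> complex) set"
  | Exc2 complex "(complex \<times> complex) set"
  | Exc3 complex "(complex \<times> complex) set"

text \<open>
  The two charts of the blow-up of the point with coordinates \<open>(x0, y0)\<close> in the chart
  (parametrisation) \<open>\<phi>\<close>. The new coordinates are \<open>((x - x0)/(y - y0), y - y0)\<close> and
  \<open>(x - x0, (y - y0)/(x - x0))\<close>, and \<open>E\<close> embeds the exceptional curve.
\<close>
fun blowup_chart1 ::
  "((complex \<times> complex) set \<Rightarrow> point) \<Rightarrow> complex \<times> complex \<Rightarrow> (complex \<times> complex \<Rightarrow> point)
     \<Rightarrow> complex \<times> complex \<Rightarrow> point" where
  "blowup_chart1 E (x0, y0) \<phi> (a, b) = (if b = 0 then E (hom2 a 1) else \<phi> (x0 + a * b, y0 + b))"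

fun blowup_chart2 ::
  "((complex \<times> complex) set \<Rightarrow> point) \<Rightarrow> complex \<times> complex \<Rightarrow> (complex \<times> complex \<Rightarrow> point)
     \<Rightarrow> complex \<times> complex \<Rightarrow> point" where
  "blowup_chart2 E (x0, y0) \<phi> (a, b) = (if a = 0 then E (hom2 1 b) else \<phi> (x0 + a, y0 + a * b))"

text \<open>
  The indices are named after the coordinates: \<open>(q, p)\<close>, \<open>(u\<^sub>1, u\<^sub>2)\<close>, \<open>(v\<^sub>1, v\<^sub>2)\<close> and, after the
  first, second (hat) and third (tilde) blow-up, \<open>(u\<^sub>i\<^sub>1, u\<^sub>i\<^sub>2)\<close> for \<open>i = 1, 2\<close>.
\<close>
datatype chart =
    Chart_qp | Chart_u | Chart_v
  | Chart_u1 complex | Chart_u2 complex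
  | Chart_hat1 complex | Chart_hat2 complex
  | Chart_tilde1 complex | Chart_tilde2 complex

definition charts :: "chart set" where
  "charts = {Chart_qp, Chart_u, Chart_v} \<union>
     (\<Union>\<rho>\<in>cube_roots. {Chart_u1 \<rho>, Chart_u2 \<rho>, Chart_hat1 \<rho>, Chart_hat2 \<rho>,
                      Chart_tilde1 \<rho>, Chart_tilde2 \<rho>})"

definition pt_qp :: "complex \<times> complex \<Rightarrow> point" where
  "pt_qp = (\<lambda>(q, p). CP2 (hom3 1 q p))"

definition pt_u :: "complex \<times> complex \<Rightarrow> point" where
  "pt_u = (\<lambda>(u1, u2). CP2 (hom3 u1 1 u2))"

definition pt_v :: "complex \<times> complex \<Rightarrow> point" where
  "pt_v = (\<lambda>(v1, v2). CP2 (hom3 v1 v2 1))"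

definition centre1 :: "complex \<Rightarrow> complex \<times> complex" where
  "centre1 \<rho> = (0, - \<rho>)"

definition centre2 :: "complex \<Rightarrow> complex \<Rightarrow> complex \<times> complex" where
  "centre2 z \<rho> = (0, cnj \<rho> * z)"

definition centre3 :: "complex \<Rightarrow> complex \<Rightarrow> complex \<Rightarrow> complex \<times> complex" where
  "centre3 \<alpha> \<beta> \<rho> = (0, cnj \<rho> * \<alpha> - \<rho> * \<beta> - 1)"

definition pt_u1 :: "complex \<Rightarrow> complex \<times> complex \<Rightarrow> point" where
  "pt_u1 \<rho> = blowup_chart1 (Exc1 \<rho>) (centre1 \<rho>) pt_u"

definition pt_u2 :: "complex \<Rightarrow> complex \<times> complex \<Rightarrow> point" where
  "pt_u2 \<rho> = blowup_chart2 (Exc1 \<rho>) (centre1 \<rho>) pt_u"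

definition pt_hat1 :: "complex \<Rightarrow> complex \<Rightarrow> complex \<times> complex \<Rightarrow> point" where
  "pt_hat1 z \<rho> = blowup_chart1 (Exc2 \<rho>) (centre2 z \<rho>) (pt_u2 \<rho>)"

definition pt_hat2 :: "complex \<Rightarrow> complex \<Rightarrow> complex \<times> complex \<Rightarrow> point" where
  "pt_hat2 z \<rho> = blowup_chart2 (Exc2 \<rho>) (centre2 z \<rho>) (pt_u2 \<rho>)"

definition pt_tilde1 ::
  "complex \<Rightarrow> complex \<Rightarrow> complex \<Rightarrow> complex \<Rightarrow> complex \<times> complex \<Rightarrow> point" where
  "pt_tilde1 \<alpha> \<beta> z \<rho> = blowup_chart1 (Exc3 \<rho>) (centre3 \<alpha> \<beta> \<rho>) (pt_hat2 z \<rho>)"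

definition pt_tilde2 ::
  "complex \<Rightarrow> complex \<Rightarrow> complex \<Rightarrow> complex \<Rightarrow> complex \<times> complex \<Rightarrow> point" where
  "pt_tilde2 \<alpha> \<beta> z \<rho> = blowup_chart2 (Exc3 \<rho>) (centre3 \<alpha> \<beta> \<rho>) (pt_hat2 z \<rho>)"

text \<open>
  The point with given coordinates in a given chart of the surface at \<open>z\<close>. Coordinate values
  whose point is the centre of a blow-up do not belong to the chart; see \<open>surface\<close> below.
\<close>
fun chart_pt ::
  "complex \<Rightarrow> complex \<Rightarrow> complex \<Rightarrow> chart \<Rightarrow> complex \<times> complex \<Rightarrow> point" where
  "chart_pt \<alpha> \<beta> z Chart_qp = pt_qp"
| "chart_pt \<alpha> \<beta> z Chart_u = pt_u"
| "chart_pt \<alpha> \<beta> z Chart_v = pt_v"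
| "chart_pt \<alpha> \<beta> z (Chart_u1 \<rho>) = pt_u1 \<rho>"
| "chart_pt \<alpha> \<beta> z (Chart_u2 \<rho>) = pt_u2 \<rho>"
| "chart_pt \<alpha> \<beta> z (Chart_hat1 \<rho>) = pt_hat1 z \<rho>"
| "chart_pt \<alpha> \<beta> z (Chart_hat2 \<rho>) = pt_hat2 z \<rho>"
| "chart_pt \<alpha> \<beta> z (Chart_tilde1 \<rho>) = pt_tilde1 \<alpha> \<beta> z \<rho>"
| "chart_pt \<alpha> \<beta> z (Chart_tilde2 \<rho>) = pt_tilde2 \<alpha> \<beta> z \<rho>"

definition centres :: "complex \<Rightarrow> complex \<Rightarrow> complex \<Rightarrow> point set" where
  "centres \<alpha> \<beta> z =
     (\<Union>\<rho>\<in>cube_roots. {pt_u (centre1 \<rho>), pt_u2 \<rho> (centre2 z \<rho>), pt_hat2 z \<rho> (centre3 \<alpha> \<beta> \<rho>)})"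

definition surface :: "complex \<Rightarrow> complex \<Rightarrow> complex \<Rightarrow> point set" where
  "surface \<alpha> \<beta> z = (\<Union>C\<in>charts. range (chart_pt \<alpha> \<beta> z C)) - centres \<alpha> \<beta> z"

text \<open>
  The line at infinity and the exceptional curves in the surface, i.e. their proper
  transforms under the later blow-ups. In the first chart of a later blow-up, the proper
  transform of the curve where the first coordinate vanishes is given by the same equation,
  whence the last set in each of the next three definitions.
\<close>
definition line_L :: "complex \<Rightarrow> complex \<Rightarrow> complex \<Rightarrow> point set" where
  "line_L \<alpha> \<beta> z =
     (range (\<lambda>y. pt_u (0, y)) \<union> range (\<lambda>y. pt_v (0, y)) \<union>
      (\<Union>\<rho>\<in>cube_roots. range (\<lambda>y. pt_u1 \<rho> (0, y)))) \<inter> surface \<alpha> \<beta> z"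

definition curve_L1 :: "complex \<Rightarrow> complex \<Rightarrow> complex \<Rightarrow> complex \<Rightarrow> point set" where
  "curve_L1 \<alpha> \<beta> z \<rho> =
     (range (\<lambda>x. pt_u1 \<rho> (x, 0)) \<union> range (\<lambda>y. pt_u2 \<rho> (0, y)) \<union>
      range (\<lambda>y. pt_hat1 z \<rho> (0, y))) \<inter> surface \<alpha> \<beta> z"

definition curve_L2 :: "complex \<Rightarrow> complex \<Rightarrow> complex \<Rightarrow> complex \<Rightarrow> point set" where
  "curve_L2 \<alpha> \<beta> z \<rho> =
     (range (\<lambda>x. pt_hat1 z \<rho> (x, 0)) \<union> range (\<lambda>y. pt_hat2 z \<rho> (0, y)) \<union>
      range (\<lambda>y. pt_tilde1 \<alpha> \<beta> z \<rho> (0, y))) \<inter> surface \<alpha> \<beta> z"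

definition curve_L3 :: "complex \<Rightarrow> complex \<Rightarrow> complex \<Rightarrow> complex \<Rightarrow> point set" where
  "curve_L3 \<alpha> \<beta> z \<rho> =
     (range (\<lambda>x. pt_tilde1 \<alpha> \<beta> z \<rho> (x, 0)) \<union> range (\<lambda>y. pt_tilde2 \<alpha> \<beta> z \<rho> (0, y)))
      \<inter> surface \<alpha> \<beta> z"

definition init_space :: "complex \<Rightarrow> complex \<Rightarrow> complex \<Rightarrow> point set" where
  "init_space \<alpha> \<beta> z = surface \<alpha> \<beta> z -
     (line_L \<alpha> \<beta> z \<union> (\<Union>\<rho>\<in>cube_roots. curve_L1 \<alpha> \<beta> z \<rho>) \<union> (\<Union>\<rho>\<in>cube_roots. curve_L2 \<alpha> \<beta> z \<rho>))"


section \<open>Consistency of the charts\<close>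

lemma hom2_eq_iff: "hom2 x y = hom2 x' y' \<longleftrightarrow> (\<exists>k. k \<noteq> 0 \<and> x = k * x' \<and> y = k * y')"
proof
  assume "hom2 x y = hom2 x' y'"
  moreover have "(x, y) \<in> hom2 x y"
    unfolding hom2_def by (rule CollectI, rule exI[of _ 1]) simp
  ultimately have "(x, y) \<in> hom2 x' y'" by simp
  then show "\<exists>k. k \<noteq> 0 \<and> x = k * x' \<and> y = k * y'"
    unfolding hom2_def by auto
next
  assume "\<exists>k. k \<noteq> 0 \<and> x = k * x' \<and> y = k * y'"
  then obtain k where k: "k \<noteq> 0" "x = k * x'" "y = k * y'" by blast
  have "\<exists>m. m \<noteq> 0 \<and> c * x' = m * x \<and> c * y' = m * y" if "c \<noteq> 0" for c
    using k that by (intro exI[of _ "c / k"]) auto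
  moreover have "\<exists>m. m \<noteq> 0 \<and> c * x = m * x' \<and> c * y = m * y'" if "c \<noteq> 0" for c
    using k that by (intro exI[of _ "c * k"]) auto
  ultimately show "hom2 x y = hom2 x' y'"
    unfolding hom2_def by auto
qed

lemma hom3_eq_iff:
  "hom3 x y w = hom3 x' y' w' \<longleftrightarrow> (\<exists>k. k \<noteq> 0 \<and> x = k * x' \<and> y = k * y' \<and> w = k * w')"
proof
  assume "hom3 x y w = hom3 x' y' w'"
  moreover have "(x, y, w) \<in> hom3 x y w"
    unfolding hom3_def by (rule CollectI, rule exI[of _ 1]) simp
  ultimately have "(x, y, w) \<in> hom3 x' y' w'" by simp
  then show "\<exists>k. k \<noteq> 0 \<and> x = k * x' \<and> y = k * y' \<and> w = k * w'"
    unfolding hom3_def by auto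
next
  assume "\<exists>k. k \<noteq> 0 \<and> x = k * x' \<and> y = k * y' \<and> w = k * w'"
  then obtain k where k: "k \<noteq> 0" "x = k * x'" "y = k * y'" "w = k * w'" by blast
  have "\<exists>m. m \<noteq> 0 \<and> c * x' = m * x \<and> c * y' = m * y \<and> c * w' = m * w" if "c \<noteq> 0" for c
    using k that by (intro exI[of _ "c / k"]) auto
  moreover have "\<exists>m. m \<noteq> 0 \<and> c * x = m * x' \<and> c * y = m * y' \<and> c * w = m * w'" if "c \<noteq> 0" for c
    using k that by (intro exI[of _ "c * k"]) auto
  ultimately show "hom3 x y w = hom3 x' y' w'"
    unfolding hom3_def by auto
qed

lemma pt_u_eq_pt_qp: "u1 \<noteq> 0 \<Longrightarrow> pt_u (u1, u2) = pt_qp (1 / u1, u2 / u1)"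
  by (auto simp: pt_u_def pt_qp_def hom3_eq_iff)

lemma pt_v_eq_pt_qp: "v1 \<noteq> 0 \<Longrightarrow> pt_v (v1, v2) = pt_qp (v2 / v1, 1 / v1)"
  by (auto simp: pt_v_def pt_qp_def hom3_eq_iff)

lemma pt_tilde2_eq_pt_qp:
  assumes "a \<noteq> 0"
  shows "pt_tilde2 \<alpha> \<beta> z \<rho> (a, b) =
    pt_qp (1 / a, - \<rho> / a + cnj \<rho> * z - (1 - cnj \<rho> * \<alpha> + \<rho> * \<beta>) * a + a\<^sup>2 * b)"
  using assms
  by (simp add: pt_tilde2_def pt_hat2_def pt_u2_def centre1_def centre2_def centre3_def
      pt_u_eq_pt_qp) (simp add: field_simps power2_eq_square)

text \<open>
  The space of initial conditions is the affine plane together with, for each \<open>\<rho>\<close>, the last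
  exceptional curve without its intersection point with the proper transform of the second.
\<close>
lemma init_space_eq:
  "init_space \<alpha> \<beta> z =
     range pt_qp \<union> (\<Union>\<rho>\<in>cube_roots. range (\<lambda>c. pt_tilde2 \<alpha> \<beta> z \<rho> (0, c)))"
proof
  show "init_space \<alpha> \<beta> z \<subseteq>
     range pt_qp \<union> (\<Union>\<rho>\<in>cube_roots. range (\<lambda>c. pt_tilde2 \<alpha> \<beta> z \<rho> (0, c)))"
    (is "_ \<subseteq> ?R")
  proof
    fix x assume x: "x \<in> init_space \<alpha> \<beta> z"
    have xs: "x \<in> surface \<alpha> \<beta> z" and xL: "x \<notin> line_L \<alpha> \<beta> z"
      and xL1: "\<And>\<rho>. \<rho> \<in> cube_roots \<Longrightarrow> x \<notin> curve_L1 \<alpha> \<beta> z \<rho>"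
      and xL2: "\<And>\<rho>. \<rho> \<in> cube_roots \<Longrightarrow> x \<notin> curve_L2 \<alpha> \<beta> z \<rho>"
      using x by (auto simp: init_space_def)
    have u: "x \<in> ?R" if "x = pt_u (a, b)" for a b
      using that xL xs pt_u_eq_pt_qp[of a b] by (cases "a = 0") (auto simp: line_L_def)
    have v: "x \<in> ?R" if "x = pt_v (a, b)" for a b
      using that xL xs pt_v_eq_pt_qp[of a b] by (cases "a = 0") (auto simp: line_L_def)
    have u1: "x \<in> ?R" if r: "\<rho> \<in> cube_roots" and e: "x = pt_u1 \<rho> (a, b)" for a b \<rho>
    proof (cases "b = 0")
      case True
      then show ?thesis using xL1[OF r] xs e by (auto simp: curve_L1_def)
    next
      case False
      then show ?thesis using u e by (simp add: pt_u1_def centre1_def)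
    qed
    have u2: "x \<in> ?R" if r: "\<rho> \<in> cube_roots" and e: "x = pt_u2 \<rho> (a, b)" for a b \<rho>
    proof (cases "a = 0")
      case True
      then show ?thesis using xL1[OF r] xs e by (auto simp: curve_L1_def)
    next
      case False
      then show ?thesis using u e by (simp add: pt_u2_def centre1_def)
    qed
    have h1: "x \<in> ?R" if r: "\<rho> \<in> cube_roots" and e: "x = pt_hat1 z \<rho> (a, b)" for a b \<rho>
    proof (cases "b = 0")
      case True
      then show ?thesis using xL2[OF r] xs e by (auto simp: curve_L2_def)
    next
      case False
      then show ?thesis using u2[OF r] e by (simp add: pt_hat1_def centre2_def)
    qed
    have h2: "x \<in> ?R" if r: "\<rho> \<in> cube_roots" and e: "x = pt_hat2 z \<rho> (a, b)" for a b \<rho>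
    proof (cases "a = 0")
      case True
      then show ?thesis using xL2[OF r] xs e by (auto simp: curve_L2_def)
    next
      case False
      then show ?thesis using u2[OF r] e by (simp add: pt_hat2_def centre2_def)
    qed
    have t2: "x \<in> ?R" if r: "\<rho> \<in> cube_roots" and e: "x = pt_tilde2 \<alpha> \<beta> z \<rho> (a, b)" for a b \<rho>
    proof (cases "a = 0")
      case True
      then show ?thesis using r e by auto
    next
      case False
      then show ?thesis using h2[OF r] e by (simp add: pt_tilde2_def centre3_def)
    qed
    have t1: "x \<in> ?R" if r: "\<rho> \<in> cube_roots" and e: "x = pt_tilde1 \<alpha> \<beta> z \<rho> (a, b)" for a b \<rho>
    proof (cases "b = 0")
      case b: True
      have a: "a \<noteq> 0"
        using xL2[OF r] xs e b by (auto simp: curve_L2_def)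
      then have "hom2 a 1 = hom2 1 (1 / a)"
        by (auto simp: hom2_eq_iff)
      then have "x = pt_tilde2 \<alpha> \<beta> z \<rho> (0, 1 / a)"
        using e b by (simp add: pt_tilde1_def pt_tilde2_def centre3_def)
      then show ?thesis using t2[OF r] by blast
    next
      case False
      then show ?thesis using h2[OF r] e by (simp add: pt_tilde1_def centre3_def)
    qed
    from xs obtain C w where C: "C \<in> charts" and "x = chart_pt \<alpha> \<beta> z C w"
      by (auto simp: surface_def)
    moreover obtain a b where "w = (a, b)" by (cases w)
    ultimately have e: "x = chart_pt \<alpha> \<beta> z C (a, b)" by simp
    show "x \<in> ?R"
    proof (cases C)
      case Chart_qp
      then show ?thesis using e by (auto simp del: UN_iff)
    next
      case Chart_u
      show ?thesis by (rule u) (use e Chart_u in simp)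
    next
      case Chart_v
      show ?thesis by (rule v) (use e Chart_v in simp)
    next
      case (Chart_u1 \<rho>)
      show ?thesis by (rule u1[of \<rho>]) (use C e Chart_u1 in \<open>auto simp: charts_def\<close>)
    next
      case (Chart_u2 \<rho>)
      show ?thesis by (rule u2[of \<rho>]) (use C e Chart_u2 in \<open>auto simp: charts_def\<close>)
    next
      case (Chart_hat1 \<rho>)
      show ?thesis by (rule h1[of \<rho>]) (use C e Chart_hat1 in \<open>auto simp: charts_def\<close>)
    next
      case (Chart_hat2 \<rho>)
      show ?thesis by (rule h2[of \<rho>]) (use C e Chart_hat2 in \<open>auto simp: charts_def\<close>)
    next
      case (Chart_tilde1 \<rho>)
      show ?thesis by (rule t1[of \<rho>]) (use C e Chart_tilde1 in \<open>auto simp: charts_def\<close>)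
    next
      case (Chart_tilde2 \<rho>)
      show ?thesis by (rule t2[of \<rho>]) (use C e Chart_tilde2 in \<open>auto simp: charts_def\<close>)
    qed
  qed
next
  have not_inf: "pt_qp (q, p) \<noteq> pt_u (0, y)" "pt_qp (q, p) \<noteq> pt_v (0, y)" for q p y
    by (simp_all add: pt_qp_def pt_u_def pt_v_def hom3_eq_iff)
  have pt_CP2: "\<exists>S. pt_qp x = CP2 S" "\<exists>S. pt_u x = CP2 S" "\<exists>S. pt_v x = CP2 S" for x
    by (cases x; simp add: pt_qp_def pt_u_def pt_v_def)+
  have ne: "CP2 S \<noteq> pt_u1 \<rho> (x, 0)" "CP2 S \<noteq> pt_u2 \<rho> (0, y)" "CP2 S \<noteq> pt_hat1 z \<rho> (0, y)"
    "CP2 S \<noteq> pt_hat1 z \<rho> (x, 0)" "CP2 S \<noteq> pt_hat2 z \<rho> (0, y)"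
    "CP2 S \<noteq> pt_tilde1 \<alpha> \<beta> z \<rho> (0, y)" for S \<rho> x y
    by (simp_all add: pt_u1_def pt_u2_def pt_hat1_def pt_hat2_def pt_tilde1_def
        centre1_def centre2_def centre3_def)
  have "pt_qp x \<in> init_space \<alpha> \<beta> z" for x
  proof -
    obtain q p where x: "x = (q, p)" by (cases x)
    obtain S where S: "pt_qp (q, p) = CP2 S" using pt_CP2 by blast
    have n1: "pt_qp (q, p) \<noteq> pt_u1 \<rho> (0, y)" for \<rho> y
      using not_inf(1) ne(1)[of S] S by (cases "y = 0") (auto simp: pt_u1_def centre1_def)
    note ne' = ne[of S, folded S]
    have "pt_qp (q, p) \<notin> centres \<alpha> \<beta> z"
      using not_inf ne'
      by (simp add: centres_def centre1_def centre2_def centre3_def)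
    then have s: "pt_qp (q, p) \<in> surface \<alpha> \<beta> z"
      unfolding surface_def charts_def by (auto intro!: bexI[of _ Chart_qp])
    show ?thesis
      using s not_inf n1 ne' unfolding x
      by (simp add: init_space_def line_L_def curve_L1_def curve_L2_def image_iff)
  qed
  moreover have "pt_tilde2 \<alpha> \<beta> z \<rho> (0, c) \<in> init_space \<alpha> \<beta> z" if r: "\<rho> \<in> cube_roots" for \<rho> c
  proof -
    have e: "pt_tilde2 \<alpha> \<beta> z \<rho> (0, c) = Exc3 \<rho> (hom2 1 c)"
      by (simp add: pt_tilde2_def centre3_def)
    have n: "hom2 1 c \<noteq> hom2 0 1"
      by (simp add: hom2_eq_iff)
    have m: "Exc3 \<rho> T \<noteq> pt_u x" "Exc3 \<rho> T \<noteq> pt_v x" "Exc3 \<rho> T \<noteq> pt_u1 \<rho>' x"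
      "Exc3 \<rho> T \<noteq> pt_u2 \<rho>' x" "Exc3 \<rho> T \<noteq> pt_hat1 z \<rho>' x" "Exc3 \<rho> T \<noteq> pt_hat2 z \<rho>' x"
      for T x \<rho>'
      by (cases x; auto simp: pt_u_def pt_v_def pt_u1_def pt_u2_def pt_hat1_def pt_hat2_def
          centre1_def centre2_def split: if_splits)+
    have m': "Exc3 \<rho> (hom2 1 c) \<noteq> pt_tilde1 \<alpha> \<beta> z \<rho>' (0, y)" for \<rho>' y
      using n m by (auto simp: pt_tilde1_def centre3_def)
    have "Exc3 \<rho> (hom2 1 c) \<notin> centres \<alpha> \<beta> z"
      using m by (simp add: centres_def)
    moreover have "Chart_tilde2 \<rho> \<in> charts"
      using r by (auto simp: charts_def)
    moreover have "Exc3 \<rho> (hom2 1 c) \<in> range (chart_pt \<alpha> \<beta> z (Chart_tilde2 \<rho>))"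
      using e by (simp add: image_iff) metis
    ultimately have s: "Exc3 \<rho> (hom2 1 c) \<in> surface \<alpha> \<beta> z"
      unfolding surface_def by blast
    show ?thesis
      unfolding e using s m m'
      by (simp add: init_space_def line_L_def curve_L1_def curve_L2_def image_iff)
  qed
  ultimately show "range pt_qp \<union> (\<Union>\<rho>\<in>cube_roots. range (\<lambda>c. pt_tilde2 \<alpha> \<beta> z \<rho> (0, c)))
      \<subseteq> init_space \<alpha> \<beta> z"
    by auto
qed

end

theory Submission
  imports Defs
begin

text \<open>
  Write \<open>H = (q\<^sup>3 + p\<^sup>3) / 3 + z q p + \<alpha> p + \<beta> q\<close> for the Hamiltonian. Near a pole with \<open>p \<approx> - \<rho> q\<close> the
  function \<open>H + p\<^sup>2 / q\<close> (equivalently \<open>H - q\<^sup>2 / p\<close>) stays finite, and it satisfies a linear differential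
  inequality. The real-analytic blend \<open>W = H + (cnj q p\<^sup>2 - cnj p q\<^sup>2) / (|q|\<^sup>2 + |p|\<^sup>2)\<close> of the two satisfies
  \<open>|dW| \<le> C (1 + |W|) |dz|\<close> wherever \<open>|q|\<^sup>2 + |p|\<^sup>2 \<ge> 1\<close>, so that it is bounded along a path of finite
  length.

  If \<open>(q, p)\<close> returns to a bounded set infinitely often as \<open>z\<close> tends to the end point, a local
  existence theorem with uniform radius continues the solution to the end point. Otherwise \<open>(q, p)\<close>
  tends to infinity; since \<open>W\<close> is bounded, \<open>q\<^sup>3 + p\<^sup>3\<close> is of order two only, so \<open>p + \<rho> q\<close> is bounded
  for some \<open>\<rho>\<close>, and then so is the second coordinate of the last chart belonging to \<open>\<rho>\<close>. The system is
  polynomial in that chart as well, so the solution extends there to the end point, and the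
  expansions follow by comparing coefficients.
\<close>

section \<open>Continuation along rectifiable paths\<close>

text \<open>Neither \<open>H + p^2 / q\<close> nor \<open>H - q^2 / p\<close> can be followed by
  itself: q or p may vanish on the path while (q, p) is large, and avoiding such zeros would mean
  deforming the path. The denominator |q|^2 + |p|^2 of the blend vanishes only at the origin. Why a
  correction of H is needed: along solutions H' = q p, which is large, whereas (p^2 / q)' = - 2 q p
  - p^4 / q^2 up to lower order. If p^3 is close to - q^3, the latter is close to - q p, and the two
  derivatives cancel. The price of the blend is that W is not holomorphic: its derivative has a part
  linear in dz and a part linear in the conjugate of dz, and both are estimated. Moreover a
  rectifiable path need not be differentiable in its parameter, so the differential inequality is
  not integrated; instead ln (1 + |W|) is compared with sums of chord lengths.\<close>

lemma continuation_permanence: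
  fixes E :: "real \<Rightarrow> complex \<Rightarrow> complex"
  assumes T: "connected T" and \<gamma>: "continuous_on T \<gamma>"
    and an: "\<And>t. t \<in> T \<Longrightarrow> E t analytic_on {\<gamma> t}"
    and loc: "\<And>t. t \<in> T \<Longrightarrow> \<forall>\<^sub>F s in at t within T. \<forall>\<^sub>F z in nhds (\<gamma> s). E s z = E t z"
    and t0: "t0 \<in> T" "\<forall>\<^sub>F z in nhds (\<gamma> t0). E t0 z = 0" and t: "t \<in> T"
  shows "\<forall>\<^sub>F z in nhds (\<gamma> t). E t z = 0"
proof (rule connected_induction_simple[where P = "\<lambda>t. \<forall>\<^sub>F z in nhds (\<gamma> t). E t z = 0",
      OF T t0(1) t t0(2)])
  fix a assume a: "a \<in> T"
  from an[OF a] obtain r where r: "r > 0" and hol: "E a holomorphic_on ball (\<gamma> a) r"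
    by (auto simp: analytic_on_def)
  from loc[OF a] obtain d1 where d1: "d1 > 0"
    "\<And>s. s \<in> T \<Longrightarrow> s \<noteq> a \<Longrightarrow> dist s a < d1 \<Longrightarrow> \<forall>\<^sub>F z in nhds (\<gamma> s). E s z = E a z"
    by (auto simp: eventually_at)
  from \<gamma> a r obtain d2 where d2: "d2 > 0"
    "\<And>s. s \<in> T \<Longrightarrow> dist s a < d2 \<Longrightarrow> dist (\<gamma> s) (\<gamma> a) < r"
    unfolding continuous_on_iff by metis
  have eq: "\<forall>\<^sub>F z in nhds (\<gamma> s). E s z = E a z" if "s \<in> T" "dist s a < d1" for s
    using d1(2)[OF that(1) _ that(2)] by (cases "s = a") auto
  \<comment> \<open>By the identity theorem, vanishing near \<open>\<gamma> s\<close> amounts to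
    vanishing of the fixed element \<open>E a\<close> on the whole ball, a condition free of s. So
    the property is locally constant in the parameter, and connectedness of T does the rest.\<close>
  have iff: "(\<forall>\<^sub>F z in nhds (\<gamma> s). E s z = 0) \<longleftrightarrow> (\<forall>z\<in>ball (\<gamma> a) r. E a z = 0)"
    if s: "s \<in> T" "dist s a < min d1 d2" for s
  proof -
    have in_ball: "\<gamma> s \<in> ball (\<gamma> a) r"
      using d2(2)[of s] s by (simp add: dist_commute)
    have "(\<forall>\<^sub>F z in nhds (\<gamma> s). E s z = 0) \<longleftrightarrow> (\<forall>\<^sub>F z in nhds (\<gamma> s). E a z = 0)"
      by (rule eventually_cong[OF eq]) (use s in auto)
    also have "\<dots> \<longleftrightarrow> (\<forall>z\<in>ball (\<gamma> a) r. E a z = 0)"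
    proof
      assume "\<forall>\<^sub>F z in nhds (\<gamma> s). E a z = 0"
      then obtain V where V: "open V" "\<gamma> s \<in> V" "\<And>z. z \<in> V \<Longrightarrow> E a z = 0"
        by (auto simp: eventually_nhds)
      show "\<forall>z\<in>ball (\<gamma> a) r. E a z = 0"
      proof
        fix z assume z: "z \<in> ball (\<gamma> a) r"
        show "E a z = 0"
          by (rule analytic_continuation_open[of "V \<inter> ball (\<gamma> a) r" "ball (\<gamma> a) r" "E a" "\<lambda>_. 0"])
            (use V in_ball hol z in auto)
      qed
    next
      assume "\<forall>z\<in>ball (\<gamma> a) r. E a z = 0"
      then show "\<forall>\<^sub>F z in nhds (\<gamma> s). E a z = 0"
        using in_ball by (intro eventually_nhds_in_open[THEN eventually_mono, of "ball (\<gamma> a) r"]) auto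
    qed
    finally show ?thesis .
  qed
  show "\<exists>S. openin (top_of_set T) S \<and> a \<in> S \<and>
      (\<forall>x\<in>S. \<forall>y\<in>S. (\<forall>\<^sub>F z in nhds (\<gamma> x). E x z = 0) \<longrightarrow> (\<forall>\<^sub>F z in nhds (\<gamma> y). E y z = 0))"
    using d1(1) d2(1) a iff
    by (intro exI[of _ "T \<inter> ball a (min d1 d2)"]) (auto simp: dist_commute openin_open)
qed

text \<open>A discrete substitute for integration along a path without derivative. The local
  estimates hold near each parameter; a Lebesgue number of the resulting cover makes them valid for
  all pairs of close parameters, and then they are summed over a fine equidistant partition, whose
  chords have total length at most M.\<close>

lemma rectifiable_growth:
  fixes \<phi> :: "real \<Rightarrow> real"
  assumes M: "\<And>(n::nat) t. mono_on {..n} t \<Longrightarrow> t ` {..n} \<subseteq> {0..1} \<Longrightarrow>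
        (\<Sum>i<n. dist (\<gamma> (t i)) (\<gamma> (t (Suc i)))) \<le> M"
    and ab: "0 \<le> a" "a \<le> b" "b \<le> 1" and C: "C \<ge> 0"
    and loc: "\<And>t. t \<in> {a..b} \<Longrightarrow> \<exists>d>0. \<forall>s\<in>{a..b}. \<forall>s'\<in>{a..b}. dist s t < d \<longrightarrow> dist s' t < d \<longrightarrow>
        \<phi> s' \<le> \<phi> s + C * dist (\<gamma> s) (\<gamma> s')"
  shows "\<phi> b \<le> \<phi> a + C * M"
proof -
  from loc obtain d where d: "\<And>t. t \<in> {a..b} \<Longrightarrow> d t > 0"
    "\<And>t s s'. t \<in> {a..b} \<Longrightarrow> s \<in> {a..b} \<Longrightarrow> s' \<in> {a..b} \<Longrightarrow> dist s t < d t \<Longrightarrow> dist s' t < d t \<Longrightarrow>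
        \<phi> s' \<le> \<phi> s + C * dist (\<gamma> s) (\<gamma> s')"
    by metis
  obtain e where e: "e > 0" "\<And>x. x \<in> {a..b} \<Longrightarrow> \<exists>G\<in>(\<lambda>t. ball t (d t)) ` {a..b}. ball x e \<subseteq> G"
    by (rule Heine_Borel_lemma[of "{a..b}" "(\<lambda>t. ball t (d t)) ` {a..b}"])
      (use d(1) in \<open>auto intro!: bexI\<close>)
  have step: "\<phi> s' \<le> \<phi> s + C * dist (\<gamma> s) (\<gamma> s')" if "s \<in> {a..b}" "s' \<in> {a..b}" "dist s s' < e" for s s'
  proof -
    from e(2)[OF that(1)] obtain t where t: "t \<in> {a..b}" "ball s e \<subseteq> ball t (d t)" by auto
    moreover have "s \<in> ball s e" "s' \<in> ball s e" using that e(1) by auto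
    ultimately have "s \<in> ball t (d t)" "s' \<in> ball t (d t)" by blast+
    then have "dist s t < d t" "dist s' t < d t" by (auto simp: dist_commute)
    then show ?thesis using d(2)[OF t(1) that(1,2)] by blast
  qed
  obtain n :: nat where n: "(b - a) / e < real n"
    using reals_Archimedean2 by blast
  with e(1) ab have n0: "n > 0" by (cases n) (auto simp: divide_less_eq)
  define t where "t i = a + real i * ((b - a) / n)" for i
  have t_in: "t i \<in> {a..b}" if "i \<le> n" for i
  proof -
    have "real i * ((b - a) / n) \<le> real n * ((b - a) / n)"
      using that ab by (intro mult_right_mono) auto
    then show ?thesis using n0 ab by (auto simp: t_def)
  qed
  have "dist (t i) (t (Suc i)) < e" for i
  proof -
    have "t (Suc i) - t i = (b - a) / n" by (simp add: t_def algebra_simps add_divide_distrib diff_divide_distrib)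
    moreover have "(b - a) / n < e" using n n0 e(1) by (simp add: field_simps)
    moreover have "0 \<le> (b - a) / n" using ab by simp
    ultimately show ?thesis by (simp add: dist_real_def)
  qed
  then have st: "\<phi> (t (Suc i)) \<le> \<phi> (t i) + C * dist (\<gamma> (t i)) (\<gamma> (t (Suc i)))" if "i < n" for i
    using that t_in by (intro step) auto
  have "\<phi> (t m) \<le> \<phi> (t 0) + C * (\<Sum>i<m. dist (\<gamma> (t i)) (\<gamma> (t (Suc i))))" if "m \<le> n" for m
    using that
  proof (induction m)
    case (Suc m)
    then show ?case using st[of m] by (auto simp: algebra_simps)
  qed simp
  from this[of n] have "\<phi> (t n) \<le> \<phi> (t 0) + C * (\<Sum>i<n. dist (\<gamma> (t i)) (\<gamma> (t (Suc i))))" by simp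
  also have "\<dots> \<le> \<phi> (t 0) + C * M"
  proof -
    have "mono_on {..n} t"
      unfolding t_def using ab by (intro mono_onI add_left_mono mult_right_mono) auto
    moreover have "t ` {..n} \<subseteq> {0..1}" using t_in ab by fastforce
    ultimately show ?thesis using C by (intro add_left_mono mult_left_mono M)
  qed
  also have "t n = b" using n0 by (simp add: t_def)
  also have "t 0 = a" by (simp add: t_def)
  finally show ?thesis .
qed

section \<open>Polynomial systems of two differential equations\<close>

text \<open>The right-hand sides in the chart (q, p) and in the last chart of each \<rho> are
  polynomials in the time and the two unknowns. This class covers both systems by one existence and
  one uniqueness result, and bounds, Lipschitz constants and holomorphy follow by induction over its
  formation.\<close>

inductive poly3 :: "(complex \<Rightarrow> complex \<Rightarrow> complex \<Rightarrow> complex) \<Rightarrow> bool" where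
  poly3_const: "poly3 (\<lambda>z x y. c)"
| poly3_time: "poly3 (\<lambda>z x y. z)"
| poly3_fst: "poly3 (\<lambda>z x y. x)"
| poly3_snd: "poly3 (\<lambda>z x y. y)"
| poly3_add: "poly3 F \<Longrightarrow> poly3 G \<Longrightarrow> poly3 (\<lambda>z x y. F z x y + G z x y)"
| poly3_mult: "poly3 F \<Longrightarrow> poly3 G \<Longrightarrow> poly3 (\<lambda>z x y. F z x y * G z x y)"

lemma poly3_minus: "poly3 F \<Longrightarrow> poly3 (\<lambda>z x y. - F z x y)"
  using poly3_mult[OF poly3_const[of "-1"], of F] by simp

lemma poly3_diff: "poly3 F \<Longrightarrow> poly3 G \<Longrightarrow> poly3 (\<lambda>z x y. F z x y - G z x y)"
  using poly3_add[OF _ poly3_minus, of F G] by simp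

lemma poly3_power: "poly3 F \<Longrightarrow> poly3 (\<lambda>z x y. F z x y ^ n)"
  by (induction n) (auto intro: poly3_const poly3_mult)

lemma poly3_holomorphic:
  "poly3 F \<Longrightarrow> f holomorphic_on A \<Longrightarrow> g holomorphic_on A \<Longrightarrow> (\<lambda>z. F z (f z) (g z)) holomorphic_on A"
  by (induction rule: poly3.induct) (auto intro: holomorphic_intros)

lemma poly3_bounded:
  "poly3 F \<Longrightarrow> \<exists>B\<ge>0. \<forall>z x y. norm z \<le> K \<longrightarrow> norm x \<le> K \<longrightarrow> norm y \<le> K \<longrightarrow> norm (F z x y) \<le> B"
proof (induction rule: poly3.induct)
  case (poly3_const c)
  show ?case by (rule exI[of _ "norm c"]) auto
next
  case (poly3_add F G)
  then obtain B1 B2 where "B1 \<ge> 0" "B2 \<ge> 0"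
    "\<forall>z x y. norm z \<le> K \<longrightarrow> norm x \<le> K \<longrightarrow> norm y \<le> K \<longrightarrow> norm (F z x y) \<le> B1"
    "\<forall>z x y. norm z \<le> K \<longrightarrow> norm x \<le> K \<longrightarrow> norm y \<le> K \<longrightarrow> norm (G z x y) \<le> B2" by blast
  then show ?case by (intro exI[of _ "B1 + B2"]) (auto intro!: norm_triangle_mono)
next
  case (poly3_mult F G)
  then obtain B1 B2 where "B1 \<ge> 0" "B2 \<ge> 0"
    "\<forall>z x y. norm z \<le> K \<longrightarrow> norm x \<le> K \<longrightarrow> norm y \<le> K \<longrightarrow> norm (F z x y) \<le> B1"
    "\<forall>z x y. norm z \<le> K \<longrightarrow> norm x \<le> K \<longrightarrow> norm y \<le> K \<longrightarrow> norm (G z x y) \<le> B2" by blast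
  then show ?case by (intro exI[of _ "B1 * B2"]) (auto simp: norm_mult intro!: mult_mono)
qed (rule exI[of _ "max K 0"], auto)+

lemma poly3_lipschitz:
  "poly3 F \<Longrightarrow> \<exists>L\<ge>0. \<forall>z x y x' y'. norm z \<le> K \<longrightarrow> norm x \<le> K \<longrightarrow> norm y \<le> K \<longrightarrow>
     norm x' \<le> K \<longrightarrow> norm y' \<le> K \<longrightarrow>
     norm (F z x y - F z x' y') \<le> L * (norm (x - x') + norm (y - y'))"
proof (induction rule: poly3.induct)
  case (poly3_add F G)
  then obtain L1 L2 where L: "L1 \<ge> 0" "L2 \<ge> 0"
    "\<forall>z x y x' y'. norm z \<le> K \<longrightarrow> norm x \<le> K \<longrightarrow> norm y \<le> K \<longrightarrow>
     norm x' \<le> K \<longrightarrow> norm y' \<le> K \<longrightarrow>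
     norm (F z x y - F z x' y') \<le> L1 * (norm (x - x') + norm (y - y'))"
    "\<forall>z x y x' y'. norm z \<le> K \<longrightarrow> norm x \<le> K \<longrightarrow> norm y \<le> K \<longrightarrow>
     norm x' \<le> K \<longrightarrow> norm y' \<le> K \<longrightarrow>
     norm (G z x y - G z x' y') \<le> L2 * (norm (x - x') + norm (y - y'))" by blast
  show ?case
  proof (intro exI[of _ "L1 + L2"] conjI allI impI)
    fix z x y x' y' :: complex assume K: "norm z \<le> K" "norm x \<le> K" "norm y \<le> K" "norm x' \<le> K" "norm y' \<le> K"
    have "norm (F z x y + G z x y - (F z x' y' + G z x' y'))
        = norm ((F z x y - F z x' y') + (G z x y - G z x' y'))"
      by (simp add: algebra_simps)
    also have "\<dots> \<le> L1 * (norm (x - x') + norm (y - y')) + L2 * (norm (x - x') + norm (y - y'))"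
      using K by (intro norm_triangle_mono L(3,4)[rule_format])
    finally show "norm (F z x y + G z x y - (F z x' y' + G z x' y'))
       \<le> (L1 + L2) * (norm (x - x') + norm (y - y'))" by (simp add: algebra_simps)
  qed (use L(1,2) in auto)
next
  case (poly3_mult F G)
  then obtain L1 L2 where L: "L1 \<ge> 0" "L2 \<ge> 0"
    "\<forall>z x y x' y'. norm z \<le> K \<longrightarrow> norm x \<le> K \<longrightarrow> norm y \<le> K \<longrightarrow>
     norm x' \<le> K \<longrightarrow> norm y' \<le> K \<longrightarrow>
     norm (F z x y - F z x' y') \<le> L1 * (norm (x - x') + norm (y - y'))"
    "\<forall>z x y x' y'. norm z \<le> K \<longrightarrow> norm x \<le> K \<longrightarrow> norm y \<le> K \<longrightarrow>
     norm x' \<le> K \<longrightarrow> norm y' \<le> K \<longrightarrow>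
     norm (G z x y - G z x' y') \<le> L2 * (norm (x - x') + norm (y - y'))" by blast
  from poly3_bounded[OF poly3_mult.hyps(1)] obtain B1 where B1: "B1 \<ge> 0"
    "\<forall>z x y. norm z \<le> K \<longrightarrow> norm x \<le> K \<longrightarrow> norm y \<le> K \<longrightarrow> norm (F z x y) \<le> B1" by blast
  from poly3_bounded[OF poly3_mult.hyps(2)] obtain B2 where B2: "B2 \<ge> 0"
    "\<forall>z x y. norm z \<le> K \<longrightarrow> norm x \<le> K \<longrightarrow> norm y \<le> K \<longrightarrow> norm (G z x y) \<le> B2" by blast
  show ?case
  proof (intro exI[of _ "L1 * B2 + B1 * L2"] conjI allI impI)
    fix z x y x' y' :: complex assume K: "norm z \<le> K" "norm x \<le> K" "norm y \<le> K" "norm x' \<le> K" "norm y' \<le> K"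
    have "norm (F z x y * G z x y - F z x' y' * G z x' y')
        = norm ((F z x y - F z x' y') * G z x y + F z x' y' * (G z x y - G z x' y'))"
      by (simp add: algebra_simps)
    also have "\<dots> \<le> (L1 * (norm (x - x') + norm (y - y'))) * B2
        + B1 * (L2 * (norm (x - x') + norm (y - y')))"
    proof (intro norm_triangle_mono; unfold norm_mult; intro mult_mono)
      show "norm (F z x y - F z x' y') \<le> L1 * (norm (x - x') + norm (y - y'))"
        using K by (intro L(3)[rule_format])
      show "norm (G z x y - G z x' y') \<le> L2 * (norm (x - x') + norm (y - y'))"
        using K by (intro L(4)[rule_format])
      show "norm (G z x y) \<le> B2" using K by (intro B2(2)[rule_format])
      show "norm (F z x' y') \<le> B1" using K by (intro B1(2)[rule_format])
    qed (use L(1) B1(1) in auto)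
    finally show "norm (F z x y * G z x y - F z x' y' * G z x' y')
       \<le> (L1 * B2 + B1 * L2) * (norm (x - x') + norm (y - y'))" by (simp add: algebra_simps)
  qed (use L(1,2) B1(1) B2(1) in auto)
qed (rule exI[of _ 1], auto)+

section \<open>Uniqueness and existence of holomorphic solutions\<close>

definition solves ::
  "(complex \<Rightarrow> complex \<Rightarrow> complex \<Rightarrow> complex) \<Rightarrow> (complex \<Rightarrow> complex \<Rightarrow> complex \<Rightarrow> complex) \<Rightarrow>
   complex set \<Rightarrow> (complex \<Rightarrow> complex) \<Rightarrow> (complex \<Rightarrow> complex) \<Rightarrow> bool" where
  "solves F G A x y \<longleftrightarrow>
     (\<forall>z\<in>A. (x has_field_derivative F z (x z) (y z)) (at z) \<and>
             (y has_field_derivative G z (x z) (y z)) (at z))"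

lemma solves_holomorphic:
  assumes "solves F G A x y"
  shows "x holomorphic_on A" "y holomorphic_on A"
proof -
  show "x holomorphic_on A"
    unfolding holomorphic_on_def field_differentiable_def
  proof
    fix z assume "z \<in> A"
    then have "(x has_field_derivative F z (x z) (y z)) (at z)" using assms by (simp add: solves_def)
    then show "\<exists>f'. (x has_field_derivative f') (at z within A)"
      using has_field_derivative_at_within by blast
  qed
  show "y holomorphic_on A"
    unfolding holomorphic_on_def field_differentiable_def
  proof
    fix z assume "z \<in> A"
    then have "(y has_field_derivative G z (x z) (y z)) (at z)" using assms by (simp add: solves_def)
    then show "\<exists>f'. (y has_field_derivative f') (at z within A)"
      using has_field_derivative_at_within by blast
  qed
qed

text \<open>Contraction at the point w of a small closed disc where the difference D of the two
  solutions is largest: bounding the difference of the right-hand sides by the Lipschitz constants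
  along the way from \<open>z0\<close> to w gives D w at most half of itself.\<close>

lemma poly3_ode_unique:
  assumes F: "poly3 F" and G: "poly3 G" and A: "open A" "z0 \<in> A"
    and sol: "solves F G A x y" "solves F G A u v"
    and init: "x z0 = u z0" "y z0 = v z0"
  shows "\<forall>\<^sub>F z in nhds z0. x z = u z \<and> y z = v z"
proof -
  from A obtain r0 where r0: "r0 > 0" "cball z0 r0 \<subseteq> A"
    using open_contains_cball by blast
  have cont: "continuous_on (cball z0 r0) f" if "f holomorphic_on A" for f :: "complex \<Rightarrow> complex"
    using holomorphic_on_imp_continuous_on[OF that] continuous_on_subset r0(2) by blast
  note hol = solves_holomorphic[OF sol(1)] solves_holomorphic[OF sol(2)]
  have "bounded (f ` cball z0 r0)" if "f holomorphic_on A" for f :: "complex \<Rightarrow> complex"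
    by (intro compact_imp_bounded compact_continuous_image cont that) auto
  then have "bounded (cball z0 r0 \<union> x ` cball z0 r0 \<union> y ` cball z0 r0 \<union> u ` cball z0 r0 \<union> v ` cball z0 r0)"
    using hol by (auto simp: bounded_Un)
  then obtain K where K: "\<And>z. z \<in> cball z0 r0 \<Longrightarrow>
      norm z \<le> K \<and> norm (x z) \<le> K \<and> norm (y z) \<le> K \<and> norm (u z) \<le> K \<and> norm (v z) \<le> K"
    unfolding bounded_iff by (metis UnCI imageI)
  obtain L1 where L1: "L1 \<ge> 0"
    "\<And>z x y x' y'. norm z \<le> K \<Longrightarrow> norm x \<le> K \<Longrightarrow> norm y \<le> K \<Longrightarrow> norm x' \<le> K \<Longrightarrow> norm y' \<le> K \<Longrightarrow>
     norm (F z x y - F z x' y') \<le> L1 * (norm (x - x') + norm (y - y'))"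
    using poly3_lipschitz[OF F, of K] by blast
  obtain L2 where L2: "L2 \<ge> 0"
    "\<And>z x y x' y'. norm z \<le> K \<Longrightarrow> norm x \<le> K \<Longrightarrow> norm y \<le> K \<Longrightarrow> norm x' \<le> K \<Longrightarrow> norm y' \<le> K \<Longrightarrow>
     norm (G z x y - G z x' y') \<le> L2 * (norm (x - x') + norm (y - y'))"
    using poly3_lipschitz[OF G, of K] by blast
  \<comment> \<open>This radius makes \<open>r * (L1 + L2)\<close> at most 1/2; the 1 in the
    denominator covers the case that both Lipschitz constants vanish.\<close>
  define r where "r = min r0 (1 / (2 * (L1 + L2 + 1)))"
  have r: "r > 0" "r \<le> r0" using r0 L1(1) L2(1) by (auto simp: r_def)
  have "r * (L1 + L2) \<le> 1 / (2 * (L1 + L2 + 1)) * (L1 + L2)"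
    using L1(1) L2(1) by (intro mult_right_mono) (auto simp: r_def)
  also have "\<dots> \<le> 1/2" using L1(1) L2(1) by (simp add: field_simps)
  finally have rL: "r * (L1 + L2) \<le> 1/2" .
  define D where "D z = norm (x z - u z) + norm (y z - v z)" for z
  have "continuous_on (cball z0 r) D"
    unfolding D_def
    by (intro continuous_intros continuous_on_subset[OF cont] hol) (use r in auto)
  then obtain w where w: "w \<in> cball z0 r" "\<And>z. z \<in> cball z0 r \<Longrightarrow> D z \<le> D w"
    using continuous_attains_sup[of "cball z0 r" D] r(1) by auto
  have sub: "z \<in> cball z0 r0" "z \<in> A" if "z \<in> cball z0 r" for z
    using that r r0(2) by auto
  have w0: "norm (w - z0) \<le> r" using w(1) by (simp add: dist_norm norm_minus_commute)
  have "norm ((x w - u w) - (x z0 - u z0)) \<le> L1 * D w * norm (w - z0)"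
  proof (rule field_differentiable_bound[where S = "cball z0 r"])
    fix z assume z: "z \<in> cball z0 r"
    show "((\<lambda>z. x z - u z) has_field_derivative F z (x z) (y z) - F z (u z) (v z)) (at z within cball z0 r)"
      using sol sub[OF z] unfolding solves_def
      by (auto intro!: has_field_derivative_at_within[OF DERIV_diff])
    have "norm (F z (x z) (y z) - F z (u z) (v z)) \<le> L1 * D z"
      unfolding D_def using K[OF sub(1)[OF z]] by (intro L1(2)) auto
    also have "\<dots> \<le> L1 * D w" using L1(1) w(2)[OF z] by (rule mult_left_mono[rotated])
    finally show "norm (F z (x z) (y z) - F z (u z) (v z)) \<le> L1 * D w" .
  qed (use w r in auto)
  moreover have "norm ((y w - v w) - (y z0 - v z0)) \<le> L2 * D w * norm (w - z0)"
  proof (rule field_differentiable_bound[where S = "cball z0 r"])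
    fix z assume z: "z \<in> cball z0 r"
    show "((\<lambda>z. y z - v z) has_field_derivative G z (x z) (y z) - G z (u z) (v z)) (at z within cball z0 r)"
      using sol sub[OF z] unfolding solves_def
      by (auto intro!: has_field_derivative_at_within[OF DERIV_diff])
    have "norm (G z (x z) (y z) - G z (u z) (v z)) \<le> L2 * D z"
      unfolding D_def using K[OF sub(1)[OF z]] by (intro L2(2)) auto
    also have "\<dots> \<le> L2 * D w" using L2(1) w(2)[OF z] by (rule mult_left_mono[rotated])
    finally show "norm (G z (x z) (y z) - G z (u z) (v z)) \<le> L2 * D w" .
  qed (use w r in auto)
  ultimately have "D w \<le> (L1 + L2) * D w * norm (w - z0)"
    using init by (simp add: D_def algebra_simps)
  also have "\<dots> \<le> (L1 + L2) * D w * r"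
    using L1(1) L2(1) w0 by (intro mult_left_mono) (auto simp: D_def)
  also have "\<dots> = (r * (L1 + L2)) * D w" by simp
  also have "\<dots> \<le> 1/2 * D w" using rL by (intro mult_right_mono) (auto simp: D_def)
  finally have "D w \<le> 0" by simp
  then have D0: "D z \<le> 0" if "z \<in> ball z0 r" for z using w(2)[of z] that by auto
  have "x z = u z \<and> y z = v z" if "z \<in> ball z0 r" for z
  proof -
    have "norm (x z - u z) + norm (y z - v z) \<le> 0" using D0[OF that] by (simp add: D_def)
    then have "norm (x z - u z) = 0" "norm (y z - v z) = 0"
      using norm_ge_zero[of "x z - u z"] norm_ge_zero[of "y z - v z"] by linarith+
    then show ?thesis by simp
  qed
  then show ?thesis
    using r(1) by (intro eventually_nhds_in_open[THEN eventually_mono, of "ball z0 r"]) auto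
qed


text \<open>The integration step of the Picard iteration. A primitive exists because the ball is
  convex; it is normalised at the centre, and the mean value inequality bounds its deviation from
  there.\<close>

lemma normalized_primitive:
  fixes h :: "complex \<Rightarrow> complex"
  assumes h: "h holomorphic_on ball z0 r" and r: "r > 0"
    and B: "\<And>z. z \<in> ball z0 r \<Longrightarrow> norm (h z) \<le> B"
  shows "\<exists>H. (\<forall>z\<in>ball z0 r. (H has_field_derivative h z) (at z) \<and> norm (H z - w0) \<le> B * r) \<and> H z0 = w0"
proof -
  obtain H where H: "\<And>z. z \<in> ball z0 r \<Longrightarrow> (H has_field_derivative h z) (at z within ball z0 r)"
    using holomorphic_convex_primitive'[OF convex_ball open_ball h] by blast
  have bd: "norm (H z - H z0) \<le> B * r" if z: "z \<in> ball z0 r" for z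
  proof -
    have "norm (H z - H z0) \<le> B * norm (z - z0)"
      by (rule field_differentiable_bound[where S = "ball z0 r" and f' = h])
        (use H B z r in auto)
    also have "B \<ge> 0" using B[OF z] norm_ge_zero order_trans by blast
    then have "B * norm (z - z0) \<le> B * r"
      using z by (intro mult_left_mono) (auto simp: dist_norm norm_minus_commute)
    finally show ?thesis .
  qed
  have "((\<lambda>z. H z - H z0 + w0) has_field_derivative h z) (at z)" if "z \<in> ball z0 r" for z
    using H[OF that] that by (auto simp: at_within_open[of z "ball z0 r"] intro!: derivative_eq_intros)
  with bd show ?thesis by (intro exI[of _ "\<lambda>z. H z - H z0 + w0"]) auto
qed

text \<open>The uniform radius is what allows a solution to be carried over the end point of the path.\<close>
lemma poly3_ode_exists:
  assumes F: "poly3 F" and G: "poly3 G"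
  shows "\<exists>r>0. \<forall>z0 x0 y0. norm z0 \<le> K \<longrightarrow> norm x0 \<le> K \<longrightarrow> norm y0 \<le> K \<longrightarrow>
     (\<exists>x y. solves F G (ball z0 r) x y \<and> x z0 = x0 \<and> y z0 = y0)"
proof -
  obtain B1 where B1: "B1 \<ge> 0"
    "\<And>z x y. norm z \<le> K + 1 \<Longrightarrow> norm x \<le> K + 1 \<Longrightarrow> norm y \<le> K + 1 \<Longrightarrow> norm (F z x y) \<le> B1"
    using poly3_bounded[OF F, of "K + 1"] by blast
  obtain B2 where B2: "B2 \<ge> 0"
    "\<And>z x y. norm z \<le> K + 1 \<Longrightarrow> norm x \<le> K + 1 \<Longrightarrow> norm y \<le> K + 1 \<Longrightarrow> norm (G z x y) \<le> B2"
    using poly3_bounded[OF G, of "K + 1"] by blast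
  obtain L1 where L1: "L1 \<ge> 0"
    "\<And>z x y x' y'. norm z \<le> K + 1 \<Longrightarrow> norm x \<le> K + 1 \<Longrightarrow> norm y \<le> K + 1 \<Longrightarrow>
     norm x' \<le> K + 1 \<Longrightarrow> norm y' \<le> K + 1 \<Longrightarrow>
     norm (F z x y - F z x' y') \<le> L1 * (norm (x - x') + norm (y - y'))"
    using poly3_lipschitz[OF F, of "K + 1"] by blast
  obtain L2 where L2: "L2 \<ge> 0"
    "\<And>z x y x' y'. norm z \<le> K + 1 \<Longrightarrow> norm x \<le> K + 1 \<Longrightarrow> norm y \<le> K + 1 \<Longrightarrow>
     norm x' \<le> K + 1 \<Longrightarrow> norm y' \<le> K + 1 \<Longrightarrow>
     norm (G z x y - G z x' y') \<le> L2 * (norm (x - x') + norm (y - y'))"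
    using poly3_lipschitz[OF G, of "K + 1"] by blast
  \<comment> \<open>With radius 1 / c, the summands \<open>B1 + B2\<close> keep all iterates within
    distance 1 of the initial values, where the bounds for \<open>K + 1\<close> apply;
    \<open>2 * (L1 + L2)\<close> makes the iteration contract by 1/2; the last 1 gives
    \<open>r \<le> 1\<close>, so that z too stays below \<open>K + 1\<close>.\<close>
  define c where "c = B1 + B2 + 2 * (L1 + L2) + 1"
  define r where "r = 1 / c"
  have c: "c \<ge> 1" using B1(1) B2(1) L1(1) L2(1) by (simp add: c_def)
  then have r: "r > 0" "r \<le> 1" by (auto simp: r_def)
  have rb: "B1 * r \<le> 1" "B2 * r \<le> 1" "(L1 + L2) * r \<le> 1/2"
    using c B1(1) B2(1) L1(1) L2(1) by (auto simp: r_def c_def field_simps)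
  have "\<exists>x y. solves F G (ball z0 r) x y \<and> x z0 = x0 \<and> y z0 = y0"
    if z0: "norm z0 \<le> K" and x0: "norm x0 \<le> K" and y0: "norm y0 \<le> K" for z0 x0 y0
  proof -
    define U where "U = ball z0 r"
    have zU: "norm z \<le> K + 1" if "z \<in> U" for z
      using that z0 r norm_triangle_ineq2[of z z0] by (auto simp: U_def dist_norm norm_minus_commute)
    have z0U: "z0 \<in> U" using r by (simp add: U_def)
    \<comment> \<open>The invariant of the iterates, followed by the relation S between consecutive
      ones, in the shape that dependent choice over the naturals expects.\<close>
    define I where "I = (\<lambda>(n::nat) (f, g). f holomorphic_on U \<and> g holomorphic_on U \<and> f z0 = x0 \<and> g z0 = y0 \<and>
      (\<forall>z\<in>U. norm (f z - x0) \<le> 1 \<and> norm (g z - y0) \<le> 1))"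
    define S where "S = (\<lambda>(n::nat) (f, g) (f', g'). \<forall>z\<in>U.
      (f' has_field_derivative F z (f z) (g z)) (at z) \<and> (g' has_field_derivative G z (f z) (g z)) (at z))"
    have bnd: "norm (f z) \<le> K + 1" "norm (g z) \<le> K + 1" if "I n (f, g)" "z \<in> U" for n f g z
    proof -
      have "norm (f z - x0) \<le> 1" "norm (g z - y0) \<le> 1" using that by (auto simp: I_def)
      then show "norm (f z) \<le> K + 1" "norm (g z) \<le> K + 1"
        using x0 y0 norm_triangle_ineq2[of "f z" x0] norm_triangle_ineq2[of "g z" y0] by linarith+
    qed
    have I0: "\<exists>fg. I 0 fg" by (rule exI[of _ "(\<lambda>_. x0, \<lambda>_. y0)"]) (simp add: I_def)
    have step: "\<exists>fg'. I (Suc n) fg' \<and> S n fg fg'" if fg': "I n fg" for n fg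
    proof -
      obtain f g where fg: "fg = (f, g)" by (cases fg)
      have I: "I n (f, g)" using fg' fg by simp
      have hol: "f holomorphic_on ball z0 r" "g holomorphic_on ball z0 r"
        using I by (auto simp: I_def U_def)
      obtain f' where f': "\<And>z. z \<in> U \<Longrightarrow> (f' has_field_derivative F z (f z) (g z)) (at z)"
        "\<And>z. z \<in> U \<Longrightarrow> norm (f' z - x0) \<le> B1 * r" "f' z0 = x0"
        using normalized_primitive[OF poly3_holomorphic[OF F hol] r(1), of B1 x0] B1(2)[OF zU bnd[OF I]]
        unfolding U_def by blast
      obtain g' where g': "\<And>z. z \<in> U \<Longrightarrow> (g' has_field_derivative G z (f z) (g z)) (at z)"
        "\<And>z. z \<in> U \<Longrightarrow> norm (g' z - y0) \<le> B2 * r" "g' z0 = y0"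
        using normalized_primitive[OF poly3_holomorphic[OF G hol] r(1), of B2 y0] B2(2)[OF zU bnd[OF I]]
        unfolding U_def by blast
      have "f' holomorphic_on U" "g' holomorphic_on U"
        using f'(1) g'(1) unfolding U_def holomorphic_on_open[OF open_ball] by blast+
      moreover have "norm (f' z - x0) \<le> 1" "norm (g' z - y0) \<le> 1" if "z \<in> U" for z
        using f'(2)[OF that] g'(2)[OF that] rb by linarith+
      ultimately show ?thesis
        using f'(1,3) g'(1,3) by (intro exI[of _ "(f', g')"]) (auto simp: I_def S_def fg)
    qed
    obtain s where s: "\<And>n. I n (s n)" "\<And>n. S n (s n) (s (Suc n))"
      using dependent_nat_choice[of I S, OF I0 step] by blast
    define f where "f n = fst (s n)" for n
    define g where "g n = snd (s n)" for n
    have I: "I n (f n, g n)" for n using s(1)[of n] by (simp add: f_def g_def)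
    have df: "(f (Suc n) has_field_derivative F z (f n z) (g n z)) (at z)"
      and dg: "(g (Suc n) has_field_derivative G z (f n z) (g n z)) (at z)" if "z \<in> U" for n z
      using s(2)[of n] that by (auto simp: f_def g_def S_def split: prod.splits)
    have hol: "f n holomorphic_on U" "g n holomorphic_on U" for n using I[of n] by (auto simp: I_def)
    have init: "f n z0 = x0" "g n z0 = y0" for n using I[of n] by (auto simp: I_def)
    \<comment> \<open>Both components of every iterate stay within 1 of the initial values, so
      consecutive iterates differ by at most 2 + 2 in total: this is the 4.\<close>
    have contr: "norm (f (Suc n) z - f n z) + norm (g (Suc n) z - g n z) \<le> 4 * (1/2)^n"
      if "z \<in> U" for n z
      using that
    proof (induction n arbitrary: z)
      case 0
      have "norm (f m z - x0) \<le> 1" "norm (g m z - y0) \<le> 1" for m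
        using I[of m] 0 by (auto simp: I_def)
      then have "norm (f (Suc 0) z - f 0 z) \<le> 1 + 1" "norm (g (Suc 0) z - g 0 z) \<le> 1 + 1"
        using norm_triangle_ineq4[of "f (Suc 0) z - x0" "f 0 z - x0"]
          norm_triangle_ineq4[of "g (Suc 0) z - y0" "g 0 z - y0"] by (smt (verit) diff_diff_eq2 diff_add_cancel)+
      then show ?case by simp
    next
      case (Suc n)
      have zr: "norm (z - z0) \<le> r" using Suc.prems by (simp add: U_def dist_norm norm_minus_commute)
      have "norm ((f (Suc (Suc n)) z - f (Suc n) z) - (f (Suc (Suc n)) z0 - f (Suc n) z0))
          \<le> L1 * (4 * (1/2)^n) * norm (z - z0)"
      proof (rule field_differentiable_bound[where S = U])
        fix w assume w: "w \<in> U"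
        show "((\<lambda>z. f (Suc (Suc n)) z - f (Suc n) z) has_field_derivative
          F w (f (Suc n) w) (g (Suc n) w) - F w (f n w) (g n w)) (at w within U)"
          using df[OF w] by (auto intro!: has_field_derivative_at_within[OF DERIV_diff])
        have "norm (F w (f (Suc n) w) (g (Suc n) w) - F w (f n w) (g n w)) \<le>
          L1 * (norm (f (Suc n) w - f n w) + norm (g (Suc n) w - g n w))"
          by (intro L1(2) zU bnd[OF I] w)
        also have "\<dots> \<le> L1 * (4 * (1/2)^n)"
          by (intro mult_left_mono Suc.IH w L1(1))
        finally show "norm (F w (f (Suc n) w) (g (Suc n) w) - F w (f n w) (g n w)) \<le> L1 * (4 * (1/2)^n)" .
      qed (use Suc.prems z0U in \<open>auto simp: U_def\<close>)
      moreover have "norm ((g (Suc (Suc n)) z - g (Suc n) z) - (g (Suc (Suc n)) z0 - g (Suc n) z0))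
          \<le> L2 * (4 * (1/2)^n) * norm (z - z0)"
      proof (rule field_differentiable_bound[where S = U])
        fix w assume w: "w \<in> U"
        show "((\<lambda>z. g (Suc (Suc n)) z - g (Suc n) z) has_field_derivative
          G w (f (Suc n) w) (g (Suc n) w) - G w (f n w) (g n w)) (at w within U)"
          using dg[OF w] by (auto intro!: has_field_derivative_at_within[OF DERIV_diff])
        have "norm (G w (f (Suc n) w) (g (Suc n) w) - G w (f n w) (g n w)) \<le>
          L2 * (norm (f (Suc n) w - f n w) + norm (g (Suc n) w - g n w))"
          by (intro L2(2) zU bnd[OF I] w)
        also have "\<dots> \<le> L2 * (4 * (1/2)^n)"
          by (intro mult_left_mono Suc.IH w L2(1))
        finally show "norm (G w (f (Suc n) w) (g (Suc n) w) - G w (f n w) (g n w)) \<le> L2 * (4 * (1/2)^n)" .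
      qed (use Suc.prems z0U in \<open>auto simp: U_def\<close>)
      ultimately have "norm (f (Suc (Suc n)) z - f (Suc n) z) + norm (g (Suc (Suc n)) z - g (Suc n) z)
          \<le> (L1 + L2) * (4 * (1/2)^n) * norm (z - z0)"
        by (simp add: init algebra_simps)
      also have "\<dots> \<le> (L1 + L2) * (4 * (1/2)^n) * r"
        using L1(1) L2(1) zr by (intro mult_left_mono) auto
      also have "\<dots> = ((L1 + L2) * r) * (4 * (1/2)^n)" by simp
      also have "\<dots> \<le> 1/2 * (4 * (1/2)^n)" by (intro mult_right_mono rb) auto
      finally show ?case by simp
    qed
    have uc: "uniformly_convergent_on U h"
      if h: "\<And>n z. z \<in> U \<Longrightarrow> norm (h (Suc n) z - h n z) \<le> 4 * (1/2)^n"
      for h :: "nat \<Rightarrow> complex \<Rightarrow> complex"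
    proof -
      have "uniformly_convergent_on U (\<lambda>n z. \<Sum>i<n. h (Suc i) z - h i z)"
        by (rule Weierstrass_m_test'[OF h]) (auto intro!: summable_mult summable_geometric)
      then have "uniformly_convergent_on U (\<lambda>n z. (\<Sum>i<n. h (Suc i) z - h i z) + h 0 z)"
        by (intro uniformly_convergent_add) (auto simp: uniformly_convergent_on_const)
      moreover have "(\<Sum>i<n. h (Suc i) z - h i z) + h 0 z = h n z" for n z
        by (subst sum_lessThan_telescope[of "\<lambda>n. h n z"]) simp
      ultimately show ?thesis by simp
    qed
    have "uniformly_convergent_on U f"
    proof (rule uc)
      fix n z assume "z \<in> U"
      from contr[OF this, of n] show "norm (f (Suc n) z - f n z) \<le> 4 * (1/2)^n"
        using norm_ge_zero[of "g (Suc n) z - g n z"] by linarith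
    qed
    then obtain x where x: "uniform_limit U f x sequentially" by (auto simp: uniformly_convergent_on_def)
    have "uniformly_convergent_on U g"
    proof (rule uc)
      fix n z assume "z \<in> U"
      from contr[OF this, of n] show "norm (g (Suc n) z - g n z) \<le> 4 * (1/2)^n"
        using norm_ge_zero[of "f (Suc n) z - f n z"] by linarith
    qed
    then obtain y where y: "uniform_limit U g y sequentially" by (auto simp: uniformly_convergent_on_def)
    have lim: "(\<lambda>n. f n z) \<longlonglongrightarrow> x z" "(\<lambda>n. g n z) \<longlonglongrightarrow> y z" if "z \<in> U" for z
      using tendsto_uniform_limitI[OF x that] tendsto_uniform_limitI[OF y that] .
    \<comment> \<open>Locally uniform limits of holomorphic functions may be differentiated
      termwise. The derivative of iterate n + 1 is the right-hand side at iterate n, whence the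
      shifted index in the assumption D.\<close>
    have deriv_lim: "(h has_field_derivative D) (at z)"
      if ul: "uniform_limit U hn h sequentially" and hh: "\<And>n. hn n holomorphic_on U" and z: "z \<in> U"
        and D: "(\<lambda>n. deriv (hn (Suc n)) z) \<longlonglongrightarrow> D" for hn h D z
    proof -
      have loc: "\<And>w. w \<in> U \<Longrightarrow> \<exists>d>0. cball w d \<subseteq> U \<and> uniform_limit (cball w d) hn h sequentially"
      proof -
        fix w assume "w \<in> U"
        then obtain d where "d > 0" "cball w d \<subseteq> U"
          using open_contains_cball[THEN iffD1, OF open_ball] unfolding U_def by blast
        then show "\<exists>d>0. cball w d \<subseteq> U \<and> uniform_limit (cball w d) hn h sequentially"
          using uniform_limit_on_subset[OF ul] by blast
      qed
      have hol: "h holomorphic_on U"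
        by (rule holomorphic_uniform_sequence[OF _ hh loc]) (auto simp: U_def)
      obtain d where d: "d > 0" "cball z d \<subseteq> U" "uniform_limit (cball z d) hn h sequentially"
        using loc[OF z] by blast
      have "((\<lambda>n. (deriv ^^ 1) (hn n) z) \<longlongrightarrow> (deriv ^^ 1) h z) sequentially"
      proof (rule higher_deriv_complex_uniform_limit[where A = "ball z d"])
        show "uniform_limit (ball z d) hn h sequentially"
          by (rule uniform_limit_on_subset[OF d(3)]) auto
        show "\<forall>\<^sub>F n in sequentially. hn n holomorphic_on ball z d"
          using d(2) by (intro always_eventually allI holomorphic_on_subset[OF hh]) auto
      qed (use d in auto)
      then have "(\<lambda>n. deriv (hn n) z) \<longlonglongrightarrow> deriv h z" by simp
      then have "(\<lambda>n. deriv (hn (Suc n)) z) \<longlonglongrightarrow> deriv h z" by (rule LIMSEQ_Suc)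
      with D have "deriv h z = D" by (rule LIMSEQ_unique[rotated])
      then show ?thesis using holomorphic_derivI[OF hol _ z] by (simp add: U_def)
    qed
    have Flim: "(\<lambda>n. H z (f n z) (g n z)) \<longlonglongrightarrow> H z (x z) (y z)" if "poly3 H" "z \<in> U" for H z
      using that(1) by induction (auto intro!: tendsto_intros lim that)
    have "solves F G U x y"
      unfolding solves_def
    proof (intro ballI conjI)
      fix z assume z: "z \<in> U"
      show "(x has_field_derivative F z (x z) (y z)) (at z)"
        by (rule deriv_lim[OF x hol(1) z]) (use Flim[OF F z] DERIV_imp_deriv[OF df[OF z]] in simp)
      show "(y has_field_derivative G z (x z) (y z)) (at z)"
        by (rule deriv_lim[OF y hol(2) z]) (use Flim[OF G z] DERIV_imp_deriv[OF dg[OF z]] in simp)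
    qed
    moreover have "x z0 = x0" "y z0 = y0"
      using lim[OF z0U] by (auto simp: init LIMSEQ_const_iff)
    ultimately show ?thesis unfolding U_def by blast
  qed
  then show ?thesis using r(1) by blast
qed

section \<open>The system in the chart of the last exceptional curve\<close>

lemma Re_Im_omega: "Re omega = - 1 / 2" "Im omega = sqrt 3 / 2"
  by (simp_all add: omega_def)

lemma omega_sq: "omega\<^sup>2 = cnj omega" and omega_cnj: "omega * cnj omega = 1"
  by (simp_all add: complex_eq_iff power2_eq_square Re_Im_omega)

lemma cube_root_sq: "\<rho> \<in> cube_roots \<Longrightarrow> \<rho>\<^sup>2 = cnj \<rho>"
  using omega_sq complex_cnj_power[of omega 2] by (auto simp: cube_roots_def)

lemma cube_root_cnj: "\<rho> \<in> cube_roots \<Longrightarrow> \<rho> * cnj \<rho> = 1"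
  using omega_cnj by (auto simp: cube_roots_def mult.commute)

lemma cube_root_norm: "norm \<rho> = 1" if "\<rho> \<in> cube_roots"
proof -
  have "norm \<rho> * norm \<rho> = 1"
    using arg_cong[OF cube_root_cnj[OF that], of norm] by (simp add: norm_mult)
  then have "norm \<rho> = 1 \<or> norm \<rho> = - 1" by (simp only: square_eq_1_iff)
  moreover have "norm \<rho> \<noteq> - 1" using norm_ge_zero[of \<rho>] by linarith
  ultimately show ?thesis by blast
qed

lemma cube_root_cnj_sq: "\<rho> \<in> cube_roots \<Longrightarrow> (cnj \<rho>)\<^sup>2 = \<rho>"
  using cube_root_sq[of \<rho>] by (metis complex_cnj_cnj complex_cnj_power)

definition field_q where "field_q \<alpha> = (\<lambda>z x y :: complex. y\<^sup>2 + z * x + \<alpha>)"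
definition field_p where "field_p \<beta> = (\<lambda>z x y :: complex. - x\<^sup>2 - z * y - \<beta>)"

text \<open>Minus the second coordinate of the centre of the third blow-up.\<close>
definition shift :: "complex \<Rightarrow> complex \<Rightarrow> complex \<Rightarrow> complex" where
  "shift \<alpha> \<beta> \<rho> = 1 - cnj \<rho> * \<alpha> + \<rho> * \<beta>"

definition p_of :: "complex \<Rightarrow> complex \<Rightarrow> complex \<Rightarrow> complex \<Rightarrow> complex \<Rightarrow> complex \<Rightarrow> complex" where
  "p_of \<alpha> \<beta> \<rho> z a b = - \<rho> / a + cnj \<rho> * z - shift \<alpha> \<beta> \<rho> * a + a\<^sup>2 * b"

text \<open>The second coordinate \<open>q r\<close> of the last chart, with r arranged by powers of
  q as the successive blow-ups produce it: \<open>p + \<rho> * q\<close> is offset by the second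
  centre, and the outer summand by the third.\<close>

definition b_of :: "complex \<Rightarrow> complex \<Rightarrow> complex \<Rightarrow> complex \<Rightarrow> complex \<Rightarrow> complex \<Rightarrow> complex" where
  "b_of \<alpha> \<beta> \<rho> z q p = q * (shift \<alpha> \<beta> \<rho> + q * (p + \<rho> * q - cnj \<rho> * z))"

lemma pt_tilde2_eq_pt_qp':
  "a \<noteq> 0 \<Longrightarrow> pt_tilde2 \<alpha> \<beta> z \<rho> (a, b) = pt_qp (1 / a, p_of \<alpha> \<beta> \<rho> z a b)"
  by (simp add: pt_tilde2_eq_pt_qp p_of_def shift_def)

lemma p_of_b_of: "q \<noteq> 0 \<Longrightarrow> p_of \<alpha> \<beta> \<rho> z (1 / q) (b_of \<alpha> \<beta> \<rho> z q p) = p"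
  by (simp add: p_of_def b_of_def field_simps power2_eq_square)

lemma b_of_p_of: "a \<noteq> 0 \<Longrightarrow> b_of \<alpha> \<beta> \<rho> z (1 / a) (p_of \<alpha> \<beta> \<rho> z a b) = b"
  by (simp add: p_of_def b_of_def field_simps power2_eq_square)

text \<open>\<open>w\<close> is \<open>p + \<rho> q - \<rho>\<^sup>2 z\<close> and \<open>s\<close> is \<open>p + \<rho> q\<close>, for \<open>q = 1 / a\<close> and \<open>b = q (k + q w)\<close>.\<close>
definition field_a :: "complex \<Rightarrow> complex \<Rightarrow> complex \<Rightarrow> complex \<Rightarrow> complex \<Rightarrow> complex \<Rightarrow> complex" where
  "field_a \<alpha> \<beta> \<rho> = (\<lambda>z a b. let w = a\<^sup>2 * b - shift \<alpha> \<beta> \<rho> * a; s = cnj \<rho> * z + w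
     in - ((a * s - \<rho>)\<^sup>2 + z * a + \<alpha> * a\<^sup>2))"

definition field_b :: "complex \<Rightarrow> complex \<Rightarrow> complex \<Rightarrow> complex \<Rightarrow> complex \<Rightarrow> complex \<Rightarrow> complex" where
  "field_b \<alpha> \<beta> \<rho> = (\<lambda>z a b. let k = shift \<alpha> \<beta> \<rho>; w = a\<^sup>2 * b - k * a; s = cnj \<rho> * z + w
     in (2 * a * b - k) * (s\<^sup>2 + \<alpha>) - 2 * \<rho> * b * (s + w) + \<rho> * k * (a * b - k) + \<rho> * s * b)"

lemmas poly3_intros = poly3_const poly3_time poly3_fst poly3_snd poly3_add poly3_mult
  poly3_diff poly3_minus poly3_power

lemma poly3_field_q: "poly3 (field_q \<alpha>)" and poly3_field_p: "poly3 (field_p \<beta>)"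
  unfolding field_q_def field_p_def by (intro poly3_intros)+

lemma poly3_field_a: "poly3 (field_a \<alpha> \<beta> \<rho>)" and poly3_field_b: "poly3 (field_b \<alpha> \<beta> \<rho>)"
  unfolding field_a_def field_b_def Let_def by (intro poly3_intros)+

lemma field_a_of_q:
  assumes "q \<noteq> 0"
  shows "field_a \<alpha> \<beta> \<rho> z (1 / q) (b_of \<alpha> \<beta> \<rho> z q p) = - field_q \<alpha> z q p / q\<^sup>2"
proof -
  have "(1 / q)\<^sup>2 * b_of \<alpha> \<beta> \<rho> z q p - shift \<alpha> \<beta> \<rho> * (1 / q) = p + \<rho> * q - cnj \<rho> * z"
    using assms by (simp add: b_of_def field_simps power2_eq_square)
  moreover have "1 / q * (cnj \<rho> * z + (p + \<rho> * q - cnj \<rho> * z)) - \<rho> = p / q"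
    using assms by (simp add: field_simps)
  ultimately show ?thesis
    unfolding field_a_def Let_def field_q_def using assms by (simp add: field_simps power2_eq_square)
qed

text \<open>This is where the three centres matter. Put s = c z + w, so p = s - r q, and expand in
  powers of q. The terms in q^4 cancel because r c = 1, those in q^3 because w is measured from c z,
  and those in q^2 free of w because of the value of k. What remains involves q only through q w and
  k q + q^2 w; for a = 1 / q and b = k q + q^2 w these are a b - k and b, so the result is
  polynomial in a and b.\<close>

lemma field_b_algebra:
  fixes q w s k z r c \<alpha> \<beta> p :: complex
  assumes "r * c = 1" "r\<^sup>2 = c" "c\<^sup>2 = r" and k: "k = 1 - c * \<alpha> + r * \<beta>"
    and w: "w = p + r * q - c * z"
  shows "(p\<^sup>2 + z * q + \<alpha>) * (k + 2 * q * w)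
     + q\<^sup>2 * ((- q\<^sup>2 - z * p - \<beta>) + r * (p\<^sup>2 + z * q + \<alpha>) - c) =
    (2 * q * w + k) * ((c * z + w)\<^sup>2 + \<alpha>) - 2 * r * (k * q + q\<^sup>2 * w) * (c * z + w + w)
     + r * k * q * w + r * (c * z + w) * (k * q + q\<^sup>2 * w)"
proof -
  have p: "p = w - r * q + c * z" using w by simp
  show ?thesis unfolding p k using assms(1-3) by algebra
qed

lemma field_b_of_qp:
  assumes \<rho>: "\<rho> \<in> cube_roots" and q: "q \<noteq> 0"
  shows "field_b \<alpha> \<beta> \<rho> z (1 / q) (b_of \<alpha> \<beta> \<rho> z q p) =
    field_q \<alpha> z q p * (shift \<alpha> \<beta> \<rho> + 2 * q * (p + \<rho> * q - cnj \<rho> * z))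
     + q\<^sup>2 * (field_p \<beta> z q p + \<rho> * field_q \<alpha> z q p - cnj \<rho>)"
proof -
  define w where "w = p + \<rho> * q - cnj \<rho> * z"
  define k where "k = shift \<alpha> \<beta> \<rho>"
  have b: "b_of \<alpha> \<beta> \<rho> z q p = k * q + q\<^sup>2 * w"
    by (simp add: b_of_def w_def k_def algebra_simps power2_eq_square)
  have e: "(1 / q)\<^sup>2 * (k * q + q\<^sup>2 * w) - k * (1 / q) = w"
    "2 * (1 / q) * (k * q + q\<^sup>2 * w) - k = 2 * q * w + k"
    "1 / q * (k * q + q\<^sup>2 * w) - k = q * w"
    using q by (simp_all add: field_simps power2_eq_square)
  show ?thesis
    unfolding b field_b_def Let_def k_def[symmetric] w_def[symmetric] e
    unfolding field_q_def field_p_def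
    using field_b_algebra[OF cube_root_cnj[OF \<rho>] cube_root_sq[OF \<rho>] cube_root_cnj_sq[OF \<rho>] _ w_def,
        of k \<alpha> \<beta>]
    by (simp add: k_def shift_def mult.assoc)
qed

lemma solves_tilde:
  assumes \<rho>: "\<rho> \<in> cube_roots" and sol: "solves (field_q \<alpha>) (field_p \<beta>) A q p"
    and nz: "\<And>z. z \<in> A \<Longrightarrow> q z \<noteq> 0"
  shows "solves (field_a \<alpha> \<beta> \<rho>) (field_b \<alpha> \<beta> \<rho>) A (\<lambda>z. 1 / q z) (\<lambda>z. b_of \<alpha> \<beta> \<rho> z (q z) (p z))"
  unfolding solves_def
proof (intro ballI conjI)
  fix z assume z: "z \<in> A"
  from sol z have dq: "(q has_field_derivative field_q \<alpha> z (q z) (p z)) (at z)"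
    and dp: "(p has_field_derivative field_p \<beta> z (q z) (p z)) (at z)" by (auto simp: solves_def)
  show "((\<lambda>z. 1 / q z) has_field_derivative
      field_a \<alpha> \<beta> \<rho> z (1 / q z) (b_of \<alpha> \<beta> \<rho> z (q z) (p z))) (at z)"
    unfolding field_a_of_q[OF nz[OF z]] using nz[OF z]
    by (auto intro!: derivative_eq_intros dq simp: power2_eq_square)
  show "((\<lambda>z. b_of \<alpha> \<beta> \<rho> z (q z) (p z)) has_field_derivative
      field_b \<alpha> \<beta> \<rho> z (1 / q z) (b_of \<alpha> \<beta> \<rho> z (q z) (p z))) (at z)"
    unfolding field_b_of_qp[OF \<rho> nz[OF z]] unfolding b_of_def
    by (auto intro!: derivative_eq_intros dq dp) (simp add: algebra_simps power2_eq_square)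
qed

lemma solves_qp:
  assumes \<rho>: "\<rho> \<in> cube_roots" and sol: "solves (field_a \<alpha> \<beta> \<rho>) (field_b \<alpha> \<beta> \<rho>) A a b"
    and nz: "\<And>z. z \<in> A \<Longrightarrow> a z \<noteq> 0"
  shows "solves (field_q \<alpha>) (field_p \<beta>) A (\<lambda>z. 1 / a z) (\<lambda>z. p_of \<alpha> \<beta> \<rho> z (a z) (b z))"
  unfolding solves_def
proof (intro ballI conjI)
  fix z assume z: "z \<in> A"
  define q where "q = 1 / a z"
  define p where "p = p_of \<alpha> \<beta> \<rho> z (a z) (b z)"
  define k where "k = shift \<alpha> \<beta> \<rho>"
  define w where "w = p + \<rho> * q - cnj \<rho> * z"
  have q: "q \<noteq> 0" "a z = 1 / q" using nz[OF z] by (auto simp: q_def)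
  \<comment> \<open>Writing b through q and p allows the formulas for \<open>field_a\<close> and
    \<open>field_b\<close> at (q, p) to be reused in the backward direction.\<close>
  have b: "b z = b_of \<alpha> \<beta> \<rho> z q p"
    using b_of_p_of[OF nz[OF z]] by (simp add: p_def q_def)
  have b': "b z = k * q + q\<^sup>2 * w"
    unfolding b by (simp add: b_of_def w_def k_def algebra_simps power2_eq_square)
  have da: "(a has_field_derivative - field_q \<alpha> z q p / q\<^sup>2) (at z)"
    using sol z field_a_of_q[OF q(1), of \<alpha> \<beta> \<rho> z p] by (auto simp: solves_def q(2) b)
  have db: "(b has_field_derivative field_q \<alpha> z q p * (k + 2 * q * w)
     + q\<^sup>2 * (field_p \<beta> z q p + \<rho> * field_q \<alpha> z q p - cnj \<rho>)) (at z)"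
    using sol z field_b_of_qp[OF \<rho> q(1), of \<alpha> \<beta> z p] by (auto simp: solves_def q(2) b k_def w_def)
  show "((\<lambda>z. 1 / a z) has_field_derivative field_q \<alpha> z (1 / a z) (p_of \<alpha> \<beta> \<rho> z (a z) (b z))) (at z)"
    unfolding q_def[symmetric] p_def[symmetric] using nz[OF z] q
    by (auto intro!: derivative_eq_intros da simp: power2_eq_square field_simps)
  show "((\<lambda>z. p_of \<alpha> \<beta> \<rho> z (a z) (b z)) has_field_derivative
      field_p \<beta> z (1 / a z) (p_of \<alpha> \<beta> \<rho> z (a z) (b z))) (at z)"
    unfolding q_def[symmetric] p_def[symmetric] unfolding p_of_def k_def[symmetric]
    using q by (auto intro!: derivative_eq_intros da db simp: b') (simp add: field_simps power2_eq_square)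
qed

section \<open>A function of controlled growth\<close>

text \<open>The last term is the mean of p^2 / q and - q^2 / p with weights |q|^2 and |p|^2: the
  conjugates in the numerator absorb the denominators q and p.\<close>

definition W :: "complex \<Rightarrow> complex \<Rightarrow> complex \<Rightarrow> complex \<Rightarrow> complex \<Rightarrow> complex" where
  "W \<alpha> \<beta> z q p = (q^3 + p^3) / 3 + z * q * p + \<alpha> * p + \<beta> * q
     + (cnj q * p\<^sup>2 - cnj p * q\<^sup>2) / (q * cnj q + p * cnj p)"

definition nrm2 :: "complex \<Rightarrow> complex \<Rightarrow> real" where
  "nrm2 q p = sqrt ((norm q)\<^sup>2 + (norm p)\<^sup>2)"

lemma nrm2_le: "norm q \<le> nrm2 q p" "norm p \<le> nrm2 q p"
  by (auto simp: nrm2_def intro!: real_le_rsqrt)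

lemma nrm2_sq: "of_real ((nrm2 q p)\<^sup>2) = q * cnj q + p * cnj p"
  by (simp add: nrm2_def flip: complex_norm_square)

text \<open>Here \<open>Q\<close>, \<open>P\<close>, \<open>Z\<close>, \<open>A\<close>, \<open>B\<close> stand for the conjugates of \<open>q\<close>, \<open>p\<close>, \<open>z\<close>, \<open>\<alpha>\<close>, \<open>\<beta>\<close>. The
  right-hand sides contain the factor \<open>q\<^sup>3 + p\<^sup>3\<close>, up to lower order terms three times the
  Hamiltonian: the leading terms cancel along the asymptotic directions \<open>p = - \<rho> q\<close>.\<close>
lemma W_holomorphic_part:
  fixes q p Q P z \<alpha> \<beta> :: complex
  assumes "D = q * Q + p * P" "n = Q * p\<^sup>2 - P * q\<^sup>2"
    "q1 = p\<^sup>2 + z * q + \<alpha>" "p1 = - q\<^sup>2 - z * p - \<beta>"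
  shows "(q * p) * D\<^sup>2 + (2 * Q * p * p1 - 2 * P * q * q1) * D - n * (Q * q1 + P * p1) =
    - (q^3 + p^3 + 3 * z * q * p) * (Q\<^sup>2 * p + P\<^sup>2 * q) - z * P * Q * (q^3 + p^3)
    + \<alpha> * (- 2 * P * q * D - n * Q) - \<beta> * (2 * Q * p * D - n * P)"
  unfolding assms by algebra

text \<open>The left-hand side is D^2 times the coefficient of the conjugate increment in the
  derivative of n / D. The Hamiltonian is holomorphic and adds nothing to it.\<close>

lemma W_antiholomorphic_part:
  fixes q p Q P Z A B :: complex
  assumes "D = q * Q + p * P" "n = Q * p\<^sup>2 - P * q\<^sup>2"
    "Q1 = P\<^sup>2 + Z * Q + A" "P1 = - Q\<^sup>2 - Z * P - B"
  shows "(Q1 * p\<^sup>2 - P1 * q\<^sup>2) * D - n * (q * Q1 + p * P1) =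
    (q^3 + p^3) * (Q^3 + P^3) + 2 * Z * P * Q * (q^3 + p^3)
    + A * (p\<^sup>2 * D - n * q) + B * (q\<^sup>2 * D + n * p)"
  unfolding assms by algebra

lemma W_has_derivative:
  assumes dq: "(q has_field_derivative q1) (at z)" and dp: "(p has_field_derivative p1) (at z)"
    and D: "D = q z * cnj (q z) + p z * cnj (p z)" "D \<noteq> 0"
    and n: "n = cnj (q z) * (p z)\<^sup>2 - cnj (p z) * (q z)\<^sup>2"
    and q1: "q1 = field_q \<alpha> z (q z) (p z)" and p1: "p1 = field_p \<beta> z (q z) (p z)"
  shows "((\<lambda>z. W \<alpha> \<beta> z (q z) (p z)) has_derivative (\<lambda>h.
     ((q z * p z) * D\<^sup>2 + (2 * cnj (q z) * p z * p1 - 2 * cnj (p z) * q z * q1) * D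
        - n * (cnj (q z) * q1 + cnj (p z) * p1)) / D\<^sup>2 * h
     + ((cnj q1 * (p z)\<^sup>2 - cnj p1 * (q z)\<^sup>2) * D - n * (q z * cnj q1 + p z * cnj p1)) / D\<^sup>2 * cnj h))
     (at z)"
proof -
  note dq' = dq[THEN has_field_derivative_imp_has_derivative] and dp' = dp[THEN has_field_derivative_imp_has_derivative]
  \<comment> \<open>The system is Hamiltonian with q' = dH/dp and p' = - dH/dq, so only the explicit
    dependence on z, through z q p, survives in the total derivative.\<close>
  have H: "((\<lambda>z. ((q z)^3 + (p z)^3) / 3 + z * q z * p z + \<alpha> * p z + \<beta> * q z) has_field_derivative
     q z * p z) (at z)"
    by (auto intro!: derivative_eq_intros dq dp simp: q1 p1 field_q_def field_p_def) 
       (simp add: field_simps power2_eq_square)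
  have N: "((\<lambda>z. cnj (q z) * (p z)\<^sup>2 - cnj (p z) * (q z)\<^sup>2) has_derivative
      (\<lambda>h. (2 * cnj (q z) * p z * p1 - 2 * cnj (p z) * q z * q1) * h
        + (cnj q1 * (p z)\<^sup>2 - cnj p1 * (q z)\<^sup>2) * cnj h)) (at z)"
    by (auto intro!: derivative_eq_intros dq' dp' simp: algebra_simps)
  have D': "((\<lambda>z. q z * cnj (q z) + p z * cnj (p z)) has_derivative
      (\<lambda>h. (cnj (q z) * q1 + cnj (p z) * p1) * h + (q z * cnj q1 + p z * cnj p1) * cnj h)) (at z)"
    by (auto intro!: derivative_eq_intros dq' dp' simp: algebra_simps)
  have "((\<lambda>z. W \<alpha> \<beta> z (q z) (p z)) has_derivative (\<lambda>h. q z * p z * h +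
     (((2 * cnj (q z) * p z * p1 - 2 * cnj (p z) * q z * q1) * h
        + (cnj q1 * (p z)\<^sup>2 - cnj p1 * (q z)\<^sup>2) * cnj h) * D
       - n * ((cnj (q z) * q1 + cnj (p z) * p1) * h + (q z * cnj q1 + p z * cnj p1) * cnj h)) / (D * D)))
     (at z)"
    unfolding W_def D(1) n
    by (intro has_derivative_add H[THEN has_field_derivative_imp_has_derivative]
        has_derivative_divide'[OF N D', THEN has_derivative_eq_rhs]) (use D in auto)
  then show ?thesis
    by (rule has_derivative_eq_rhs) (use D(2) in \<open>simp add: fun_eq_iff field_simps power2_eq_square\<close>)
qed

text \<open>With \<open>R\<close> the length of \<open>(q, p)\<close> and \<open>N = q\<^sup>3 + p\<^sup>3\<close>, \<open>N\<close> is bounded both by a multiple of \<open>R\<^sup>3\<close>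
  and by \<open>3 |W|\<close> up to \<open>O(R\<^sup>2)\<close>, whence \<open>|N|\<^sup>2 / R\<^sup>4\<close> is at most linear in \<open>|W|\<close>.\<close>
lemma W_controls_cubic:
  assumes R: "R = nrm2 q p" "R \<ge> 1" and z: "norm z \<le> Z" and c: "c = norm \<alpha> + norm \<beta>"
    and E: "E = norm (W \<alpha> \<beta> z q p)"
  shows "norm (cnj q * p\<^sup>2 - cnj p * q\<^sup>2) \<le> 2 * R^3"
    "norm (q^3 + p^3) \<le> 2 * R^3"
    "norm (q^3 + p^3 + 3 * z * q * p) \<le> 3 * E + (6 + 3 * c) * R"
    "norm (q^3 + p^3) \<le> 3 * E + (6 + 3 * c + 3 * Z) * R\<^sup>2"
proof -
  have qR: "norm q \<le> R" "norm p \<le> R" using nrm2_le R by auto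
  have R0: "R \<ge> 0" using R by simp
  have Z0: "Z \<ge> 0" using z norm_ge_zero order_trans by blast
  have pw: "norm x * norm y ^ 2 \<le> R^3" "norm x ^ 3 \<le> R^3" if "norm x \<le> R" "norm y \<le> R" for x y :: complex
  proof -
    have "norm x * norm y ^ 2 \<le> R * R^2" using that R0 by (intro mult_mono power_mono) auto
    then show "norm x * norm y ^ 2 \<le> R^3" by (simp add: power3_eq_cube power2_eq_square)
  qed (use that in \<open>auto intro: power_mono\<close>)
  have "norm (cnj q * p\<^sup>2 - cnj p * q\<^sup>2) \<le> norm q * norm p ^ 2 + norm p * norm q ^ 2"
    by (rule order_trans[OF norm_triangle_ineq4]) (simp add: norm_mult norm_power)
  also have "\<dots> \<le> 2 * R^3" using pw(1)[OF qR] pw(1)[OF qR(2,1)] by simp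
  finally show n: "norm (cnj q * p\<^sup>2 - cnj p * q\<^sup>2) \<le> 2 * R^3" .
  have "norm (q^3 + p^3) \<le> norm q ^ 3 + norm p ^ 3"
    by (rule order_trans[OF norm_triangle_ineq]) (simp add: norm_power)
  also have "\<dots> \<le> 2 * R^3" using pw(2)[OF qR(1) qR(1)] pw(2)[OF qR(2) qR(2)] by simp
  finally show "norm (q^3 + p^3) \<le> 2 * R^3" .
  define f where "f = (cnj q * p\<^sup>2 - cnj p * q\<^sup>2) / (q * cnj q + p * cnj p)"
  have "norm f = norm (cnj q * p\<^sup>2 - cnj p * q\<^sup>2) / R\<^sup>2"
    unfolding f_def nrm2_sq[symmetric] R(1)[symmetric] norm_divide norm_of_real by simp
  also have "\<dots> \<le> 2 * R" using n R(2) by (simp add: divide_le_eq power3_eq_cube power2_eq_square)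
  finally have f: "norm f \<le> 2 * R" .
  have "norm (\<alpha> * p + \<beta> * q) \<le> norm \<alpha> * norm p + norm \<beta> * norm q"
    by (rule order_trans[OF norm_triangle_ineq]) (simp add: norm_mult)
  also have "\<dots> \<le> norm \<alpha> * R + norm \<beta> * R" by (intro add_mono mult_left_mono qR) auto
  finally have ab: "norm (\<alpha> * p + \<beta> * q) \<le> c * R" by (simp add: c algebra_simps)
  have "q^3 + p^3 + 3 * z * q * p = 3 * W \<alpha> \<beta> z q p - 3 * f - 3 * (\<alpha> * p + \<beta> * q)"
    unfolding W_def f_def[symmetric] by (simp add: field_simps)
  also have "norm \<dots> \<le> 3 * E + 3 * (2 * R) + 3 * (c * R)"
  proof -
    have "norm (3 * W \<alpha> \<beta> z q p - 3 * f - 3 * (\<alpha> * p + \<beta> * q)) \<le>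
       norm (3 * W \<alpha> \<beta> z q p) + norm (3 * f) + norm (3 * (\<alpha> * p + \<beta> * q))"
      by (meson norm_triangle_ineq4 order_trans add_right_mono)
    then show ?thesis using f ab unfolding norm_mult[of 3] E by simp
  qed
  also have "\<dots> = 3 * E + (6 + 3 * c) * R" by (simp add: algebra_simps)
  finally show M: "norm (q^3 + p^3 + 3 * z * q * p) \<le> 3 * E + (6 + 3 * c) * R" .
  have "norm (q^3 + p^3) = norm ((q^3 + p^3 + 3 * z * q * p) - 3 * z * q * p)" by simp
  also have "\<dots> \<le> norm (q^3 + p^3 + 3 * z * q * p) + norm (3 * z * q * p)" by (rule norm_triangle_ineq4)
  also have "norm (3 * z * q * p) \<le> 3 * Z * R * R"
    unfolding norm_mult using qR z R0 Z0 by (intro mult_mono) auto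
  also have "norm (q^3 + p^3 + 3 * z * q * p) \<le> 3 * E + (6 + 3 * c) * R\<^sup>2"
  proof -
    have "(6 + 3 * c) * R \<le> (6 + 3 * c) * R\<^sup>2"
      using R(2) by (intro mult_left_mono) (auto simp: power2_eq_square c)
    then show ?thesis using M by simp
  qed
  finally show "norm (q^3 + p^3) \<le> 3 * E + (6 + 3 * c + 3 * Z) * R\<^sup>2"
    by (simp add: algebra_simps power2_eq_square)
qed


text \<open>The square comes from the squared constant \<kappa> in the bound for |q^3 + p^3|^2. The
  number 100 is a round majorant of the coefficient sums 12 + 20 + 54 and 12 + 27 in the step
  \<open>total\<close> of the next proof.\<close>

definition growth :: "real \<Rightarrow> real \<Rightarrow> real" where
  "growth c Z = 100 * (1 + c + Z)\<^sup>2"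

text \<open>The derivative sends h to (HA h + HB h') / D^2, with h' the conjugate of h and |D^2| =
  R^4. So both numerators must be bounded by R^4 (1 + |W|) up to a constant, although their degrees
  in (q, p) suggest R^6; the factors M and N make up for the difference.\<close>

lemma W_derivative_bound:
  assumes dq: "(q has_field_derivative field_q \<alpha> z (q z) (p z)) (at z)"
    and dp: "(p has_field_derivative field_p \<beta> z (q z) (p z)) (at z)"
    and R1: "nrm2 (q z) (p z) \<ge> 1" and z: "norm z \<le> Z"
  shows "\<exists>d. ((\<lambda>z. W \<alpha> \<beta> z (q z) (p z)) has_derivative d) (at z) \<and>
     (\<forall>h. norm (d h) \<le> growth (norm \<alpha> + norm \<beta>) Z * (1 + norm (W \<alpha> \<beta> z (q z) (p z))) * norm h)"
proof -
  define x y where "x = q z" and "y = p z"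
  define R E c where "R = nrm2 x y" and "E = norm (W \<alpha> \<beta> z x y)" and "c = norm \<alpha> + norm \<beta>"
  define D where "D = x * cnj x + y * cnj y"
  define n where "n = cnj x * y\<^sup>2 - cnj y * x\<^sup>2"
  define N where "N = x^3 + y^3"
  define M where "M = x^3 + y^3 + 3 * z * x * y"
  define \<kappa> where "\<kappa> = 6 + 3 * c + 3 * Z"
  define q1 p1 where "q1 = field_q \<alpha> z x y" and "p1 = field_p \<beta> z x y"
  have R: "R \<ge> 1" using R1 by (simp add: R_def x_def y_def)
  have R0: "R \<ge> 0" using R by simp
  have D_R: "D = of_real (R\<^sup>2)" by (simp only: D_def R_def nrm2_sq)
  have D0: "D \<noteq> 0" using R by (simp add: D_R)
  have nD: "norm D = R\<^sup>2" "norm (D\<^sup>2) = R^4" by (simp_all add: D_R norm_power)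
  note ctl = W_controls_cubic[OF R_def R z c_def E_def]
  have n: "norm n \<le> 2 * R^3" and N3: "norm N \<le> 2 * R^3"
    and M: "norm M \<le> 3 * E + (6 + 3 * c) * R" and N: "norm N \<le> 3 * E + \<kappa> * R\<^sup>2"
    using ctl by (simp_all add: n_def N_def M_def \<kappa>_def)
  have xR: "norm x \<le> R" "norm y \<le> R" using nrm2_le R_def by auto
  have c0: "c \<ge> 0" "norm \<alpha> \<le> c" "norm \<beta> \<le> c" by (auto simp: c_def)
  have Z0: "Z \<ge> 0" using z norm_ge_zero order_trans by blast
  have E0: "E \<ge> 0" by (simp add: E_def)
  have \<kappa>0: "\<kappa> \<ge> 6" using c0 Z0 by (simp add: \<kappa>_def)
  have R4: "R^4 > 0" using R by simp
  have RR: "R ^ 2 \<le> R ^ 4" "R ^ 3 \<le> R ^ 4" "1 \<le> R ^ 4"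
    using R by (auto intro: power_increasing one_le_power)
  have cub: "norm a * norm b * norm d \<le> R^3" if "norm a \<le> R" "norm b \<le> R" "norm d \<le> R" for a b d :: complex
  proof -
    have "norm a * norm b * norm d \<le> R * R * R" using that R0 by (intro mult_mono) auto
    then show ?thesis by (simp add: power3_eq_cube)
  qed
  have quart: "norm a * norm b * norm D \<le> R^4" if "norm a \<le> R" "norm b \<le> R" for a b :: complex
  proof -
    have "norm a * norm b * norm D \<le> R * R * R\<^sup>2" using that R0 nD by (intro mult_mono) auto
    then show ?thesis by (simp add: power4_eq_xxxx power2_eq_square)
  qed
  have nq: "norm n * norm a \<le> 2 * R^4" if "norm a \<le> R" for a :: complex
  proof -
    have "norm n * norm a \<le> 2 * R^3 * R" using that R0 n by (intro mult_mono) auto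
    then show ?thesis by (simp add: power4_eq_xxxx power3_eq_cube)
  qed
  define HA where "HA = (x * y) * D\<^sup>2 + (2 * cnj x * y * p1 - 2 * cnj y * x * q1) * D
        - n * (cnj x * q1 + cnj y * p1)"
  define HB where "HB = (cnj q1 * y\<^sup>2 - cnj p1 * x\<^sup>2) * D - n * (x * cnj q1 + y * cnj p1)"
  have HA: "HA = - M * ((cnj x)\<^sup>2 * y + (cnj y)\<^sup>2 * x) - z * cnj y * cnj x * N
    + \<alpha> * (- 2 * cnj y * x * D - n * cnj x) - \<beta> * (2 * cnj x * y * D - n * cnj y)"
    unfolding HA_def M_def N_def
    by (rule W_holomorphic_part) (simp_all add: D_def n_def q1_def p1_def field_q_def field_p_def)
  have HB: "HB = N * cnj N + 2 * cnj z * cnj y * cnj x * N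
    + cnj \<alpha> * (y\<^sup>2 * D - n * x) + cnj \<beta> * (x\<^sup>2 * D + n * y)"
    unfolding HB_def N_def complex_cnj_add complex_cnj_power
    by (rule W_antiholomorphic_part) (simp_all add: D_def n_def q1_def p1_def field_q_def field_p_def)
  have zN: "norm (z * cnj y * cnj x * N) \<le> Z * (3 * E + \<kappa>) * R^4"
  proof -
    have "norm (z * cnj y * cnj x * N) \<le> Z * R * R * (3 * E + \<kappa> * R\<^sup>2)"
      unfolding norm_mult using z xR R0 Z0 N by (intro mult_mono) auto
    also have "\<dots> = Z * (3 * E * R\<^sup>2 + \<kappa> * R^4)"
      by (simp add: algebra_simps power2_eq_square power4_eq_xxxx)
    also have "\<dots> \<le> Z * (3 * E * R^4 + \<kappa> * R^4)"
      using Z0 E0 RR by (intro mult_left_mono add_right_mono) auto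
    finally show ?thesis by (simp add: algebra_simps)
  qed
  \<comment> \<open>The term for which the correction was designed. By degree it would be of order
    R^6, but M, expressed through W, is only of order R + E.\<close>
  have "norm (M * ((cnj x)\<^sup>2 * y + (cnj y)\<^sup>2 * x)) \<le> (3 * E + (6 + 3 * c) * R) * (2 * R^3)"
  proof -
    have "norm ((cnj x)\<^sup>2 * y + (cnj y)\<^sup>2 * x) \<le> norm x * norm x * norm y + norm y * norm y * norm x"
      by (rule order_trans[OF norm_triangle_ineq]) (simp add: norm_mult norm_power power2_eq_square)
    also have "\<dots> \<le> 2 * R^3" using cub[of x x y] cub[of y y x] xR by simp
    finally show ?thesis unfolding norm_mult[of M] using M E0 c0 R0 by (intro mult_mono) auto
  qed
  also have "\<dots> = 6 * E * R^3 + (12 + 6 * c) * R^4"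
    by (simp add: algebra_simps power3_eq_cube power4_eq_xxxx)
  also have "\<dots> \<le> 6 * E * R^4 + (12 + 6 * c) * R^4"
    using E0 RR by (intro add_right_mono mult_left_mono) auto
  finally have t1: "norm (M * ((cnj x)\<^sup>2 * y + (cnj y)\<^sup>2 * x)) \<le> (6 * E + 12 + 6 * c) * R^4"
    by (simp add: algebra_simps)
  have t2: "norm (\<alpha> * (- 2 * cnj y * x * D - n * cnj x)) \<le> c * (4 * R^4)"
  proof -
    have "norm (- 2 * cnj y * x * D - n * cnj x) \<le> 2 * (norm y * norm x * norm D) + norm n * norm x"
      by (rule order_trans[OF norm_triangle_ineq4]) (simp add: norm_mult)
    also have "\<dots> \<le> 4 * R^4" using quart[of y x] nq[of x] xR by simp
    finally show ?thesis unfolding norm_mult[of \<alpha>] using c0 by (intro mult_mono) auto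
  qed
  have t3: "norm (\<beta> * (2 * cnj x * y * D - n * cnj y)) \<le> c * (4 * R^4)"
  proof -
    have "norm (2 * cnj x * y * D - n * cnj y) \<le> 2 * (norm x * norm y * norm D) + norm n * norm y"
      by (rule order_trans[OF norm_triangle_ineq4]) (simp add: norm_mult)
    also have "\<dots> \<le> 4 * R^4" using quart[of x y] nq[of y] xR by simp
    finally show ?thesis unfolding norm_mult[of \<beta>] using c0 by (intro mult_mono) auto
  qed
  have t4: "norm (cnj \<alpha> * (y\<^sup>2 * D - n * x)) \<le> c * (3 * R^4)"
  proof -
    have "norm (y\<^sup>2 * D - n * x) \<le> norm y * norm y * norm D + norm n * norm x"
      by (rule order_trans[OF norm_triangle_ineq4]) (simp add: norm_mult power2_eq_square)
    also have "\<dots> \<le> 3 * R^4" using quart[of y y] nq[of x] xR by simp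
    finally show ?thesis unfolding norm_mult[of "cnj \<alpha>"] using c0 by (intro mult_mono) auto
  qed
  have t5: "norm (cnj \<beta> * (x\<^sup>2 * D + n * y)) \<le> c * (3 * R^4)"
  proof -
    have "norm (x\<^sup>2 * D + n * y) \<le> norm x * norm x * norm D + norm n * norm y"
      by (rule order_trans[OF norm_triangle_ineq]) (simp add: norm_mult power2_eq_square)
    also have "\<dots> \<le> 3 * R^4" using quart[of x x] nq[of y] xR by simp
    finally show ?thesis unfolding norm_mult[of "cnj \<beta>"] using c0 by (intro mult_mono) auto
  qed
  \<comment> \<open>Bounding both factors by \<open>3 * E + \<kappa> * R\<^sup>2\<close> would
    produce E^2. The product is split instead: the cubic bound for N goes with \<open>3 * E\<close>,
    and the bound through E goes with \<open>\<kappa> * R\<^sup>2\<close>. The result is linear in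
    E, as a Gronwall argument requires.\<close>
  have t6: "norm (N * cnj N) \<le> (6 * E + 3 * E * \<kappa> + \<kappa>\<^sup>2) * R^4"
  proof -
    have "norm (N * cnj N) \<le> norm N * (3 * E + \<kappa> * R\<^sup>2)"
      using N by (simp add: norm_mult mult_left_mono)
    also have "\<dots> = norm N * (3 * E) + norm N * (\<kappa> * R\<^sup>2)" by (simp add: algebra_simps)
    also have "\<dots> \<le> 2 * R^3 * (3 * E) + (3 * E + \<kappa> * R\<^sup>2) * (\<kappa> * R\<^sup>2)"
      using N3 N E0 \<kappa>0 by (intro add_mono mult_right_mono) auto
    also have "\<dots> = 6 * E * R^3 + 3 * E * \<kappa> * R^2 + \<kappa>\<^sup>2 * R^4"
      by (simp add: algebra_simps power2_eq_square power4_eq_xxxx)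
    also have "\<dots> \<le> 6 * E * R^4 + 3 * E * \<kappa> * R^4 + \<kappa>\<^sup>2 * R^4"
      using E0 \<kappa>0 RR by (intro add_right_mono add_mono mult_left_mono) auto
    finally show ?thesis by (simp add: algebra_simps)
  qed
  have nHA: "norm HA \<le> (6 * E + 12 + 6 * c + Z * (3 * E + \<kappa>) + 8 * c) * R^4"
  proof -
    have "norm HA \<le> norm (M * ((cnj x)\<^sup>2 * y + (cnj y)\<^sup>2 * x)) + norm (z * cnj y * cnj x * N)
      + norm (\<alpha> * (- 2 * cnj y * x * D - n * cnj x)) + norm (\<beta> * (2 * cnj x * y * D - n * cnj y))"
      unfolding HA mult_minus_left
      by (intro order_trans[OF norm_triangle_ineq4] order_trans[OF norm_triangle_ineq] add_mono order_refl) simp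
    then show ?thesis using t1 t2 t3 zN by (simp add: algebra_simps)
  qed
  have nHB: "norm HB \<le> (6 * E + 3 * E * \<kappa> + \<kappa>\<^sup>2 + 2 * (Z * (3 * E + \<kappa>)) + 6 * c) * R^4"
  proof -
    have e: "norm (2 * cnj z * cnj y * cnj x * N) = 2 * norm (z * cnj y * cnj x * N)"
      by (simp add: norm_mult)
    have "norm HB \<le> norm (N * cnj N) + norm (2 * cnj z * cnj y * cnj x * N)
      + norm (cnj \<alpha> * (y\<^sup>2 * D - n * x)) + norm (cnj \<beta> * (x\<^sup>2 * D + n * y))"
      unfolding HB
      by (intro order_trans[OF norm_triangle_ineq] add_mono order_refl)
    then show ?thesis using t4 t5 t6 zN unfolding e by (simp add: algebra_simps)
  qed
  define S where "S = 1 + c + Z"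
  have S: "S \<ge> 1" "c \<le> S" "Z \<le> S" "\<kappa> \<le> 6 * S" using c0 Z0 by (auto simp: S_def \<kappa>_def)
  have total: "(6 * E + 12 + 6 * c + Z * (3 * E + \<kappa>) + 8 * c)
      + (6 * E + 3 * E * \<kappa> + \<kappa>\<^sup>2 + 2 * (Z * (3 * E + \<kappa>)) + 6 * c) \<le> 100 * S\<^sup>2 * (1 + E)"
  proof -
    have b: "Z * \<kappa> \<le> S * (6 * S)" "\<kappa>\<^sup>2 \<le> (6 * S)\<^sup>2" "E * \<kappa> \<le> E * (6 * S)" "Z * E \<le> S * E"
      using S \<kappa>0 Z0 E0 by (intro mult_mono power_mono; simp)+
    have s: "1 \<le> S\<^sup>2" "S \<le> S\<^sup>2" "E * S \<le> E * S\<^sup>2" "E \<le> E * S\<^sup>2"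
    proof -
      show S1: "1 \<le> S\<^sup>2" using S by simp
      show SS: "S \<le> S\<^sup>2" using S by (simp add: power2_eq_square)
      show "E * S \<le> E * S\<^sup>2" using SS E0 by (rule mult_left_mono)
      show "E \<le> E * S\<^sup>2" using mult_left_mono[OF S1 E0] by simp
    qed
    have "(6 * E + 12 + 6 * c + Z * (3 * E + \<kappa>) + 8 * c)
      + (6 * E + 3 * E * \<kappa> + \<kappa>\<^sup>2 + 2 * (Z * (3 * E + \<kappa>)) + 6 * c)
      = 12 * E + 12 + 20 * c + 9 * (Z * E) + 3 * (Z * \<kappa>) + 3 * (E * \<kappa>) + \<kappa>\<^sup>2"
      by (simp add: algebra_simps)
    also have "\<dots> \<le> 12 * E + 12 + 20 * S + 9 * (S * E) + 3 * (S * (6 * S)) + 3 * (E * (6 * S)) + (6 * S)\<^sup>2"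
      using b S(2) by linarith
    also have "\<dots> = 12 * E + 12 + 20 * S + 27 * (E * S) + 54 * S\<^sup>2"
      by (simp add: algebra_simps power2_eq_square)
    also have "\<dots> \<le> 100 * S\<^sup>2 + 100 * (E * S\<^sup>2)" using s S E0 by linarith
    finally show ?thesis by (simp add: algebra_simps)
  qed
  show ?thesis
  proof (intro exI conjI allI)
    show "((\<lambda>z. W \<alpha> \<beta> z (q z) (p z)) has_derivative (\<lambda>h. HA / D\<^sup>2 * h + HB / D\<^sup>2 * cnj h)) (at z)"
      unfolding HA_def HB_def x_def y_def
      by (rule W_has_derivative)
        (use dq dp D0 in \<open>simp_all add: D_def n_def q1_def p1_def x_def y_def\<close>)
    fix h
    have "norm (HA / D\<^sup>2 * h + HB / D\<^sup>2 * cnj h) \<le> norm HA / R^4 * norm h + norm HB / R^4 * norm h"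
      by (rule order_trans[OF norm_triangle_ineq]) (simp add: norm_mult norm_divide nD)
    also have "\<dots> = (norm HA + norm HB) / R^4 * norm h" by (simp add: add_divide_distrib distrib_right)
    also have "\<dots> \<le> (100 * S\<^sup>2 * (1 + E)) * norm h"
    proof (rule mult_right_mono)
      have "norm HA + norm HB \<le> (100 * S\<^sup>2 * (1 + E)) * R^4"
        using nHA nHB mult_right_mono[OF total, of "R^4"] R4 by (simp add: distrib_right)
      then show "(norm HA + norm HB) / R^4 \<le> 100 * S\<^sup>2 * (1 + E)"
        using R4 by (simp add: divide_le_eq)
    qed simp
    finally show "norm (HA / D\<^sup>2 * h + HB / D\<^sup>2 * cnj h) \<le>
      growth (norm \<alpha> + norm \<beta>) Z * (1 + norm (W \<alpha> \<beta> z (q z) (p z))) * norm h"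
      by (simp add: growth_def S_def c_def E_def x_def y_def)
  qed
qed

section \<open>From bounded W to bounded coordinates in a last chart\<close>

text \<open>Expresses b = q (k + q w), up to the unit c, through H + p^2 / q and s. The only other
  trace of b is the factor q w = b / q - k, in which b is divided by q; if s is bounded and q is
  large, that term can be absorbed into the left-hand side.\<close>

lemma tilde_identity:
  assumes r: "r * c = 1" "r\<^sup>2 = c" "c\<^sup>2 = r" and k: "k = 1 - c * \<alpha> + r * \<beta>" and q: "q \<noteq> 0"
    and s: "s = p + r * q" and w: "w = s - c * z"
  shows "c * (q * (k + q * w)) = ((q^3 + p^3) / 3 + z * q * p + \<alpha> * p + \<beta> * q + p\<^sup>2 / q)
     + r * s * (q * w) - (s^3 + 3 * \<alpha> * s - 6 * r * s) / 3 - s\<^sup>2 / (q::complex)"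
proof -
  have p: "p = s - r * q" using s by simp
  \<comment> \<open>Naming the two quotients turns the claim, multiplied by 3 q, into a consequence
    of polynomial relations, which \<open>algebra\<close> can decide.\<close>
  define u v where "u = p\<^sup>2 / q" and "v = s\<^sup>2 / q"
  have uv: "q * u = p\<^sup>2" "q * v = s\<^sup>2" using q by (simp_all add: u_def v_def)
  have "q * (3 * (c * (q * (k + q * w)))) = q * (q^3 + p^3 + 3 * (z * q * p + \<alpha> * p + \<beta> * q + u)
     + 3 * (r * s * (q * w)) - (s^3 + 3 * \<alpha> * s - 6 * r * s) - 3 * v)"
    using uv r unfolding w k p by algebra
  then have "3 * (c * (q * (k + q * w))) = q^3 + p^3 + 3 * (z * q * p + \<alpha> * p + \<beta> * q + u)
     + 3 * (r * s * (q * w)) - (s^3 + 3 * \<alpha> * s - 6 * r * s) - 3 * v"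
    using q by simp
  moreover have third: "L = (N / 3 + a + b + d + u) + e - f / 3 - v"
    if "3 * L = N + 3 * (a + b + d + u) + 3 * e - f - 3 * v" for L N a b d e f :: complex
  proof -
    have "L = (3 * L) / 3" by simp
    then show ?thesis unfolding that by (simp add: add_divide_distrib diff_divide_distrib)
  qed
  ultimately show ?thesis unfolding u_def[symmetric] v_def[symmetric] by blast
qed

lemma cube_root_times_omega: "\<rho> \<in> cube_roots \<Longrightarrow> \<rho> * omega \<in> cube_roots \<and> \<rho> * cnj omega \<in> cube_roots"
  using omega_sq omega_cnj complex_cnj_power[of omega 2]
  by (auto simp: cube_roots_def mult.commute[of "cnj omega" omega] power2_eq_square)

lemma cubic_factor:
  "\<rho> \<in> cube_roots \<Longrightarrow> q^3 + p^3 = (p + \<rho> * q) * (p + \<rho> * omega * q) * (p + \<rho> * cnj omega * q)"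
proof -
  assume r: "\<rho> \<in> cube_roots"
  have r3: "\<rho> ^ 3 = 1" using cube_root_sq[OF r] cube_root_cnj[OF r]
    by (simp add: power3_eq_cube power2_eq_square mult.commute)
  have o: "omega + cnj omega = -1" by (simp add: complex_eq_iff Re_Im_omega)
  show ?thesis using r3 o omega_cnj by algebra
qed

text \<open>q^3 + p^3 is the product of the three factors p + \<rho> q. The \<rho> of the smallest
  factor s is chosen; the other two factors are at least |q| / 2, so |q^3 + p^3| = O(R^2) bounds s.
  Then \<open>tilde_identity\<close> converts the bounds for W and s into one for the last
  coordinate.\<close>

lemma chart_bound:
  fixes Z Wb :: real
  assumes "Wb \<ge> 0" "Z \<ge> 0"
  shows "\<exists>K R0. \<forall>z q p. norm z \<le> Z \<longrightarrow> norm (W \<alpha> \<beta> z q p) \<le> Wb \<longrightarrow> nrm2 q p \<ge> R0 \<longrightarrow>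
     (\<exists>\<rho>\<in>cube_roots. q \<noteq> 0 \<and> norm (1 / q) \<le> K \<and> norm (b_of \<alpha> \<beta> \<rho> z q p) \<le> K)"
proof -
  define c where "c = norm \<alpha> + norm \<beta>"
  define \<kappa> where "\<kappa> = 3 * Wb + 6 + 3 * c + 3 * Z"
  \<comment> \<open>The bound for the smallest factor s. Here 24 = 4 * 6: a factor 2 for each of the
    two larger factors, and 6 from R^2 \<le> 6 |q|^2.\<close>
  define S where "S = 24 * \<kappa>"
  define C1 where "C1 = Wb + 3 * \<kappa> + S^3 + c * S + 2 * S + S\<^sup>2"
  \<comment> \<open>C1 collects the terms free of b. The factor 2 pays for absorbing half of the
    left-hand side, and the maximum with 1 takes care of 1 / q.\<close>
  define K where "K = max 1 (2 * (C1 + S * (1 + c)))"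
  have c0: "c \<ge> 0" "norm \<alpha> \<le> c" by (auto simp: c_def)
  have \<kappa>6: "\<kappa> \<ge> 6" using assms c0 by (simp add: \<kappa>_def)
  have S0: "S \<ge> 144" using \<kappa>6 by (simp add: S_def)
  have "\<exists>\<rho>\<in>cube_roots. q \<noteq> 0 \<and> norm (1 / q) \<le> K \<and> norm (b_of \<alpha> \<beta> \<rho> z q p) \<le> K"
    if z: "norm z \<le> Z" and Wb: "norm (W \<alpha> \<beta> z q p) \<le> Wb" and R0: "nrm2 q p \<ge> 144 * \<kappa>" for z q p
  proof -
    define R where "R = nrm2 q p"
    define N where "N = q^3 + p^3"
    \<comment> \<open>The threshold 144 \<kappa> serves twice: it gives \<kappa> \<le> R / 8 and
      thereby |s| \<le> R / 2, and, once R \<le> 3 |q| is known, it gives |q| \<ge> 48 \<kappa> = 2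
      S.\<close>
    have R1: "R \<ge> 144 * \<kappa>" "R \<ge> 1" using R0 \<kappa>6 by (auto simp: R_def)
    have "norm N \<le> 3 * Wb + (6 + 3 * c + 3 * Z) * R\<^sup>2"
      using W_controls_cubic(4)[OF R_def R1(2) z c_def refl] Wb by (simp add: N_def)
    also have "3 * Wb \<le> 3 * Wb * R\<^sup>2" using R1(2) assms(1) by (simp add: mult_le_cancel_left1)
    finally have N: "norm N \<le> \<kappa> * R\<^sup>2" by (simp add: \<kappa>_def algebra_simps)
    obtain \<rho> where \<rho>: "\<rho> \<in> cube_roots" and
      mini: "\<And>\<rho>'. \<rho>' \<in> cube_roots \<Longrightarrow> norm (p + \<rho> * q) \<le> norm (p + \<rho>' * q)"
    proof -
      have "finite cube_roots" "cube_roots \<noteq> {}" by (auto simp: cube_roots_def)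
      then show ?thesis
        using that[of "arg_min_on (\<lambda>\<rho>. norm (p + \<rho> * q)) cube_roots"]
          arg_min_if_finite(1) arg_min_least[of cube_roots _ "\<lambda>\<rho>. norm (p + \<rho> * q)"] by blast
    qed
    define s where "s = p + \<rho> * q"
    define t1 where "t1 = p + \<rho> * omega * q"
    define t2 where "t2 = p + \<rho> * cnj omega * q"
    have st: "norm s \<le> norm t1" "norm s \<le> norm t2"
      using mini cube_root_times_omega[OF \<rho>] unfolding s_def t1_def t2_def by blast+
    have Nf: "norm N = norm s * norm t1 * norm t2"
      using cubic_factor[OF \<rho>, of q p] by (simp add: N_def s_def t1_def t2_def norm_mult)
    have "norm s ^ 3 \<le> norm N"
      unfolding Nf power3_eq_cube using st by (intro mult_mono) auto
    also have "\<dots> \<le> \<kappa> * R\<^sup>2" by (rule N)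
    also have "\<dots> \<le> (R / 8) * R\<^sup>2" using R1 \<kappa>6 by (intro mult_right_mono) auto
    also have "\<dots> = (R / 2) ^ 3" by (simp add: power3_eq_cube power2_eq_square)
    finally have sR: "norm s \<le> R / 2" using R1(2) power_le_imp_le_base[of "norm s" 2 "R/2"]
      by (simp add: eval_nat_numeral)
    \<comment> \<open>As s is at most half of the length R, the modulus of p exceeds that of q by at
      most R / 2; hence q carries a fixed share of the length.\<close>
    have "norm p \<le> norm s + norm (\<rho> * q)"
      using norm_triangle_ineq4[of s "\<rho> * q"] by (simp add: s_def)
    then have "norm p \<le> norm s + norm q" by (simp add: norm_mult cube_root_norm[OF \<rho>])
    then have "(norm p)\<^sup>2 \<le> (norm s + norm q)\<^sup>2" by (intro power_mono) auto
    also have "\<dots> \<le> 2 * (norm s)\<^sup>2 + 2 * (norm q)\<^sup>2"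
      using sum_squares_bound[of "norm s" "norm q"] by (simp add: power2_sum)
    also have "(norm s)\<^sup>2 \<le> (R / 2)\<^sup>2" using sR by (intro power_mono) auto
    finally have "(norm p)\<^sup>2 \<le> R\<^sup>2 / 2 + 2 * (norm q)\<^sup>2" by (simp add: power_divide)
    moreover have "R\<^sup>2 = (norm q)\<^sup>2 + (norm p)\<^sup>2" by (simp add: R_def nrm2_def)
    ultimately have q6: "R\<^sup>2 \<le> 6 * (norm q)\<^sup>2" by linarith
    also have "\<dots> \<le> (3 * norm q)\<^sup>2" by (simp add: power_mult_distrib)
    finally have qR: "R \<le> 3 * norm q" by (rule power2_le_imp_le) simp
    have q0: "q \<noteq> 0" using qR R1 by auto
    have q2S: "norm q \<ge> 2 * S" "norm q \<ge> 1" using qR R1 \<kappa>6 unfolding S_def by linarith+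
    have om: "norm (omega - 1) \<ge> 1" "norm (cnj omega - 1) \<ge> 1"
      using abs_Re_le_cmod[of "omega - 1"] abs_Re_le_cmod[of "cnj omega - 1"] by (auto simp: Re_Im_omega)
    \<comment> \<open>The difference of two of the linear factors is a multiple of q, and s is the
      smallest of them, so each of the other two is at least |q| / 2.\<close>
    have tq: "norm q \<le> 2 * norm (p + \<rho> * x * q)" if "norm (x - 1) \<ge> 1" "norm s \<le> norm (p + \<rho> * x * q)" for x
    proof -
      have "norm q \<le> norm (x - 1) * norm q" using that(1) by (simp add: mult_le_cancel_right1)
      also have "\<dots> = norm (\<rho> * (x - 1) * q)" by (simp add: norm_mult cube_root_norm[OF \<rho>])
      also have "\<dots> = norm ((p + \<rho> * x * q) - s)" by (simp add: s_def algebra_simps)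
      also have "\<dots> \<le> norm (p + \<rho> * x * q) + norm s" by (rule norm_triangle_ineq4)
      finally show ?thesis using that(2) by simp
    qed
    have "norm q \<le> 2 * norm t1" "norm q \<le> 2 * norm t2"
      unfolding t1_def t2_def using st by (intro tq om; simp add: t1_def t2_def)+
    then have "norm s * (norm q * norm q) \<le> norm s * ((2 * norm t1) * (2 * norm t2))"
      by (intro mult_left_mono mult_mono) auto
    also have "\<dots> = 4 * norm N" by (simp add: Nf)
    also have "\<dots> \<le> 4 * \<kappa> * R\<^sup>2" using N by simp
    also have "\<dots> \<le> 4 * \<kappa> * (6 * (norm q)\<^sup>2)" using q6 \<kappa>6 by (intro mult_left_mono) auto
    finally have "norm s * (norm q)\<^sup>2 \<le> S * (norm q)\<^sup>2" by (simp add: S_def power2_eq_square)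
    then have sS: "norm s \<le> S" using q0 by (simp add: mult_le_cancel_right)
    define k where "k = shift \<alpha> \<beta> \<rho>"
    define w where "w = s - cnj \<rho> * z"
    define D where "D = q * cnj q + p * cnj p"
    have DR: "D = of_real (R\<^sup>2)" by (simp only: D_def R_def nrm2_sq)
    have D0: "D \<noteq> 0" using R1 by (simp add: DR)
    have b: "b_of \<alpha> \<beta> \<rho> z q p = q * (k + q * w)"
      by (simp add: b_of_def k_def w_def s_def)
    define WA where "WA = (q^3 + p^3) / 3 + z * q * p + \<alpha> * p + \<beta> * q + p\<^sup>2 / q"
    \<comment> \<open>The two functions p^2 / q and - q^2 / p differ by N / (q p), and the blend
      gives the second one the weight |p|^2 / D. The discrepancy is bounded because N = O(R^2) and R
      \<le> 3 |q|.\<close>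
    have "W \<alpha> \<beta> z q p = WA - cnj p * N / (q * D)"
    proof -
      have "(cnj q * p\<^sup>2 - cnj p * q\<^sup>2) * q = p\<^sup>2 * D - cnj p * N"
        by (simp add: D_def N_def algebra_simps power2_eq_square power3_eq_cube)
      moreover have "(cnj q * p\<^sup>2 - cnj p * q\<^sup>2) / D = (cnj q * p\<^sup>2 - cnj p * q\<^sup>2) * q / (q * D)"
        using q0 by simp
      ultimately have "(cnj q * p\<^sup>2 - cnj p * q\<^sup>2) / D = p\<^sup>2 / q - cnj p * N / (q * D)"
        using D0 by (simp add: diff_divide_distrib)
      then show ?thesis by (simp add: W_def WA_def D_def)
    qed
    then have "WA = W \<alpha> \<beta> z q p + cnj p * N / (q * D)" by simp
    also have "norm \<dots> \<le> Wb + 3 * \<kappa>"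
    proof (rule norm_triangle_mono[OF Wb])
      have "norm (cnj p * N) \<le> R * (\<kappa> * R\<^sup>2)"
        unfolding norm_mult using nrm2_le(2)[of p q] N R1 by (intro mult_mono) (auto simp: R_def)
      also have "\<dots> \<le> (3 * norm q) * (\<kappa> * R\<^sup>2)" using qR \<kappa>6 by (intro mult_right_mono) auto
      finally show "norm (cnj p * N / (q * D)) \<le> 3 * \<kappa>"
        using q0 R1(2) by (simp add: norm_divide norm_mult DR divide_le_eq norm_power mult_ac)
    qed
    finally have WA: "norm WA \<le> Wb + 3 * \<kappa>" .
    define B where "B = norm (b_of \<alpha> \<beta> \<rho> z q p)"
    have nk: "norm k \<le> 1 + c"
    proof -
      have "norm k \<le> norm (1 - cnj \<rho> * \<alpha>) + norm (\<rho> * \<beta>)"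
        unfolding k_def shift_def by (rule norm_triangle_ineq)
      also have "norm (1 - cnj \<rho> * \<alpha>) \<le> 1 + norm (cnj \<rho> * \<alpha>)"
        using norm_triangle_ineq4[of 1 "cnj \<rho> * \<alpha>"] by simp
      finally show ?thesis by (simp add: norm_mult cube_root_norm[OF \<rho>] c_def)
    qed
    have qw: "norm (q * w) \<le> B / norm q + (1 + c)"
    proof -
      have "q * w = b_of \<alpha> \<beta> \<rho> z q p / q - k" using q0 by (simp add: b)
      then have "norm (q * w) \<le> B / norm q + norm k"
        using norm_triangle_ineq4[of "b_of \<alpha> \<beta> \<rho> z q p / q" k] by (simp add: norm_divide B_def)
      then show ?thesis using nk by simp
    qed
    have "cnj \<rho> * b_of \<alpha> \<beta> \<rho> z q p
        = WA + \<rho> * s * (q * w) - (s^3 + 3 * \<alpha> * s - 6 * \<rho> * s) / 3 - s\<^sup>2 / q"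
      unfolding b WA_def
      by (rule tilde_identity[OF cube_root_cnj[OF \<rho>] cube_root_sq[OF \<rho>] cube_root_cnj_sq[OF \<rho>]
            _ q0 s_def w_def]) (simp add: k_def shift_def)
    moreover have "B = norm (cnj \<rho> * b_of \<alpha> \<beta> \<rho> z q p)"
      by (simp add: B_def norm_mult cube_root_norm[OF \<rho>])
    ultimately have "B \<le> norm WA + norm (\<rho> * s * (q * w)) + norm ((s^3 + 3 * \<alpha> * s - 6 * \<rho> * s) / 3) + norm (s\<^sup>2 / q)"
      by (simp only:) (intro order_trans[OF norm_triangle_ineq4] order_trans[OF norm_triangle_ineq] add_mono order_refl)
    also have "norm (\<rho> * s * (q * w)) \<le> S * (B / norm q + (1 + c))"
      using qw sS S0 by (auto simp: norm_mult[of _ "q * w"] norm_mult[of \<rho>] cube_root_norm[OF \<rho>] intro!: mult_mono)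
    \<comment> \<open>Here |q| \<ge> 2 S is used: the contribution of b on the right is at most B /
      2 and can be moved to the left.\<close>
    also have "S * (B / norm q + (1 + c)) \<le> B / 2 + S * (1 + c)"
    proof -
      have "S * (B / norm q) \<le> S * (B / (2 * S))"
        using q2S S0 q0 by (intro mult_left_mono divide_left_mono) (auto simp: B_def intro!: mult_pos_pos)
      then show ?thesis using S0 by (simp add: algebra_simps)
    qed
    also have "norm ((s^3 + 3 * \<alpha> * s - 6 * \<rho> * s) / 3) \<le> S^3 + c * S + 2 * S"
    proof -
      have "norm (s^3 + 3 * \<alpha> * s - 6 * \<rho> * s) \<le> norm (s^3) + norm (3 * \<alpha> * s) + norm (6 * \<rho> * s)"
        by (intro order_trans[OF norm_triangle_ineq4] order_trans[OF norm_triangle_ineq] add_mono order_refl)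
      also have "\<dots> = norm s ^ 3 + 3 * (norm \<alpha> * norm s) + 6 * norm s"
        by (simp add: norm_mult norm_power cube_root_norm[OF \<rho>])
      also have "\<dots> \<le> S^3 + 3 * (c * S) + 6 * S"
        using sS c0 by (intro add_mono mult_left_mono mult_mono power_mono) auto
      moreover have "S^3 \<ge> 0" using S0 by simp
      ultimately show ?thesis unfolding norm_divide norm_numeral by linarith
    qed
    also have "norm (s\<^sup>2 / q) \<le> S\<^sup>2"
    proof -
      have "norm (s\<^sup>2 / q) \<le> (norm s)\<^sup>2 / 1"
        unfolding norm_divide norm_power using q2S by (intro divide_left_mono) auto
      also have "\<dots> \<le> S\<^sup>2" using sS by (simp add: power_mono)
      finally show ?thesis .
    qed
    finally have "B \<le> K" using WA by (simp add: K_def C1_def)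
    moreover have "norm (1 / q) \<le> 1" using q2S(2) q0 by (simp add: norm_divide divide_le_eq)
    then have "norm (1 / q) \<le> K" by (simp add: K_def)
    ultimately show ?thesis using \<rho> q0 by (auto simp: B_def)
  qed
  then show ?thesis by (intro exI[of _ K] exI[of _ "144 * \<kappa>"]) blast
qed

section \<open>Local growth of W along solutions\<close>

text \<open>The logarithm turns the linear inequality |dW| \<le> C (1 + |W|) |dz| into a Lipschitz
  estimate whose constant does not depend on W. Such estimates add up over a partition, which is
  what \<open>rectifiable_growth\<close> asks for.\<close>

lemma W_locally_lipschitz:
  assumes r: "r > 0" and sol: "solves (field_q \<alpha>) (field_p \<beta>) (ball z0 r) q p"
    and R: "\<And>z. z \<in> ball z0 r \<Longrightarrow> nrm2 (q z) (p z) \<ge> 1" and Z: "\<And>z. z \<in> ball z0 r \<Longrightarrow> norm z \<le> Z"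
    and C: "C = growth (norm \<alpha> + norm \<beta>) Z"
  shows "\<exists>d>0. \<forall>z\<in>ball z0 d. \<forall>w\<in>ball z0 d.
     ln (1 + norm (W \<alpha> \<beta> w (q w) (p w))) \<le> ln (1 + norm (W \<alpha> \<beta> z (q z) (p z))) + 2 * C * dist z w"
proof -
  define g where "g z = W \<alpha> \<beta> z (q z) (p z)" for z
  have "\<forall>z\<in>ball z0 r. \<exists>d. (g has_derivative d) (at z) \<and> (\<forall>h. norm (d h) \<le> C * (1 + norm (g z)) * norm h)"
    unfolding g_def C using W_derivative_bound sol R Z by (auto simp: solves_def)
  then obtain g' where g': "\<And>z. z \<in> ball z0 r \<Longrightarrow> (g has_derivative g' z) (at z)"
    "\<And>z h. z \<in> ball z0 r \<Longrightarrow> norm (g' z h) \<le> C * (1 + norm (g z)) * norm h" by metis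
  have C0: "C \<ge> 0" by (simp add: C growth_def)
  have "isCont g z0" using g'(1)[of z0] r by (auto intro: has_derivative_continuous)
  then obtain e where e: "e > 0" "\<And>z. dist z z0 < e \<Longrightarrow> dist (g z) (g z0) < 1 / 3"
    unfolding continuous_at_eps_delta by (metis zero_less_divide_1_iff zero_less_numeral)
  define d where "d = min e r"
  have d: "d > 0" "ball z0 d \<subseteq> ball z0 r" using e r by (auto simp: d_def)
  \<comment> \<open>Values of g on this ball lie within 1/3 of the value at the centre, so any two
    differ by less than 1 and 1 + |g| varies by at most a factor 2. This is the 2 in the Lipschitz
    constant.\<close>
  have near: "1 + norm (g w) \<le> 2 * (1 + norm (g z))" if "z \<in> ball z0 d" "w \<in> ball z0 d" for z w
  proof -
    have "dist (g z) (g z0) < 1/3" "dist (g w) (g z0) < 1/3"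
      using that e(2)[of z] e(2)[of w] by (auto simp: d_def dist_commute)
    then have "dist (g w) (g z) < 1"
      using dist_triangle[of "g w" "g z" "g z0"] by (simp add: dist_commute)
    then have "norm (g w) - norm (g z) < 1"
      unfolding dist_norm by (rule le_less_trans[OF norm_triangle_ineq2])
    then have "1 + norm (g w) \<le> 2 + norm (g z)" by simp
    also have "\<dots> \<le> 2 * (1 + norm (g z))" by simp
    finally show ?thesis .
  qed
  have "ln (1 + norm (g w)) \<le> ln (1 + norm (g z)) + 2 * C * dist z w"
    if z: "z \<in> ball z0 d" and w: "w \<in> ball z0 d" for z w
  proof -
    have "norm (g w - g z) \<le> (2 * C * (1 + norm (g z))) * norm (w - z)"
    proof (rule differentiable_bound[where S = "ball z0 d" and f' = g'])
      fix u assume u: "u \<in> ball z0 d"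
      then have ur: "u \<in> ball z0 r" using d by blast
      show "(g has_derivative g' u) (at u within ball z0 d)"
        using g'(1)[OF ur] by (rule has_derivative_at_withinI)
      show "onorm (g' u) \<le> 2 * C * (1 + norm (g z))"
      proof (rule onorm_le)
        fix h
        have "norm (g' u h) \<le> C * (1 + norm (g u)) * norm h" by (rule g'(2)[OF ur])
        also have "\<dots> \<le> C * (2 * (1 + norm (g z))) * norm h"
          using near[OF z u] C0 by (intro mult_right_mono mult_left_mono) auto
        finally show "norm (g' u h) \<le> 2 * C * (1 + norm (g z)) * norm h" by (simp add: mult_ac)
      qed
    qed (use z w in auto)
    then have "1 + norm (g w) \<le> (1 + norm (g z)) * (1 + 2 * C * dist z w)"
      using norm_triangle_ineq2[of "g w" "g z"] by (simp add: dist_norm norm_minus_commute algebra_simps)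
    also have "\<dots> \<le> (1 + norm (g z)) * exp (2 * C * dist z w)"
      by (intro mult_left_mono) auto
    finally have le: "1 + norm (g w) \<le> (1 + norm (g z)) * exp (2 * C * dist z w)" .
    have pos: "0 < 1 + norm (g u)" for u by (rule add_pos_nonneg) auto
    have "ln (1 + norm (g w)) \<le> ln ((1 + norm (g z)) * exp (2 * C * dist z w))"
      using le pos by (subst ln_le_cancel_iff) (auto intro: mult_pos_pos)
    also have "\<dots> = ln (1 + norm (g z)) + 2 * C * dist z w"
      using pos[of z] by (simp add: ln_mult)
    finally show ?thesis .
  qed
  with d(1) show ?thesis unfolding g_def by blast
qed

section \<open>Solutions continued along a path\<close>

lemma solves_subset: "solves F G A x y \<Longrightarrow> B \<subseteq> A \<Longrightarrow> solves F G B x y"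
  by (auto simp: solves_def)

locale continued_solution =
  fixes \<alpha> \<beta> :: complex and \<gamma> :: "real \<Rightarrow> complex" and q p :: "complex \<Rightarrow> complex"
    and Q P :: "real \<Rightarrow> complex \<Rightarrow> complex"
  assumes rect: "rectifiable_path \<gamma>"
    and init: "\<forall>\<^sub>F z in nhds (\<gamma> 0). q analytic_on {z} \<and> p analytic_on {z} \<and>
      deriv q z = field_q \<alpha> z (q z) (p z) \<and> deriv p z = field_p \<beta> z (q z) (p z)"
    and contQ: "continuation_along \<gamma> {0..<1} q Q" and contP: "continuation_along \<gamma> {0..<1} p P"
begin

lemma \<gamma>_cont: "continuous_on {0..1} \<gamma>"
  using rect by (simp add: rectifiable_path_def path_def)

lemma analytic: "t \<in> {0..<1} \<Longrightarrow> Q t analytic_on {\<gamma> t}" "t \<in> {0..<1} \<Longrightarrow> P t analytic_on {\<gamma> t}"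
  using contQ contP by (auto simp: continuation_along_def)

lemma consistent:
  assumes "t \<in> {0..<1}"
  shows "\<forall>\<^sub>F s in at t within {0..<1}. \<forall>\<^sub>F z in nhds (\<gamma> s). Q s z = Q t z \<and> P s z = P t z"
proof -
  have "\<forall>\<^sub>F s in at t within {0..<1}. \<forall>\<^sub>F z in nhds (\<gamma> s). Q s z = Q t z"
    "\<forall>\<^sub>F s in at t within {0..<1}. \<forall>\<^sub>F z in nhds (\<gamma> s). P s z = P t z"
    using contQ contP assms by (auto simp: continuation_along_def)
  then show ?thesis by eventually_elim (rule eventually_conj)
qed

text \<open>\<Phi> stands for a relation between the two function elements; \<open>cong\<close>
  demands that its value at a point depend only on their germs there. Derivatives are therefore
  allowed, and differential equations as well as coordinate relations are carried along the
  path.\<close>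

lemma permanence:
  assumes ta: "0 \<le> ta" and t: "t \<in> {ta..<1}"
    and an: "\<And>t. t \<in> {ta..<1} \<Longrightarrow> \<Phi> (Q t) (P t) analytic_on {\<gamma> t}"
    and cong: "\<And>z f g f' g'. \<forall>\<^sub>F z in nhds z. f z = f' z \<and> g z = g' z \<Longrightarrow> \<Phi> f g z = \<Phi> f' g' z"
    and base: "\<forall>\<^sub>F z in nhds (\<gamma> ta). \<Phi> (Q ta) (P ta) z = 0"
  shows "\<forall>\<^sub>F z in nhds (\<gamma> t). \<Phi> (Q t) (P t) z = 0"
proof (rule continuation_permanence[where E = "\<lambda>t. \<Phi> (Q t) (P t)" and T = "{ta..<1}"])
  show "continuous_on {ta..<1} \<gamma>"
    using \<gamma>_cont by (rule continuous_on_subset) (use ta in auto)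
next
  fix t assume t: "t \<in> {ta..<1}"
  have "\<forall>\<^sub>F s in at t within {ta..<1}. \<forall>\<^sub>F z in nhds (\<gamma> s). Q s z = Q t z \<and> P s z = P t z"
    by (rule filter_leD[OF at_le consistent]) (use t ta in auto)
  then show "\<forall>\<^sub>F s in at t within {ta..<1}. \<forall>\<^sub>F z in nhds (\<gamma> s). \<Phi> (Q s) (P s) z = \<Phi> (Q t) (P t) z"
  proof eventually_elim
    case (elim s)
    then have "\<forall>\<^sub>F z in nhds (\<gamma> s). \<forall>\<^sub>F z in nhds z. Q s z = Q t z \<and> P s z = P t z"
      by (simp add: eventually_eventually)
    then show ?case by eventually_elim (rule cong)
  qed
qed (use an base t in auto)

text \<open>Permanence is applied to the residuals of the two equations, which vanish near the
  starting point.\<close>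

lemma solves_along:
  assumes t: "t \<in> {0..<1}"
  shows "\<exists>r>0. solves (field_q \<alpha>) (field_p \<beta>) (ball (\<gamma> t) r) (Q t) (P t)"
proof -
  have Q0: "\<forall>\<^sub>F z in nhds (\<gamma> 0). Q 0 z = q z" "\<forall>\<^sub>F z in nhds (\<gamma> 0). P 0 z = p z"
    using contQ contP by (auto simp: continuation_along_def)
  then have "\<forall>\<^sub>F z in nhds (\<gamma> 0). \<forall>\<^sub>F z in nhds z. Q 0 z = q z"
    "\<forall>\<^sub>F z in nhds (\<gamma> 0). \<forall>\<^sub>F z in nhds z. P 0 z = p z"
    by (simp_all add: eventually_eventually)
  with init Q0 have base: "\<forall>\<^sub>F z in nhds (\<gamma> 0). deriv (Q 0) z = field_q \<alpha> z (Q 0 z) (P 0 z) \<and>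
      deriv (P 0) z = field_p \<beta> z (Q 0 z) (P 0 z)"
    by eventually_elim (auto cong: deriv_cong_ev)
  have "\<forall>\<^sub>F z in nhds (\<gamma> t). deriv (Q t) z - field_q \<alpha> z (Q t z) (P t z) = 0"
  proof (rule permanence[where ta = 0 and \<Phi> = "\<lambda>f g z. deriv f z - field_q \<alpha> z (f z) (g z)"])
    fix z and f g f' g' :: "complex \<Rightarrow> complex"
    assume *: "\<forall>\<^sub>F z in nhds z. f z = f' z \<and> g z = g' z"
    then have "deriv f z = deriv f' z" by (intro deriv_cong_ev) (auto elim: eventually_mono)
    with * show "deriv f z - field_q \<alpha> z (f z) (g z) = deriv f' z - field_q \<alpha> z (f' z) (g' z)"
      by (auto dest: eventually_nhds_x_imp_x)
  qed (use t base in \<open>auto simp: field_q_def intro!: analytic_intros analytic elim: eventually_mono\<close>)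
  moreover have "\<forall>\<^sub>F z in nhds (\<gamma> t). deriv (P t) z - field_p \<beta> z (Q t z) (P t z) = 0"
  proof (rule permanence[where ta = 0 and \<Phi> = "\<lambda>f g z. deriv g z - field_p \<beta> z (f z) (g z)"])
    fix z and f g f' g' :: "complex \<Rightarrow> complex"
    assume *: "\<forall>\<^sub>F z in nhds z. f z = f' z \<and> g z = g' z"
    then have "deriv g z = deriv g' z" by (intro deriv_cong_ev) (auto elim: eventually_mono)
    with * show "deriv g z - field_p \<beta> z (f z) (g z) = deriv g' z - field_p \<beta> z (f' z) (g' z)"
      by (auto dest: eventually_nhds_x_imp_x)
  qed (use t base in \<open>auto simp: field_p_def intro!: analytic_intros analytic elim: eventually_mono\<close>)
  ultimately have "\<forall>\<^sub>F z in nhds (\<gamma> t). deriv (Q t) z = field_q \<alpha> z (Q t z) (P t z) \<and>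
      deriv (P t) z = field_p \<beta> z (Q t z) (P t z)"
    by eventually_elim simp
  then obtain r where r: "r > 0" "\<And>z. z \<in> ball (\<gamma> t) r \<Longrightarrow> deriv (Q t) z = field_q \<alpha> z (Q t z) (P t z) \<and>
      deriv (P t) z = field_p \<beta> z (Q t z) (P t z)"
    by (auto simp: eventually_nhds_metric dist_commute)
  obtain r1 where r1: "r1 > 0" "Q t holomorphic_on ball (\<gamma> t) r1"
    using analytic(1)[OF t] by (auto simp: analytic_on_def)
  obtain r2 where r2: "r2 > 0" "P t holomorphic_on ball (\<gamma> t) r2"
    using analytic(2)[OF t] by (auto simp: analytic_on_def)
  have "solves (field_q \<alpha>) (field_p \<beta>) (ball (\<gamma> t) (min r (min r1 r2))) (Q t) (P t)"
    unfolding solves_def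
  proof (intro ballI)
    fix z assume z: "z \<in> ball (\<gamma> t) (min r (min r1 r2))"
    have "(Q t has_field_derivative deriv (Q t) z) (at z)" "(P t has_field_derivative deriv (P t) z) (at z)"
      using holomorphic_derivI[OF r1(2), of z UNIV] holomorphic_derivI[OF r2(2), of z UNIV] z by auto
    with r(2)[of z] z show "(Q t has_field_derivative field_q \<alpha> z (Q t z) (P t z)) (at z) \<and>
      (P t has_field_derivative field_p \<beta> z (Q t z) (P t z)) (at z)" by auto
  qed
  then show ?thesis using r r1 r2 by (intro exI[of _ "min r (min r1 r2)"]) auto
qed

lemma norm_bounded: "\<exists>Z. \<forall>t\<in>{0..1}. norm (\<gamma> t) \<le> Z"
  using compact_imp_bounded[OF compact_continuous_image[OF \<gamma>_cont compact_Icc]]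
  by (auto simp: bounded_iff)

text \<open>The strict lower bound on the path persists on a small disc around each of its points,
  where the local Lipschitz estimate for the element at that point applies. Elements at neighbouring
  parameters agree, so the estimate passes to values along the path, and the finite length yields a
  bound uniform up to the end.\<close>

lemma W_bounded:
  assumes ta: "ta \<in> {0..<1}" and R: "\<And>t. t \<in> {ta..<1} \<Longrightarrow> nrm2 (Q t (\<gamma> t)) (P t (\<gamma> t)) > 1"
  shows "\<exists>B. \<forall>t\<in>{ta..<1}. norm (W \<alpha> \<beta> (\<gamma> t) (Q t (\<gamma> t)) (P t (\<gamma> t))) \<le> B"
proof -
  obtain M where M: "\<And>(n::nat) t. mono_on {..n} t \<Longrightarrow> t ` {..n} \<subseteq> {0..1} \<Longrightarrow>
        (\<Sum>i<n. dist (\<gamma> (t i)) (\<gamma> (t (Suc i)))) \<le> M"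
    using rect unfolding rectifiable_path_def by blast
  obtain Z where Z: "\<And>t. t \<in> {0..1} \<Longrightarrow> norm (\<gamma> t) \<le> Z" using norm_bounded by blast
  \<comment> \<open>The discs around path points have radius at most 1, so their points have modulus
    at most \<open>Z + 1\<close>.\<close>
  define C where "C = growth (norm \<alpha> + norm \<beta>) (Z + 1)"
  have C0: "C \<ge> 0" by (simp add: C_def growth_def)
  define V where "V s = W \<alpha> \<beta> (\<gamma> s) (Q s (\<gamma> s)) (P s (\<gamma> s))" for s
  define \<phi> where "\<phi> s = ln (1 + norm (V s))" for s
  have growth: "\<phi> b \<le> \<phi> ta + 2 * C * M" if b: "b \<in> {ta..<1}" for b
  proof (rule rectifiable_growth[where \<phi> = \<phi> and \<gamma> = \<gamma> and C = "2 * C" and a = ta and b = b])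
    fix t assume t: "t \<in> {ta..b}"
    then have t01: "t \<in> {0..<1}" using ta b by auto
    obtain r where r: "r > 0" and sol: "solves (field_q \<alpha>) (field_p \<beta>) (ball (\<gamma> t) r) (Q t) (P t)"
      using solves_along[OF t01] by blast
    have "isCont (Q t) (\<gamma> t)" "isCont (P t) (\<gamma> t)"
      using sol r by (auto simp: solves_def intro: DERIV_isCont)
    then have "isCont (\<lambda>z. nrm2 (Q t z) (P t z)) (\<gamma> t)"
      unfolding nrm2_def by (intro continuous_intros)
    then have "\<forall>\<^sub>F z in nhds (\<gamma> t). nrm2 (Q t z) (P t z) > 1"
      using R[of t] t b tendsto_at_iff_tendsto_nhds[of "\<lambda>z. nrm2 (Q t z) (P t z)" "\<gamma> t"]
      unfolding continuous_at by (intro order_tendstoD) auto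
    then obtain e where e: "e > 0" "\<And>z. dist z (\<gamma> t) < e \<Longrightarrow> nrm2 (Q t z) (P t z) > 1"
      by (auto simp: eventually_nhds_metric)
    define r' where "r' = min 1 (min e r)"
    have r': "r' > 0" using e r by (simp add: r'_def)
    have bZ: "norm z \<le> Z + 1" if "z \<in> ball (\<gamma> t) r'" for z
      using that Z[of t] t01 norm_triangle_ineq2[of z "\<gamma> t"]
      by (auto simp: r'_def dist_norm norm_minus_commute)
    obtain d where d: "d > 0" and lip: "\<And>z w. z \<in> ball (\<gamma> t) d \<Longrightarrow> w \<in> ball (\<gamma> t) d \<Longrightarrow>
       ln (1 + norm (W \<alpha> \<beta> w (Q t w) (P t w))) \<le> ln (1 + norm (W \<alpha> \<beta> z (Q t z) (P t z))) + 2 * C * dist z w"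
    proof -
      have "nrm2 (Q t z) (P t z) \<ge> 1" if "z \<in> ball (\<gamma> t) r'" for z
        using that e(2)[of z] by (auto simp: r'_def dist_commute)
      moreover have "solves (field_q \<alpha>) (field_p \<beta>) (ball (\<gamma> t) r') (Q t) (P t)"
        by (rule solves_subset[OF sol]) (auto simp: r'_def)
      ultimately show ?thesis using W_locally_lipschitz[OF r' _ _ bZ C_def] that by blast
    qed
    have "\<forall>\<^sub>F s in at t within {0..<1}. Q s (\<gamma> s) = Q t (\<gamma> s) \<and> P s (\<gamma> s) = P t (\<gamma> s)"
      using consistent[OF t01] by eventually_elim (blast dest: eventually_nhds_x_imp_x)
    moreover have "\<forall>\<^sub>F s in at t within {0..<1}. \<gamma> s \<in> ball (\<gamma> t) d"
    proof -
      have "(\<gamma> \<longlongrightarrow> \<gamma> t) (at t within {0..1})" using \<gamma>_cont t01 by (auto simp: continuous_on_def)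
      then have "(\<gamma> \<longlongrightarrow> \<gamma> t) (at t within {0..<1})" by (rule tendsto_within_subset) auto
      then show ?thesis using d by (auto simp: tendsto_iff dist_commute)
    qed
    ultimately have "\<forall>\<^sub>F s in at t within {0..<1}.
        V s = W \<alpha> \<beta> (\<gamma> s) (Q t (\<gamma> s)) (P t (\<gamma> s)) \<and> \<gamma> s \<in> ball (\<gamma> t) d"
      by eventually_elim (simp add: V_def)
    then obtain \<delta> where \<delta>: "\<delta> > 0" "\<And>s. s \<in> {0..<1} \<Longrightarrow> s \<noteq> t \<Longrightarrow> dist s t < \<delta> \<Longrightarrow>
        V s = W \<alpha> \<beta> (\<gamma> s) (Q t (\<gamma> s)) (P t (\<gamma> s)) \<and> \<gamma> s \<in> ball (\<gamma> t) d"
      by (auto simp: eventually_at)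
    have loc: "V s = W \<alpha> \<beta> (\<gamma> s) (Q t (\<gamma> s)) (P t (\<gamma> s)) \<and> \<gamma> s \<in> ball (\<gamma> t) d"
      if "s \<in> {ta..b}" "dist s t < \<delta>" for s
      using \<delta>(2)[of s] that b ta d by (cases "s = t") (auto simp: V_def)
    show "\<exists>\<delta>>0. \<forall>s\<in>{ta..b}. \<forall>s'\<in>{ta..b}. dist s t < \<delta> \<longrightarrow> dist s' t < \<delta> \<longrightarrow>
        \<phi> s' \<le> \<phi> s + 2 * C * dist (\<gamma> s) (\<gamma> s')"
      using \<delta>(1) lip loc by (intro exI[of _ \<delta>]) (simp add: \<phi>_def)
  qed (use M ta b C0 in auto)
  have "norm (V b) \<le> exp (\<phi> ta + 2 * C * M)" if "b \<in> {ta..<1}" for b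
  proof -
    have "0 < 1 + norm (V b)" by (rule add_pos_nonneg) auto
    then have "1 + norm (V b) = exp (\<phi> b)" by (simp add: \<phi>_def)
    also have "\<dots> \<le> exp (\<phi> ta + 2 * C * M)" using growth[OF that] by simp
    finally show ?thesis by simp
  qed
  then show ?thesis unfolding V_def by blast
qed

lemma continues_as:
  assumes ta: "ta \<in> {0..<1}" and A: "open A" "\<And>t. t \<in> {ta..<1} \<Longrightarrow> \<gamma> t \<in> A"
    and hol: "x holomorphic_on A" "y holomorphic_on A"
    and base: "\<forall>\<^sub>F z in nhds (\<gamma> ta). Q ta z = x z \<and> P ta z = y z" and t: "t \<in> {ta..<1}"
  shows "\<forall>\<^sub>F z in nhds (\<gamma> t). Q t z = x z \<and> P t z = y z"
proof -
  have an: "x analytic_on {\<gamma> t}" "y analytic_on {\<gamma> t}" if "t \<in> {ta..<1}" for t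
    using hol A that by (auto simp: analytic_at)
  have "\<forall>\<^sub>F z in nhds (\<gamma> t). Q t z - x z = 0"
    by (rule permanence[where ta = ta and \<Phi> = "\<lambda>f g z. f z - x z"])
      (use ta t base in \<open>auto intro!: analytic_intros analytic an elim: eventually_mono dest: eventually_nhds_x_imp_x\<close>)
  moreover have "\<forall>\<^sub>F z in nhds (\<gamma> t). P t z - y z = 0"
    by (rule permanence[where ta = ta and \<Phi> = "\<lambda>f g z. g z - y z"])
      (use ta t base in \<open>auto intro!: analytic_intros analytic an elim: eventually_mono dest: eventually_nhds_x_imp_x\<close>)
  ultimately show ?thesis by eventually_elim simp
qed

end

section \<open>Expansion at the pole\<close>

text \<open>The coefficients of \<open>g = \<zeta> q\<close> and \<open>m = \<zeta> p\<close> in powers of \<open>\<zeta> = z - z\<^sub>*\<close>; the recursion resonates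
  at order three, where the value \<open>c\<close> of the coordinate \<open>b\<close> supplies the missing equation.\<close>
lemma pole_coefficients:
  fixes g m :: "complex fps"
  assumes r: "r * s = 1" "r\<^sup>2 = s" "s\<^sup>2 = r"
    and g: "fps_X * fps_deriv g - g = m * m + fps_X * (fps_const zs + fps_X) * g + fps_const \<alpha> * fps_X\<^sup>2"
    and m: "fps_X * fps_deriv m - m = - (g * g) - fps_X * (fps_const zs + fps_X) * m - fps_const \<beta> * fps_X\<^sup>2"
    and b: "fps_X^3 * b = fps_const (1 - s * \<alpha> + r * \<beta>) * (fps_X\<^sup>2 * g)
       - fps_const s * ((fps_const zs + fps_X) * (fps_X * (g * g))) + fps_const r * (g * g * g) + g * g * m"
    and init: "fps_nth g 0 = - r" "fps_nth m 0 = s"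
  defines "c \<equiv> fps_nth b 0"
  shows "fps_nth g 1 = r * zs / 2" "fps_nth m 1 = s * zs / 2"
    "fps_nth g 2 = r * (1 + zs\<^sup>2 / 4) - \<alpha> / 3 + 2 / 3 * s * \<beta>"
    "fps_nth m 2 = s * (1 - zs\<^sup>2 / 4) - 2 / 3 * r * \<alpha> + \<beta> / 3"
    "fps_nth g 3 = c / 2 + (- \<alpha> / 2 + 7 * r / 8 + \<beta> * s / 2) * zs"
    "fps_nth m 3 = c * r / 2 - 3 * s * zs / 8"
proof -
  define g1 g2 g3 m1 m2 m3 where "g1 = fps_nth g (Suc 0)" and "g2 = fps_nth g 2" and "g3 = fps_nth g 3"
    and "m1 = fps_nth m (Suc 0)" and "m2 = fps_nth m 2" and "m3 = fps_nth m 3"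
  note defs = g1_def[symmetric] g2_def[symmetric] g3_def[symmetric]
    m1_def[symmetric] m2_def[symmetric] m3_def[symmetric]
  have sums: "{0..1::nat} = {0,1}" "{0..2::nat} = {0,1,2}" "{0..3::nat} = {0,1,2,3}"
    "{0..Suc 0} = {0,1}" by auto
  have X: "fps_nth (fps_X * (fps_const zs + fps_X) * f) 0 = 0"
    "fps_nth (fps_X * (fps_const zs + fps_X) * f) 1 = zs * fps_nth f 0"
    "fps_nth (fps_X * (fps_const zs + fps_X) * f) 2 = zs * fps_nth f 1 + fps_nth f 0"
    "fps_nth (fps_X * (fps_const zs + fps_X) * f) 3 = zs * fps_nth f 2 + fps_nth f 1"
    "fps_nth (fps_const a * fps_X\<^sup>2) 1 = 0" "fps_nth (fps_const a * fps_X\<^sup>2) 2 = a"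
    "fps_nth (fps_const a * fps_X\<^sup>2) 3 = 0" for f :: "complex fps" and a
    by (simp_all add: mult.assoc distrib_right numeral_2_eq_2 numeral_3_eq_3)
  have dX: "fps_nth (fps_X * fps_deriv f) 1 = fps_nth f 1" "fps_nth (fps_X * fps_deriv f) 2 = 2 * fps_nth f 2"
    "fps_nth (fps_X * fps_deriv f) 3 = 3 * fps_nth f 3" for f :: "complex fps"
    by (simp_all add: numeral_2_eq_2 numeral_3_eq_3)
  have sq: "fps_nth (f * h) 1 = fps_nth f 0 * fps_nth h 1 + fps_nth f 1 * fps_nth h 0"
    "fps_nth (f * h) 2 = fps_nth f 0 * fps_nth h 2 + fps_nth f 1 * fps_nth h 1 + fps_nth f 2 * fps_nth h 0"
    "fps_nth (f * h) 3 = fps_nth f 0 * fps_nth h 3 + fps_nth f 1 * fps_nth h 2 + fps_nth f 2 * fps_nth h 1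
      + fps_nth f 3 * fps_nth h 0" for f h :: "complex fps"
    by (simp_all add: fps_mult_nth sums)
  have G: "fps_nth (fps_X * fps_deriv g - g) n = fps_nth (m * m + fps_X * (fps_const zs + fps_X) * g + fps_const \<alpha> * fps_X\<^sup>2) n"
    and M: "fps_nth (fps_X * fps_deriv m - m) n = fps_nth (- (g * g) - fps_X * (fps_const zs + fps_X) * m - fps_const \<beta> * fps_X\<^sup>2) n"
    and B: "fps_nth (fps_X^3 * b) n = fps_nth (fps_const (1 - s * \<alpha> + r * \<beta>) * (fps_X\<^sup>2 * g)
       - fps_const s * ((fps_const zs + fps_X) * (fps_X * (g * g))) + fps_const r * (g * g * g) + g * g * m) n" for n
    using g m b by simp_all
  note nths = fps_sub_nth fps_add_nth fps_neg_nth dX X sq[of g g] sq[of m m]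
  have e1: "0 = 2 * s * m1 - zs * r"
    using G[of 1, unfolded nths] by (simp add: init defs algebra_simps)
  have e2: "0 = 2 * r * g1 - zs * s"
    using M[of 1, unfolded nths] by (simp add: init defs algebra_simps)
  have e3: "g2 = 2 * s * m2 + m1\<^sup>2 + zs * g1 - r + \<alpha>"
    using G[of 2, unfolded nths] by (simp add: init defs algebra_simps power2_eq_square)
  have e4: "m2 = 2 * r * g2 - g1\<^sup>2 - zs * m1 - s - \<beta>"
    using M[of 2, unfolded nths] by (simp add: init defs algebra_simps power2_eq_square)
  have e5: "2 * g3 = 2 * s * m3 + 2 * m1 * m2 + zs * g2 + g1"
    using G[of 3, unfolded nths] by (simp add: init defs algebra_simps)
  have e6: "2 * m3 = 2 * r * g3 - 2 * g1 * g2 - zs * m2 - m1"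
    using M[of 3, unfolded nths] by (simp add: init defs algebra_simps)
  \<comment> \<open>In this equation the unknowns of order three enter as g3 + s m3, whereas e5 and
    e6 both only fix g3 - s m3. Together they determine both.\<close>
  have e7: "c = (1 - s * \<alpha> + r * \<beta>) * g1 - s * (zs * (- 2 * r * g2 + g1\<^sup>2) - 2 * r * g1)
      + r * (3 * r\<^sup>2 * g3 - 6 * r * g1 * g2 + g1^3)
      + (r\<^sup>2 * m3 - 2 * r * g1 * m2 + (- 2 * r * g2 + g1\<^sup>2) * m1 + (- 2 * r * g3 + 2 * g1 * g2) * s)"
  proof -
    have XX: "fps_nth ((fps_const zs + fps_X) * (fps_X * f)) 3 = zs * fps_nth f 2 + fps_nth f 1"
      "fps_nth (fps_X\<^sup>2 * f) 3 = fps_nth f 1" "fps_nth (fps_X^3 * f) 3 = fps_nth f 0" for f :: "complex fps"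
      by (simp_all add: distrib_right numeral_2_eq_2 numeral_3_eq_3 mult.assoc[symmetric] fps_X_power_mult_nth)
        (simp_all add: mult.assoc)
    show ?thesis
      using B[of 3, unfolded fps_sub_nth fps_add_nth fps_mult_left_const_nth XX sq[of "g * g"] sq[of g g]] unfolding c_def
      by (simp add: init defs algebra_simps
          power2_eq_square power3_eq_cube)
  qed
  \<comment> \<open>Rescaled parameters that clear the denominators of the target formulas, so that
    \<open>algebra\<close> works with integer coefficients.\<close>
  define x a b' C where "x = zs / 8" and "a = \<alpha> / 6" and "b' = \<beta> / 6" and "C = c / 2"
  have subst: "zs = 8 * x" "\<alpha> = 6 * a" "\<beta> = 6 * b'" "c = 2 * C"
    by (simp_all add: x_def a_def b'_def C_def)
  note e = e1 e2 e3 e4 e5 e6 e7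
  note e' = e[unfolded subst]
  have h1: "g1 = 4 * r * x" using e'(2) r by algebra
  have k1: "m1 = 4 * s * x" using e'(1) r by algebra
  have "3 * g2 = 3 * (r * (1 + 16 * x\<^sup>2) - 2 * a + 4 * s * b')"
    using e'(3,4) r unfolding h1 k1 by algebra
  then have h2: "g2 = r * (1 + 16 * x\<^sup>2) - 2 * a + 4 * s * b'" by (simp only: mult_cancel_left) simp
  have k2: "m2 = s * (1 - 16 * x\<^sup>2) - 4 * r * a + 2 * b'"
    using e'(4) r unfolding h1 k1 h2 by algebra
  have "4 * g3 = 4 * (C + (- 24 * a + 7 * r + 24 * b' * s) * x)"
    using e'(5,7) r unfolding h1 k1 h2 k2 by algebra
  then have h3: "g3 = C + (- 24 * a + 7 * r + 24 * b' * s) * x" by (simp only: mult_cancel_left) simp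
  have "2 * m3 = 2 * (C * r - 3 * s * x)"
    using e'(6) r unfolding h1 k1 h2 k2 h3 by algebra
  then have k3: "m3 = C * r - 3 * s * x" by (simp only: mult_cancel_left) simp
  show "fps_nth g 1 = r * zs / 2" "fps_nth m 1 = s * zs / 2"
    "fps_nth g 2 = r * (1 + zs\<^sup>2 / 4) - \<alpha> / 3 + 2 / 3 * s * \<beta>"
    "fps_nth m 2 = s * (1 - zs\<^sup>2 / 4) - 2 / 3 * r * \<alpha> + \<beta> / 3"
    "fps_nth g 3 = c / 2 + (- \<alpha> / 2 + 7 * r / 8 + \<beta> * s / 2) * zs"
    "fps_nth m 3 = c * r / 2 - 3 * s * zs / 8"
    unfolding One_nat_def defs h1 k1 h2 k2 h3 k3 by (simp_all add: x_def a_def b'_def C_def power_divide algebra_simps)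
qed


lemma series_split:
  fixes w :: complex
  assumes s: "(\<lambda>n. G n * w ^ n) sums S" and w: "w \<noteq> 0"
  shows "summable (\<lambda>n. G (n + 4) * w ^ (n + 3))"
    "S / w = G 0 / w + G 1 + G 2 * w + G 3 * w\<^sup>2 + (\<Sum>n. G (n + 4) * w ^ (n + 3))"
proof -
  have "(\<lambda>n. G (n + 4) * w ^ (n + 4)) sums (S - (\<Sum>i<4. G i * w ^ i))"
    by (rule sums_split_initial_segment[OF s])
  then have "(\<lambda>n. G (n + 4) * w ^ (n + 4) / w) sums ((S - (\<Sum>i<4. G i * w ^ i)) / w)"
    by (rule sums_divide)
  then have *: "(\<lambda>n. G (n + 4) * w ^ (n + 3)) sums ((S - (\<Sum>i<4. G i * w ^ i)) / w)"
    using w by (simp add: eval_nat_numeral)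
  then show "summable (\<lambda>n. G (n + 4) * w ^ (n + 3))" by (rule sums_summable)
  have "(\<Sum>i<4. G i * w ^ i) = G 0 + G 1 * w + G 2 * w\<^sup>2 + G 3 * w^3"
    by (simp add: eval_nat_numeral)
  with sums_unique[OF *] w show
    "S / w = G 0 / w + G 1 + G 2 * w + G 3 * w\<^sup>2 + (\<Sum>n. G (n + 4) * w ^ (n + 3))"
    by (simp add: field_simps power2_eq_square power3_eq_cube)
qed

text \<open>On the exceptional curve a = 0 the equation reads a' = - \<rho>^2, which is nonzero, so
  a has a simple zero and q = 1 / a a simple pole. Multiplying q and p by z - zs gives holomorphic
  functions g and m, whose Taylor coefficients are computed from the system and from the value of b
  at zs.\<close>

lemma tilde_solution_pole:
  assumes \<rho>: "\<rho> \<in> cube_roots" and r: "r > 0"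
    and sol: "solves (field_a \<alpha> \<beta> \<rho>) (field_b \<alpha> \<beta> \<rho>) (ball zs r) a b" and a0: "a zs = 0"
  defines "c \<equiv> b zs"
  obtains e and cs ds :: "nat \<Rightarrow> complex" where "e > 0" "e \<le> r"
    "\<And>z. z \<in> ball zs e - {zs} \<Longrightarrow> a z \<noteq> 0"
    "\<And>z. z \<in> ball zs e - {zs} \<Longrightarrow> summable (\<lambda>n. cs (n + 3) * (z - zs) ^ (n + 3))"
    "\<And>z. z \<in> ball zs e - {zs} \<Longrightarrow> summable (\<lambda>n. ds (n + 3) * (z - zs) ^ (n + 3))"
    "\<And>z. z \<in> ball zs e - {zs} \<Longrightarrow> 1 / a z = - \<rho> / (z - zs) + \<rho> * zs / 2
       + (\<rho> * (1 + zs\<^sup>2 / 4) - \<alpha> / 3 + 2 / 3 * cnj \<rho> * \<beta>) * (z - zs)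
       + (c / 2 + (- \<alpha> / 2 + 7 * \<rho> / 8 + \<beta> * cnj \<rho> / 2) * zs) * (z - zs)\<^sup>2
       + (\<Sum>n. cs (n + 3) * (z - zs) ^ (n + 3))"
    "\<And>z. z \<in> ball zs e - {zs} \<Longrightarrow> p_of \<alpha> \<beta> \<rho> z (a z) (b z) = cnj \<rho> / (z - zs) + cnj \<rho> * zs / 2
       + (cnj \<rho> * (1 - zs\<^sup>2 / 4) - 2 / 3 * \<rho> * \<alpha> + \<beta> / 3) * (z - zs)
       + (c * \<rho> / 2 - 3 * cnj \<rho> * zs / 8) * (z - zs)\<^sup>2
       + (\<Sum>n. ds (n + 3) * (z - zs) ^ (n + 3))"
proof -
  note r1 = cube_root_cnj[OF \<rho>] and r2 = cube_root_sq[OF \<rho>] and r3 = cube_root_cnj_sq[OF \<rho>]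
  have \<rho>0: "\<rho> \<noteq> 0" using r1 by auto
  note hol = solves_holomorphic[OF sol]
  have "(a has_field_derivative field_a \<alpha> \<beta> \<rho> zs (a zs) (b zs)) (at zs)"
    using sol r by (simp add: solves_def)
  also have "field_a \<alpha> \<beta> \<rho> zs (a zs) (b zs) = - cnj \<rho>"
    by (simp add: field_a_def a0 r2)
  finally have da: "deriv a zs = - cnj \<rho>" by (rule DERIV_imp_deriv)
  \<comment> \<open>The difference quotient of a with its removable singularity filled in. Its value
    at zs is nonzero, so g = 1 / h is holomorphic nearby.\<close>
  define h where "h = (\<lambda>z. if z = zs then deriv a zs else (a z - a zs) / (z - zs))"
  have hol_h: "h holomorphic_on ball zs r"
    unfolding h_def by (rule pole_lemma_open[OF hol(1)]) auto
  have hz: "h zs = - cnj \<rho>" "\<And>z. a z = (z - zs) * h z" by (auto simp: h_def da a0)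
  have "isCont h zs"
    using holomorphic_on_imp_continuous_on[OF hol_h] r by (auto simp: continuous_on_eq_continuous_at)
  moreover have "h zs \<noteq> 0" using hz(1) \<rho>0 by simp
  ultimately obtain e1 where e1: "e1 > 0" "\<And>z. dist zs z < e1 \<Longrightarrow> h z \<noteq> 0"
    using continuous_at_avoid[of zs h 0] by blast
  define e where "e = min e1 r"
  have e: "e > 0" "e \<le> r" and h0: "\<And>z. z \<in> ball zs e \<Longrightarrow> h z \<noteq> 0"
    using e1 r by (auto simp: e_def)
  have sub: "ball zs e \<subseteq> ball zs r" using e by auto
  have anz: "a z \<noteq> 0" if "z \<in> ball zs e - {zs}" for z
    using h0[of z] that hz(2)[of z] by auto
  define k where "k = shift \<alpha> \<beta> \<rho>"
  define g where "g z = 1 / h z" for z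
  define m where "m z = - \<rho> * g z + (z - zs) * (cnj \<rho> * z - k * a z + (a z)\<^sup>2 * b z)" for z
  have hol_g: "g holomorphic_on ball zs e"
    unfolding g_def using h0 by (intro holomorphic_intros holomorphic_on_subset[OF hol_h sub]) auto
  have hol_m: "m holomorphic_on ball zs e"
    unfolding m_def by (intro holomorphic_intros hol_g holomorphic_on_subset[OF hol(1) sub]
        holomorphic_on_subset[OF hol(2) sub])
  have q: "1 / a z = g z / (z - zs)" and p: "p_of \<alpha> \<beta> \<rho> z (a z) (b z) = m z / (z - zs)"
    if "z \<in> ball zs e - {zs}" for z
  proof -
    show q: "1 / a z = g z / (z - zs)" using hz(2)[of z] by (simp add: g_def)
    have "p_of \<alpha> \<beta> \<rho> z (a z) (b z) = - \<rho> * (1 / a z) + (cnj \<rho> * z - k * a z + (a z)\<^sup>2 * b z)"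
      by (simp add: p_of_def k_def)
    also have "\<dots> = m z / (z - zs)"
      unfolding q m_def using that by (simp add: field_simps)
    finally show "p_of \<alpha> \<beta> \<rho> z (a z) (b z) = m z / (z - zs)" .
  qed
  have init: "g zs = - \<rho>" "m zs = cnj \<rho>"
  proof -
    show g: "g zs = - \<rho>" using r1 \<rho>0 by (simp add: g_def hz(1) nonzero_divide_eq_eq)
    show "m zs = cnj \<rho>" using r2 by (simp add: m_def g power2_eq_square)
  qed
  define U where "U = ball zs e - {zs}"
  have "open U" unfolding U_def by (intro open_delete) auto
  have solU: "solves (field_q \<alpha>) (field_p \<beta>) U (\<lambda>z. 1 / a z) (\<lambda>z. p_of \<alpha> \<beta> \<rho> z (a z) (b z))"
    by (rule solves_qp[OF \<rho> solves_subset[OF sol]]) (use sub anz in \<open>auto simp: U_def\<close>)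
  have prod_deriv: "((\<lambda>z. (z - zs) * f z) has_field_derivative f z + (z - zs) * D) (at z)"
    if "(f has_field_derivative D) (at z)" for f D z
    using that by (auto intro!: derivative_eq_intros)
  \<comment> \<open>Multiplied by (z - zs)^2, the system has no singular terms left. At zs itself it
    reduces to - g = m^2 and - m = - g^2, which holds for the values - \<rho> and \<rho>^2.\<close>
  have deriv: "(z - zs) * deriv g z - g z = m z * m z + (z - zs) * z * g z + \<alpha> * (z - zs)\<^sup>2"
    "(z - zs) * deriv m z - m z = - (g z * g z) - (z - zs) * z * m z - \<beta> * (z - zs)\<^sup>2"
    if z: "z \<in> ball zs e" for z
  proof -
    have "((z - zs) * deriv g z - g z = m z * m z + (z - zs) * z * g z + \<alpha> * (z - zs)\<^sup>2) \<and>
      ((z - zs) * deriv m z - m z = - (g z * g z) - (z - zs) * z * m z - \<beta> * (z - zs)\<^sup>2)"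
    proof (cases "z = zs")
      case True
      then show ?thesis using init r2 r3 by (simp add: power2_eq_square)
    next
      case False
      then have zU: "z \<in> U" using z by (simp add: U_def)
      define y where "y = z - zs"
      have y: "y \<noteq> 0" using False by (simp add: y_def)
      note qz = q[OF zU[unfolded U_def]] and pz = p[OF zU[unfolded U_def]]
      have "((\<lambda>z. (z - zs) * (1 / a z)) has_field_derivative
          1 / a z + (z - zs) * field_q \<alpha> z (1 / a z) (p_of \<alpha> \<beta> \<rho> z (a z) (b z))) (at z)"
        using solU zU unfolding solves_def by (intro prod_deriv) blast
      then have "(g has_field_derivative g z / y + y * field_q \<alpha> z (g z / y) (m z / y)) (at z)"
        unfolding qz pz y_def
        by (rule has_field_derivative_transform_within_open[OF _ \<open>open U\<close> zU])
          (use q in \<open>auto simp: U_def\<close>)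
      then have dg: "deriv g z = g z / y + y * field_q \<alpha> z (g z / y) (m z / y)" by (rule DERIV_imp_deriv)
      have "((\<lambda>z. (z - zs) * p_of \<alpha> \<beta> \<rho> z (a z) (b z)) has_field_derivative
          p_of \<alpha> \<beta> \<rho> z (a z) (b z) + (z - zs) * field_p \<beta> z (1 / a z) (p_of \<alpha> \<beta> \<rho> z (a z) (b z))) (at z)"
        using solU zU unfolding solves_def by (intro prod_deriv) blast
      then have "(m has_field_derivative m z / y + y * field_p \<beta> z (g z / y) (m z / y)) (at z)"
        unfolding qz pz y_def
        by (rule has_field_derivative_transform_within_open[OF _ \<open>open U\<close> zU])
          (use p in \<open>auto simp: U_def\<close>)
      then have dm: "deriv m z = m z / y + y * field_p \<beta> z (g z / y) (m z / y)" by (rule DERIV_imp_deriv)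
      show ?thesis
        unfolding dg dm y_def[symmetric] field_q_def field_p_def
        using y by (simp add: field_simps power2_eq_square)
    qed
    then show "(z - zs) * deriv g z - g z = m z * m z + (z - zs) * z * g z + \<alpha> * (z - zs)\<^sup>2"
      "(z - zs) * deriv m z - m z = - (g z * g z) - (z - zs) * z * m z - \<beta> * (z - zs)\<^sup>2" by blast+
  qed
  \<comment> \<open>The formula \<open>b_of\<close> at q = g / y and p = m / y, multiplied by y^3
    with y = z - zs. Its coefficient of order three is the value of b at zs.\<close>
  have b_eq: "(z - zs)^3 * b z = k * ((z - zs)\<^sup>2 * g z) - cnj \<rho> * (z * ((z - zs) * (g z * g z)))
      + \<rho> * (g z * g z * g z) + g z * g z * m z" if z: "z \<in> ball zs e" for z
  proof (cases "z = zs")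
    case True
    then show ?thesis using r2 by (simp add: init power2_eq_square)
  next
    case False
    then have zU: "z \<in> ball zs e - {zs}" using z by simp
    define y where "y = z - zs"
    have y: "y \<noteq> 0" using False by (simp add: y_def)
    have "b z = b_of \<alpha> \<beta> \<rho> z (g z / y) (m z / y)"
      using b_of_p_of[OF anz[OF zU], of \<alpha> \<beta> \<rho> z "b z"] unfolding q[OF zU] p[OF zU] y_def by simp
    then show ?thesis
      unfolding y_def[symmetric] b_of_def k_def[symmetric]
      using y by (simp add: field_simps power2_eq_square power3_eq_cube)
  qed
  define G M B where "G = fps_expansion g zs" and "M = fps_expansion m zs" and "B = fps_expansion b zs"
  have exG: "(\<lambda>x. g (zs + x)) has_fps_expansion G" and exM: "(\<lambda>x. m (zs + x)) has_fps_expansion M"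
    and exB: "(\<lambda>x. b (zs + x)) has_fps_expansion B"
    unfolding G_def M_def B_def
  proof -
    have "f analytic_on {zs}" if "f holomorphic_on ball zs e'" "e' > 0" for f e'
      unfolding analytic_at using that by (intro exI[of _ "ball zs e'"]) auto
    then have "g analytic_on {zs}" "m analytic_on {zs}" "b analytic_on {zs}"
      using hol_g hol_m hol(2) e(1) r by blast+
    then show "(\<lambda>x. g (zs + x)) has_fps_expansion fps_expansion g zs"
      "(\<lambda>x. m (zs + x)) has_fps_expansion fps_expansion m zs"
      "(\<lambda>x. b (zs + x)) has_fps_expansion fps_expansion b zs"
      by (auto intro: analytic_at_imp_has_fps_expansion)
  qed
  have near: "\<forall>\<^sub>F x in nhds 0. zs + x \<in> ball zs e"
    using e(1) by (auto simp: eventually_nhds_metric dist_norm)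
  have uniq: "F1 = F2" if "f1 has_fps_expansion F1" "f2 has_fps_expansion F2" "\<And>x. zs + x \<in> ball zs e \<Longrightarrow> f1 x = f2 x"
    for f1 f2 :: "complex \<Rightarrow> complex" and F1 F2
  proof -
    have "\<forall>\<^sub>F x in nhds 0. f1 x = f2 x" using near by eventually_elim (rule that(3))
    then have "f2 has_fps_expansion F1" using that(1) has_fps_expansion_cong by blast
    then show ?thesis using that(2) fps_expansion_unique_complex by blast
  qed
  have shift_deriv: "deriv (\<lambda>x. f (zs + x)) x = deriv f (zs + x)" for f x
    by (simp add: deriv_shift_0' o_def add.assoc)
  have idx: "(\<lambda>x. zs + x) has_fps_expansion fps_const zs + fps_X"
    by (intro fps_expansion_intros)
  note ex = fps_expansion_intros exG exM exB idx
  have eqG: "fps_X * fps_deriv G - G = M * M + fps_X * (fps_const zs + fps_X) * G + fps_const \<alpha> * fps_X\<^sup>2"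
  proof (rule uniq)
    show "(\<lambda>x. x * deriv (\<lambda>x. g (zs + x)) x - g (zs + x)) has_fps_expansion fps_X * fps_deriv G - G"
      by (intro ex)
    show "(\<lambda>x. m (zs + x) * m (zs + x) + x * (zs + x) * g (zs + x) + \<alpha> * x^2) has_fps_expansion
      M * M + fps_X * (fps_const zs + fps_X) * G + fps_const \<alpha> * fps_X\<^sup>2"
      by (intro ex)
  qed (use deriv(1)[of "zs + _"] in \<open>simp add: shift_deriv\<close>)
  have eqM: "fps_X * fps_deriv M - M = - (G * G) - fps_X * (fps_const zs + fps_X) * M - fps_const \<beta> * fps_X\<^sup>2"
  proof (rule uniq)
    show "(\<lambda>x. x * deriv (\<lambda>x. m (zs + x)) x - m (zs + x)) has_fps_expansion fps_X * fps_deriv M - M"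
      by (intro ex)
    show "(\<lambda>x. - (g (zs + x) * g (zs + x)) - x * (zs + x) * m (zs + x) - \<beta> * x^2) has_fps_expansion
      - (G * G) - fps_X * (fps_const zs + fps_X) * M - fps_const \<beta> * fps_X\<^sup>2"
      by (intro ex)
  qed (use deriv(2)[of "zs + _"] in \<open>simp add: shift_deriv\<close>)
  have eqB: "fps_X^3 * B = fps_const (1 - cnj \<rho> * \<alpha> + \<rho> * \<beta>) * (fps_X\<^sup>2 * G)
       - fps_const (cnj \<rho>) * ((fps_const zs + fps_X) * (fps_X * (G * G))) + fps_const \<rho> * (G * G * G) + G * G * M"
  proof (rule uniq)
    show "(\<lambda>x. x^3 * b (zs + x)) has_fps_expansion fps_X^3 * B"
      by (intro ex)
    show "(\<lambda>x. (1 - cnj \<rho> * \<alpha> + \<rho> * \<beta>) * (x^2 * g (zs + x))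
       - cnj \<rho> * ((zs + x) * (x * (g (zs + x) * g (zs + x)))) + \<rho> * (g (zs + x) * g (zs + x) * g (zs + x))
       + g (zs + x) * g (zs + x) * m (zs + x)) has_fps_expansion
      fps_const (1 - cnj \<rho> * \<alpha> + \<rho> * \<beta>) * (fps_X\<^sup>2 * G)
       - fps_const (cnj \<rho>) * ((fps_const zs + fps_X) * (fps_X * (G * G))) + fps_const \<rho> * (G * G * G) + G * G * M"
      by (intro ex)
  qed (use b_eq[of "zs + _"] in \<open>simp add: k_def shift_def\<close>)
  have nth0: "fps_nth G 0 = - \<rho>" "fps_nth M 0 = cnj \<rho>" "fps_nth B 0 = c"
    by (simp_all add: G_def M_def B_def fps_expansion_def init c_def)
  note coef = pole_coefficients[OF r1 r2 r3 eqG eqM eqB nth0(1,2), unfolded nth0(3)]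
  have sums: "(\<lambda>n. fps_nth G n * (z - zs) ^ n) sums g z" "(\<lambda>n. fps_nth M n * (z - zs) ^ n) sums m z"
    if "z \<in> ball zs e" for z
    using holomorphic_power_series[OF hol_g that] holomorphic_power_series[OF hol_m that]
    by (simp_all add: G_def M_def fps_expansion_def)
  \<comment> \<open>Division by z - zs lowers every exponent by one, so the coefficient with index n
    + 1 of g or m belongs to the power n in q or p.\<close>
  define cs ds where "cs n = fps_nth G (n + 1)" and "ds n = fps_nth M (n + 1)" for n
  have shift: "cs (n + 3) = fps_nth G (n + 4)" "ds (n + 3) = fps_nth M (n + 4)" for n
    by (simp_all add: cs_def ds_def add.commute)
  show thesis
  proof (rule that[of e cs ds])
    show "e > 0" "e \<le> r" by (rule e)+
  next
    fix z assume z: "z \<in> ball zs e - {zs}"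
    then have z': "z \<in> ball zs e" "z - zs \<noteq> 0" by auto
    show "a z \<noteq> 0" by (rule anz[OF z])
    note G = series_split[OF sums(1)[OF z'(1)] z'(2)] and M = series_split[OF sums(2)[OF z'(1)] z'(2)]
    show "summable (\<lambda>n. cs (n + 3) * (z - zs) ^ (n + 3))" "summable (\<lambda>n. ds (n + 3) * (z - zs) ^ (n + 3))"
      unfolding shift by (rule G(1) M(1))+
    show "1 / a z = - \<rho> / (z - zs) + \<rho> * zs / 2
       + (\<rho> * (1 + zs\<^sup>2 / 4) - \<alpha> / 3 + 2 / 3 * cnj \<rho> * \<beta>) * (z - zs)
       + (c / 2 + (- \<alpha> / 2 + 7 * \<rho> / 8 + \<beta> * cnj \<rho> / 2) * zs) * (z - zs)\<^sup>2
       + (\<Sum>n. cs (n + 3) * (z - zs) ^ (n + 3))"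
      unfolding shift q[OF z] G(2) coef nth0 ..
    show "p_of \<alpha> \<beta> \<rho> z (a z) (b z) = cnj \<rho> / (z - zs) + cnj \<rho> * zs / 2
       + (cnj \<rho> * (1 - zs\<^sup>2 / 4) - 2 / 3 * \<rho> * \<alpha> + \<beta> / 3) * (z - zs)
       + (c * \<rho> / 2 - 3 * cnj \<rho> * zs / 8) * (z - zs)\<^sup>2
       + (\<Sum>n. ds (n + 3) * (z - zs) ^ (n + 3))"
      unfolding shift p[OF z] M(2) coef nth0 ..
  qed
qed

section \<open>Behaviour at the end point\<close>

context continued_solution
begin

text \<open>Uniqueness and permanence identify all elements on the tail with the single solution (x,
  y). This solution is holomorphic at the end point, so adjoining it as the element at parameter 1
  completes the continuation.\<close>

lemma solves_continuation:
  assumes ta: "ta \<in> {0..<1}" and r: "r > 0" and sol: "solves (field_q \<alpha>) (field_p \<beta>) (ball (\<gamma> ta) r) x y"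
    and init: "x (\<gamma> ta) = Q ta (\<gamma> ta)" "y (\<gamma> ta) = P ta (\<gamma> ta)"
    and ball: "\<And>t. t \<in> {ta..1} \<Longrightarrow> \<gamma> t \<in> ball (\<gamma> ta) r"
  shows "\<exists>Q' P'. continuation_along \<gamma> {0..1} q Q' \<and> continuation_along \<gamma> {0..1} p P'"
proof -
  obtain d where d: "d > 0" "solves (field_q \<alpha>) (field_p \<beta>) (ball (\<gamma> ta) d) (Q ta) (P ta)"
    using solves_along[OF ta] by blast
  have "\<forall>\<^sub>F z in nhds (\<gamma> ta). Q ta z = x z \<and> P ta z = y z"
    by (rule poly3_ode_unique[OF poly3_field_q poly3_field_p, where A = "ball (\<gamma> ta) (min d r)"])
      (use d r init in \<open>auto intro: solves_subset[OF d(2)] solves_subset[OF sol]\<close>)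
  then have eq: "\<forall>\<^sub>F z in nhds (\<gamma> t). Q t z = x z \<and> P t z = y z" if "t \<in> {ta..<1}" for t
    using continues_as[OF ta open_ball _ solves_holomorphic[OF sol] _ that] ball that by auto
  have *: "continuation_along \<gamma> {0..1} f (F(1 := g))"
    if F: "continuation_along \<gamma> {0..<1} f F" and g: "g holomorphic_on ball (\<gamma> ta) r"
      and Fg: "\<And>t. t \<in> {ta..<1} \<Longrightarrow> \<forall>\<^sub>F z in nhds (\<gamma> t). F t z = g z" for f g F
    unfolding continuation_along_def
  proof (intro conjI ballI)
    fix t :: real assume t: "t \<in> {0..1}"
    show "(F(1 := g)) t analytic_on {\<gamma> t}"
    proof (cases "t = 1")
      case True
      then show ?thesis using g ball[of 1] ta unfolding True by (auto simp: analytic_at intro!: exI[of _ "ball (\<gamma> ta) r"])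
    next
      case False
      then show ?thesis using F t by (auto simp: continuation_along_def)
    qed
    show "\<forall>\<^sub>F s in at t within {0..1}. \<forall>\<^sub>F z in nhds (\<gamma> s). (F(1 := g)) s z = (F(1 := g)) t z"
    proof (cases "t = 1")
      case True
      have "\<forall>\<^sub>F s in at 1 within {0..1}. s \<in> {ta..<1}"
        using ta by (auto simp: eventually_at dist_real_def intro!: exI[of _ "1 - ta"])
      then show ?thesis unfolding True by eventually_elim (use Fg in auto)
    next
      case False
      then have t1: "t \<in> {0..<1}" using t by auto
      have "at t within {0..1} = at t within {0..<1}"
        by (rule at_within_nhd[of t "{..<1}"]) (use t1 in auto)
      moreover have "\<forall>\<^sub>F s in at t within {0..<1}. s \<in> {0..<1}" by (auto simp: eventually_at_filter)
      moreover have "\<forall>\<^sub>F s in at t within {0..<1}. \<forall>\<^sub>F z in nhds (\<gamma> s). F s z = F t z"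
        using F t1 by (auto simp: continuation_along_def)
      ultimately show ?thesis using False
        by (auto elim: eventually_elim2)
    qed
  qed (use F in \<open>auto simp: continuation_along_def\<close>)
  have "\<forall>\<^sub>F z in nhds (\<gamma> t). Q t z = x z" "\<forall>\<^sub>F z in nhds (\<gamma> t). P t z = y z" if "t \<in> {ta..<1}" for t
    using eq[OF that] by (auto elim: eventually_mono)
  then have "continuation_along \<gamma> {0..1} q (Q(1 := x))" "continuation_along \<gamma> {0..1} p (P(1 := y))"
    by (blast intro: * contQ contP solves_holomorphic[OF sol])+
  then show ?thesis by blast
qed

text \<open>The ball is centred at the running point of the path and not at its end, since the
  existence theorem yields discs around the initial point.\<close>

lemma tail_in_ball:
  assumes "r > 0"
  shows "\<forall>\<^sub>F ta in at_left 1. ta \<in> {0..<1} \<and> (\<forall>t\<in>{ta..1}. \<gamma> t \<in> ball (\<gamma> ta) r)"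
proof -
  obtain d where d: "d > 0" "\<And>t. t \<in> {0..1} \<Longrightarrow> dist t 1 < d \<Longrightarrow> dist (\<gamma> t) (\<gamma> 1) < r / 2"
    using \<gamma>_cont assms unfolding continuous_on_iff by (metis atLeastAtMost_iff half_gt_zero order_refl zero_le_one)
  have "\<forall>\<^sub>F ta in at_left 1. ta \<in> {max 0 (1 - d)<..<1::real}"
    by (rule eventually_at_left_real) (use d in auto)
  then show ?thesis
  proof eventually_elim
    case (elim ta)
    have "dist (\<gamma> ta) (\<gamma> t) < r" if "t \<in> {ta..1}" for t
    proof -
      have "dist (\<gamma> ta) (\<gamma> 1) < r / 2" "dist (\<gamma> t) (\<gamma> 1) < r / 2"
        using elim that d(2)[of ta] d(2)[of t] by (auto simp: dist_real_def)
      then show ?thesis by (rule dist_triangle_half_l)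
    qed
    then show ?case using elim by auto
  qed
qed

lemma frequently_bounded_continues:
  assumes K: "\<exists>\<^sub>F t in at_left 1. nrm2 (Q t (\<gamma> t)) (P t (\<gamma> t)) \<le> K"
  shows "\<exists>Q' P'. continuation_along \<gamma> {0..1} q Q' \<and> continuation_along \<gamma> {0..1} p P'"
proof -
  obtain Z where Z: "\<And>t. t \<in> {0..1} \<Longrightarrow> norm (\<gamma> t) \<le> Z" using norm_bounded by blast
  \<comment> \<open>The radius depends only on K and on the bound Z for the path. It is fixed first;
    then a parameter with values below K is picked so late that the disc around its path point
    contains the rest of the path.\<close>
  obtain r where r: "r > 0" "\<And>z0 x0 y0. norm z0 \<le> max K Z \<Longrightarrow> norm x0 \<le> max K Z \<Longrightarrow> norm y0 \<le> max K Z \<Longrightarrow>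
     \<exists>x y. solves (field_q \<alpha>) (field_p \<beta>) (ball z0 r) x y \<and> x z0 = x0 \<and> y z0 = y0"
    using poly3_ode_exists[OF poly3_field_q poly3_field_p, of "max K Z"] by blast
  from frequently_eventually_frequently[OF K tail_in_ball[OF r(1)]]
  obtain ta where ta: "nrm2 (Q ta (\<gamma> ta)) (P ta (\<gamma> ta)) \<le> K" "ta \<in> {0..<1}"
    "\<And>t. t \<in> {ta..1} \<Longrightarrow> \<gamma> t \<in> ball (\<gamma> ta) r"
    by (auto dest!: frequently_ex)
  have "norm (\<gamma> ta) \<le> max K Z" "norm (Q ta (\<gamma> ta)) \<le> max K Z" "norm (P ta (\<gamma> ta)) \<le> max K Z"
    using Z[of ta] ta(1,2) nrm2_le[of "Q ta (\<gamma> ta)" "P ta (\<gamma> ta)"] nrm2_le[of "P ta (\<gamma> ta)" "Q ta (\<gamma> ta)"]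
    by (auto simp: le_max_iff_disj)
  from r(2)[OF this] obtain x y where "solves (field_q \<alpha>) (field_p \<beta>) (ball (\<gamma> ta) r) x y"
    "x (\<gamma> ta) = Q ta (\<gamma> ta)" "y (\<gamma> ta) = P ta (\<gamma> ta)" by blast
  then show ?thesis using solves_continuation ta(2,3) r(1) by blast
qed

text \<open>A single late parameter \<open>ta\<close> suffices to select \<rho>: the chart
  coordinates are bounded there, the chart system has a solution on a disc covering the rest of the
  path, and permanence transports the coordinate relations to all later parameters.\<close>

lemma unbounded_reaches_tilde:
  assumes large: "\<And>K. \<forall>\<^sub>F t in at_left 1. nrm2 (Q t (\<gamma> t)) (P t (\<gamma> t)) > K"
  shows "\<exists>\<rho>\<in>cube_roots. \<exists>ta\<in>{0..<1}. \<exists>r>0. \<exists>a b. (\<forall>t\<in>{ta..1}. \<gamma> t \<in> ball (\<gamma> ta) r) \<and>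
    solves (field_a \<alpha> \<beta> \<rho>) (field_b \<alpha> \<beta> \<rho>) (ball (\<gamma> ta) r) a b \<and> a (\<gamma> 1) = 0 \<and>
    (\<forall>t\<in>{ta..<1}. \<forall>\<^sub>F z in nhds (\<gamma> t). a z * Q t z = 1 \<and> b z = b_of \<alpha> \<beta> \<rho> z (Q t z) (P t z))"
proof -
  obtain Z where Z: "\<And>t. t \<in> {0..1} \<Longrightarrow> norm (\<gamma> t) \<le> Z" using norm_bounded by blast
  have Z0: "Z \<ge> 0" using order_trans[OF norm_ge_zero Z[of 0]] by simp
  have "\<forall>\<^sub>F t in at_left 1. t \<in> {0<..<1::real}" by (rule eventually_at_left_real) simp
  with large[of 1] have "\<forall>\<^sub>F t in at_left 1. t \<in> {0<..<1} \<and> nrm2 (Q t (\<gamma> t)) (P t (\<gamma> t)) > 1"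
    by eventually_elim simp
  then obtain tb where tb: "tb < 1" "\<And>t. tb < t \<Longrightarrow> t < 1 \<Longrightarrow> t \<in> {0<..<1} \<and> nrm2 (Q t (\<gamma> t)) (P t (\<gamma> t)) > 1"
    unfolding eventually_at_left_field by blast
  define tc where "tc = (tb + 1) / 2"
  have tc: "tc \<in> {0..<1}" "tb < tc" using tb(1) tb(2)[of tc] by (auto simp: tc_def)
  have big: "nrm2 (Q t (\<gamma> t)) (P t (\<gamma> t)) > 1" if "t \<in> {tc..<1}" for t
    using tb(2)[of t] tc(2) that by auto
  obtain B where B: "\<And>t. t \<in> {tc..<1} \<Longrightarrow> norm (W \<alpha> \<beta> (\<gamma> t) (Q t (\<gamma> t)) (P t (\<gamma> t))) \<le> B"
    using W_bounded[OF tc(1) big] by blast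
  obtain K R where KR: "\<And>z q p. norm z \<le> Z \<Longrightarrow> norm (W \<alpha> \<beta> z q p) \<le> max B 0 \<Longrightarrow> nrm2 q p \<ge> R \<Longrightarrow>
     \<exists>\<rho>\<in>cube_roots. q \<noteq> 0 \<and> norm (1 / q) \<le> K \<and> norm (b_of \<alpha> \<beta> \<rho> z q p) \<le> K"
    using chart_bound[OF max.cobounded2[of 0 B] Z0, where \<alpha> = \<alpha> and \<beta> = \<beta>] by blast
  have "\<forall>\<rho>. \<exists>r>0. \<forall>z0 x0 y0. norm z0 \<le> max K Z \<longrightarrow> norm x0 \<le> max K Z \<longrightarrow> norm y0 \<le> max K Z \<longrightarrow>
     (\<exists>x y. solves (field_a \<alpha> \<beta> \<rho>) (field_b \<alpha> \<beta> \<rho>) (ball z0 r) x y \<and> x z0 = x0 \<and> y z0 = y0)"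
    by (intro allI poly3_ode_exists poly3_field_a poly3_field_b)
  then obtain rr where rr: "\<And>\<rho>. rr \<rho> > 0" "\<And>\<rho> z0 x0 y0. norm z0 \<le> max K Z \<Longrightarrow> norm x0 \<le> max K Z \<Longrightarrow> norm y0 \<le> max K Z \<Longrightarrow>
     \<exists>x y. solves (field_a \<alpha> \<beta> \<rho>) (field_b \<alpha> \<beta> \<rho>) (ball z0 (rr \<rho>)) x y \<and> x z0 = x0 \<and> y z0 = y0"
    by metis
  \<comment> \<open>The value of \<rho> becomes known only after \<open>ta\<close> has been chosen,
    and \<open>ta\<close> depends on the radius; the minimum over the three cube roots breaks the
    circle.\<close>
  define r where "r = Min (rr ` cube_roots)"
  have fin: "finite (rr ` cube_roots)" "rr ` cube_roots \<noteq> {}" by (auto simp: cube_roots_def)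
  have r: "r > 0" "\<And>\<rho>. \<rho> \<in> cube_roots \<Longrightarrow> r \<le> rr \<rho>"
    using fin rr(1) by (auto simp: r_def)
  have "\<forall>\<^sub>F t in at_left 1. t \<in> {tc<..<1}" using tc by (intro eventually_at_left_real) simp
  with large[of R] tail_in_ball[OF r(1)]
  have "\<forall>\<^sub>F t in at_left 1. nrm2 (Q t (\<gamma> t)) (P t (\<gamma> t)) > R \<and>
    (t \<in> {0..<1} \<and> (\<forall>s\<in>{t..1}. \<gamma> s \<in> ball (\<gamma> t) r)) \<and> t \<in> {tc<..<1}"
    by eventually_elim simp
  then obtain ta where ta: "nrm2 (Q ta (\<gamma> ta)) (P ta (\<gamma> ta)) > R" "ta \<in> {0..<1}"
    "\<And>s. s \<in> {ta..1} \<Longrightarrow> \<gamma> s \<in> ball (\<gamma> ta) r" "ta \<in> {tc<..<1}"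
    using eventually_happens'[OF trivial_limit_at_left_real] by blast
  have "norm (W \<alpha> \<beta> (\<gamma> ta) (Q ta (\<gamma> ta)) (P ta (\<gamma> ta))) \<le> max B 0"
    using B[of ta] ta(4) by (simp add: le_max_iff_disj)
  moreover have "norm (\<gamma> ta) \<le> Z" using Z[of ta] ta(2) by simp
  ultimately obtain \<rho> where \<rho>: "\<rho> \<in> cube_roots" and q0: "Q ta (\<gamma> ta) \<noteq> 0" and K: "norm (1 / Q ta (\<gamma> ta)) \<le> K"
    "norm (b_of \<alpha> \<beta> \<rho> (\<gamma> ta) (Q ta (\<gamma> ta)) (P ta (\<gamma> ta))) \<le> K"
    using KR[of "\<gamma> ta" "Q ta (\<gamma> ta)" "P ta (\<gamma> ta)"] ta(1) by auto
  obtain a b where ab: "solves (field_a \<alpha> \<beta> \<rho>) (field_b \<alpha> \<beta> \<rho>) (ball (\<gamma> ta) (rr \<rho>)) a b"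
    "a (\<gamma> ta) = 1 / Q ta (\<gamma> ta)" "b (\<gamma> ta) = b_of \<alpha> \<beta> \<rho> (\<gamma> ta) (Q ta (\<gamma> ta)) (P ta (\<gamma> ta))"
    using rr(2)[of "\<gamma> ta" "1 / Q ta (\<gamma> ta)" "b_of \<alpha> \<beta> \<rho> (\<gamma> ta) (Q ta (\<gamma> ta)) (P ta (\<gamma> ta))" \<rho>]
      K Z[of ta] ta(2) by (auto simp: le_max_iff_disj)
  have sol: "solves (field_a \<alpha> \<beta> \<rho>) (field_b \<alpha> \<beta> \<rho>) (ball (\<gamma> ta) r) a b"
    by (rule solves_subset[OF ab(1)]) (use r(2)[OF \<rho>] in auto)
  note hol = solves_holomorphic[OF sol]
  obtain d where d: "d > 0" "solves (field_q \<alpha>) (field_p \<beta>) (ball (\<gamma> ta) d) (Q ta) (P ta)"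
    using solves_along[OF ta(2)] by blast
  have "isCont (Q ta) (\<gamma> ta)" using d by (auto simp: solves_def intro: DERIV_isCont)
  then obtain d' where d': "d' > 0" "\<And>z. dist (\<gamma> ta) z < d' \<Longrightarrow> Q ta z \<noteq> 0"
    using continuous_at_avoid[of "\<gamma> ta" "Q ta" 0] q0 by blast
  define A where "A = ball (\<gamma> ta) (min r (min d d'))"
  have A: "\<gamma> ta \<in> A" "open A" using r d d' by (auto simp: A_def)
  have "\<forall>\<^sub>F z in nhds (\<gamma> ta). 1 / Q ta z = a z \<and> b_of \<alpha> \<beta> \<rho> z (Q ta z) (P ta z) = b z"
  proof (rule poly3_ode_unique[OF poly3_field_a poly3_field_b A(2,1)])
    show "solves (field_a \<alpha> \<beta> \<rho>) (field_b \<alpha> \<beta> \<rho>) A (\<lambda>z. 1 / Q ta z) (\<lambda>z. b_of \<alpha> \<beta> \<rho> z (Q ta z) (P ta z))"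
      by (rule solves_tilde[OF \<rho> solves_subset[OF d(2)]]) (use d'(2) in \<open>auto simp: A_def\<close>)
    show "solves (field_a \<alpha> \<beta> \<rho>) (field_b \<alpha> \<beta> \<rho>) A a b"
      by (rule solves_subset[OF sol]) (auto simp: A_def)
  qed (use ab in auto)
  moreover have "\<forall>\<^sub>F z in nhds (\<gamma> ta). z \<in> A" using A by (intro eventually_nhds_in_open)
  ultimately have base: "\<forall>\<^sub>F z in nhds (\<gamma> ta). a z * Q ta z = 1 \<and> b z = b_of \<alpha> \<beta> \<rho> z (Q ta z) (P ta z)"
  proof eventually_elim
    case (elim z)
    then have "Q ta z \<noteq> 0" using d'(2) by (auto simp: A_def)
    moreover have e: "a z = 1 / Q ta z" "b z = b_of \<alpha> \<beta> \<rho> z (Q ta z) (P ta z)" using elim by simp_all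
    ultimately show ?case unfolding e by simp
  qed
  have an: "a analytic_on {\<gamma> t}" "b analytic_on {\<gamma> t}" if "t \<in> {ta..1}" for t
    unfolding analytic_at using hol ta(3)[OF that] open_ball by blast+
  \<comment> \<open>The product form \<open>a z * Q t z = 1\<close> is analytic without knowing that
    Q has no zeros, and it yields this fact for Q and for a at the same time.\<close>
  have rel: "\<forall>\<^sub>F z in nhds (\<gamma> t). a z * Q t z = 1 \<and> b z = b_of \<alpha> \<beta> \<rho> z (Q t z) (P t z)" if t: "t \<in> {ta..<1}" for t
  proof -
    have "\<forall>\<^sub>F z in nhds (\<gamma> t). a z * Q t z - 1 = 0"
    proof (rule permanence[where ta = ta and \<Phi> = "\<lambda>f g z. a z * f z - 1"])
      fix t assume "t \<in> {ta..<1}"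
      then show "(\<lambda>z. a z * Q t z - 1) analytic_on {\<gamma> t}"
        using ta(2) by (intro analytic_intros an analytic) auto
    qed (use ta(2) t base in \<open>auto elim: eventually_mono dest: eventually_nhds_x_imp_x\<close>)
    moreover have "\<forall>\<^sub>F z in nhds (\<gamma> t). b z - b_of \<alpha> \<beta> \<rho> z (Q t z) (P t z) = 0"
    proof (rule permanence[where ta = ta and \<Phi> = "\<lambda>f g z. b z - b_of \<alpha> \<beta> \<rho> z (f z) (g z)"])
      fix t assume "t \<in> {ta..<1}"
      then show "(\<lambda>z. b z - b_of \<alpha> \<beta> \<rho> z (Q t z) (P t z)) analytic_on {\<gamma> t}"
        unfolding b_of_def using ta(2) by (intro analytic_intros an analytic) auto
    qed (use ta(2) t base in \<open>auto elim: eventually_mono dest: eventually_nhds_x_imp_x\<close>)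
    ultimately show ?thesis by eventually_elim simp
  qed
  \<comment> \<open>Otherwise the point would return to the affine chart: (q, p) would converge
    along the path to the finite point given by a and b at the end, contrary to its growth.\<close>
  have "a (\<gamma> 1) = 0"
  proof (rule ccontr)
    assume a1: "a (\<gamma> 1) \<noteq> 0"
    have g1: "(\<gamma> \<longlongrightarrow> \<gamma> 1) (at_left 1)"
      using continuous_on_Icc_at_leftD[OF \<gamma>_cont] by simp
    have "isCont a (\<gamma> 1)" "isCont b (\<gamma> 1)"
      using an[of 1] ta(2) by (auto intro: analytic_at_imp_isCont)
    then have "((\<lambda>t. a (\<gamma> t)) \<longlongrightarrow> a (\<gamma> 1)) (at_left 1)" "((\<lambda>t. b (\<gamma> t)) \<longlongrightarrow> b (\<gamma> 1)) (at_left 1)"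
      using g1 isCont_tendsto_compose by blast+
    then have "((\<lambda>t. nrm2 (1 / a (\<gamma> t)) (p_of \<alpha> \<beta> \<rho> (\<gamma> t) (a (\<gamma> t)) (b (\<gamma> t)))) \<longlongrightarrow>
        nrm2 (1 / a (\<gamma> 1)) (p_of \<alpha> \<beta> \<rho> (\<gamma> 1) (a (\<gamma> 1)) (b (\<gamma> 1)))) (at_left 1)" (is "(_ \<longlongrightarrow> ?l) _")
      unfolding nrm2_def p_of_def using a1 by (intro tendsto_intros g1)
    then have "\<forall>\<^sub>F t in at_left 1. nrm2 (1 / a (\<gamma> t)) (p_of \<alpha> \<beta> \<rho> (\<gamma> t) (a (\<gamma> t)) (b (\<gamma> t))) < ?l + 1"
      by (rule order_tendstoD) simp
    moreover have "\<forall>\<^sub>F t in at_left 1. t \<in> {ta<..<1}" using ta(2) by (intro eventually_at_left_real) auto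
    ultimately have "\<forall>\<^sub>F t in at_left 1. nrm2 (1 / a (\<gamma> t)) (p_of \<alpha> \<beta> \<rho> (\<gamma> t) (a (\<gamma> t)) (b (\<gamma> t))) < ?l + 1 \<and>
        t \<in> {ta<..<1} \<and> nrm2 (Q t (\<gamma> t)) (P t (\<gamma> t)) > ?l + 1"
      using large[of "?l + 1"] by eventually_elim simp
    then obtain t where t: "nrm2 (1 / a (\<gamma> t)) (p_of \<alpha> \<beta> \<rho> (\<gamma> t) (a (\<gamma> t)) (b (\<gamma> t))) < ?l + 1"
      "t \<in> {ta<..<1}" "nrm2 (Q t (\<gamma> t)) (P t (\<gamma> t)) > ?l + 1"
      using eventually_happens'[OF trivial_limit_at_left_real] by blast
    have aQ: "a (\<gamma> t) * Q t (\<gamma> t) = 1" and b: "b (\<gamma> t) = b_of \<alpha> \<beta> \<rho> (\<gamma> t) (Q t (\<gamma> t)) (P t (\<gamma> t))"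
      using rel[of t, THEN eventually_nhds_x_imp_x] t(2) by auto
    have nz: "a (\<gamma> t) \<noteq> 0" "Q t (\<gamma> t) \<noteq> 0" using aQ by auto
    then have a: "a (\<gamma> t) = 1 / Q t (\<gamma> t)" using aQ by (simp add: eq_divide_eq)
    show False using t(1,3) unfolding a b p_of_b_of[OF nz(2)] by simp
  qed
  then show ?thesis using \<rho> ta(2,3) r(1) sol rel by blast
qed

end

section \<open>The chart, the limit point and the series at the end point\<close>

theorem theorem1:
  fixes \<alpha> \<beta> z0 zs :: complex
    and U :: "complex set"
    and q p :: "complex \<Rightarrow> complex"
    and \<gamma> :: "real \<Rightarrow> complex"
    and Q P :: "real \<Rightarrow> complex \<Rightarrow> complex"
  assumes "open U" and "z0 \<in> U"
    and "q analytic_on U" and "p analytic_on U"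
    and "\<And>z. z \<in> U \<Longrightarrow> deriv q z = (p z)\<^sup>2 + z * q z + \<alpha>"
    and "\<And>z. z \<in> U \<Longrightarrow> deriv p z = - (q z)\<^sup>2 - z * p z - \<beta>"
    and "rectifiable_path \<gamma>" and "pathstart \<gamma> = z0" and "pathfinish \<gamma> = zs"
    and "continuation_along \<gamma> {0..<1} q Q" and "continuation_along \<gamma> {0..<1} p P"
    and "\<not> (\<exists>Q' P'. continuation_along \<gamma> {0..1} q Q' \<and> continuation_along \<gamma> {0..1} p P')"
  shows "\<exists>C\<in>charts. \<exists>X Y.
     X analytic_on {zs} \<and> Y analytic_on {zs} \<and>
     (\<forall>\<^sub>F z in nhds zs. chart_pt \<alpha> \<beta> z C (X z, Y z) \<in> init_space \<alpha> \<beta> z) \<and>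
     (\<forall>\<^sub>F t in at_left 1. \<forall>\<^sub>F z in nhds (\<gamma> t).
        chart_pt \<alpha> \<beta> z C (X z, Y z) = chart_pt \<alpha> \<beta> z Chart_qp (Q t z, P t z)) \<and>
     (\<exists>\<rho>\<in>cube_roots. \<exists>pt.
        pt = chart_pt \<alpha> \<beta> zs C (X zs, Y zs) \<and>
        pt \<in> curve_L3 \<alpha> \<beta> zs \<rho> \<and>
        pt \<notin> range (chart_pt \<alpha> \<beta> zs Chart_qp) \<and>
        (\<exists>c. pt = chart_pt \<alpha> \<beta> zs (Chart_tilde2 \<rho>) (0, c) \<and>
          (\<exists>h k r. \<exists>cs ds :: nat \<Rightarrow> complex. \<exists>qs ps :: complex \<Rightarrow> complex. r > 0 \<and>
             h = c / 2 + (- \<alpha> / 2 + 7 * \<rho> / 8 + \<beta> * cnj \<rho> / 2) * zs \<and>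
             k = c * \<rho> / 2 - 3 * cnj \<rho> * zs / 8 \<and>
             (\<forall>z \<in> ball zs r - {zs}.
                summable (\<lambda>n. cs (n + 3) * (z - zs) ^ (n + 3)) \<and>
                summable (\<lambda>n. ds (n + 3) * (z - zs) ^ (n + 3)) \<and>
                qs z = - \<rho> / (z - zs) + \<rho> * zs / 2
                  + (\<rho> * (1 + zs\<^sup>2 / 4) - \<alpha> / 3 + 2 / 3 * cnj \<rho> * \<beta>) * (z - zs)
                  + h * (z - zs)\<^sup>2 + (\<Sum>n. cs (n + 3) * (z - zs) ^ (n + 3)) \<and>
                ps z = cnj \<rho> / (z - zs) + cnj \<rho> * zs / 2
                  + (cnj \<rho> * (1 - zs\<^sup>2 / 4) - 2 / 3 * \<rho> * \<alpha> + \<beta> / 3) * (z - zs)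
                  + k * (z - zs)\<^sup>2 + (\<Sum>n. ds (n + 3) * (z - zs) ^ (n + 3)) \<and>
                chart_pt \<alpha> \<beta> z C (X z, Y z) = chart_pt \<alpha> \<beta> z Chart_qp (qs z, ps z)) \<and>
             (\<forall>\<^sub>F t in at_left 1. \<forall>\<^sub>F z in nhds (\<gamma> t). Q t z = qs z \<and> P t z = ps z))))"
proof -
  have \<gamma>01: "\<gamma> 0 = z0" "\<gamma> 1 = zs"
    using assms(8,9) by (auto simp: pathstart_def pathfinish_def)
  have "\<forall>\<^sub>F z in nhds (\<gamma> 0). z \<in> U"
    using assms(1,2) by (simp add: \<gamma>01 eventually_nhds_in_open)
  then have init: "\<forall>\<^sub>F z in nhds (\<gamma> 0). q analytic_on {z} \<and> p analytic_on {z} \<and>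
      deriv q z = field_q \<alpha> z (q z) (p z) \<and> deriv p z = field_p \<beta> z (q z) (p z)"
    by eventually_elim
      (use assms(3-6) in \<open>simp add: field_q_def field_p_def analytic_on_analytic_at[of _ U]\<close>)
  interpret continued_solution \<alpha> \<beta> \<gamma> q p Q P
    by unfold_locales (rule assms(7) init assms(10) assms(11))+
  \<comment> \<open>If some bound K were met for parameters arbitrarily close to 1, the solution
    would continue to the end point, which is excluded by hypothesis.\<close>
  have large: "\<forall>\<^sub>F t in at_left 1. nrm2 (Q t (\<gamma> t)) (P t (\<gamma> t)) > K" for K
    using frequently_bounded_continues[of K] assms(12) by (auto simp: frequently_def not_le)
  obtain \<rho> ta r a b where \<rho>: "\<rho> \<in> cube_roots" and ta: "ta \<in> {0..<1}" and r: "r > 0"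
    and ball: "\<forall>t\<in>{ta..1}. \<gamma> t \<in> ball (\<gamma> ta) r"
    and sol: "solves (field_a \<alpha> \<beta> \<rho>) (field_b \<alpha> \<beta> \<rho>) (ball (\<gamma> ta) r) a b" and a0: "a zs = 0"
    and rel: "\<forall>t\<in>{ta..<1}. \<forall>\<^sub>F z in nhds (\<gamma> t). a z * Q t z = 1 \<and> b z = b_of \<alpha> \<beta> \<rho> z (Q t z) (P t z)"
    using unbounded_reaches_tilde[OF large] unfolding \<gamma>01
    by (elim bexE exE conjE) (rule that; assumption)
  have "\<gamma> 1 \<in> ball (\<gamma> ta) r" using ball ta by simp
  then have zs: "zs \<in> ball (\<gamma> ta) r" unfolding \<gamma>01 .
  obtain r' where r': "r' > 0" "ball zs r' \<subseteq> ball (\<gamma> ta) r"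
    by (rule openE[OF open_ball zs])
  have tail: "\<forall>\<^sub>F t in at_left 1. \<forall>\<^sub>F z in nhds (\<gamma> t).
      a z \<noteq> 0 \<and> Q t z = 1 / a z \<and> P t z = p_of \<alpha> \<beta> \<rho> z (a z) (b z)"
  proof -
    have "\<forall>\<^sub>F t in at_left 1. t \<in> {ta<..<1}" using ta by (intro eventually_at_left_real) simp
    then show ?thesis
    proof eventually_elim
      case (elim t)
      then have "\<forall>\<^sub>F z in nhds (\<gamma> t). a z * Q t z = 1 \<and> b z = b_of \<alpha> \<beta> \<rho> z (Q t z) (P t z)"
        using rel by simp
      then show ?case
      proof eventually_elim
        case (elim z)
        then have "a z \<noteq> 0" "Q t z \<noteq> 0" by auto
        then have q: "Q t z = 1 / a z" and a: "a z = 1 / Q t z"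
          using elim by (simp_all add: nonzero_eq_divide_eq mult.commute)
        have "p_of \<alpha> \<beta> \<rho> z (a z) (b z) = P t z"
          unfolding a elim[THEN conjunct2] by (rule p_of_b_of) fact
        with \<open>a z \<noteq> 0\<close> q show ?case by simp
      qed
    qed
  qed
  define c where "c = b zs"
  obtain e cs ds where e: "e > 0" "e \<le> r'"
    and anz: "\<And>z. z \<in> ball zs e - {zs} \<Longrightarrow> a z \<noteq> 0"
    and summable: "\<And>z. z \<in> ball zs e - {zs} \<Longrightarrow> summable (\<lambda>n. cs (n + 3) * (z - zs) ^ (n + 3))"
      "\<And>z. z \<in> ball zs e - {zs} \<Longrightarrow> summable (\<lambda>n. ds (n + 3) * (z - zs) ^ (n + 3))"
    and q_series: "\<And>z. z \<in> ball zs e - {zs} \<Longrightarrow> 1 / a z = - \<rho> / (z - zs) + \<rho> * zs / 2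
       + (\<rho> * (1 + zs\<^sup>2 / 4) - \<alpha> / 3 + 2 / 3 * cnj \<rho> * \<beta>) * (z - zs)
       + (c / 2 + (- \<alpha> / 2 + 7 * \<rho> / 8 + \<beta> * cnj \<rho> / 2) * zs) * (z - zs)\<^sup>2
       + (\<Sum>n. cs (n + 3) * (z - zs) ^ (n + 3))"
    and p_series: "\<And>z. z \<in> ball zs e - {zs} \<Longrightarrow> p_of \<alpha> \<beta> \<rho> z (a z) (b z) = cnj \<rho> / (z - zs) + cnj \<rho> * zs / 2
       + (cnj \<rho> * (1 - zs\<^sup>2 / 4) - 2 / 3 * \<rho> * \<alpha> + \<beta> / 3) * (z - zs)
       + (c * \<rho> / 2 - 3 * cnj \<rho> * zs / 8) * (z - zs)\<^sup>2
       + (\<Sum>n. ds (n + 3) * (z - zs) ^ (n + 3))"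
    by (rule tilde_solution_pole[OF \<rho> r'(1) solves_subset[OF sol r'(2)] a0, folded c_def]) blast
  have C: "Chart_tilde2 \<rho> \<in> charts" using \<rho> by (auto simp: charts_def)
  have an: "a analytic_on {zs}" "b analytic_on {zs}"
    unfolding analytic_at using solves_holomorphic[OF sol] zs open_ball by blast+
  \<comment> \<open>Points with nonzero a lie in the affine chart and points with a = 0 on the last
    exceptional curve, off the second one; by \<open>init_space_eq\<close> these are exactly the
    points of the space.\<close>
  have in_space: "pt_tilde2 \<alpha> \<beta> z \<rho> (a z, b z) \<in> init_space \<alpha> \<beta> z" for z
    unfolding init_space_eq using \<rho> by (cases "a z = 0") (auto simp: pt_tilde2_eq_pt_qp')
  have pt_in: "pt_tilde2 \<alpha> \<beta> zs \<rho> (0, c) \<in> curve_L3 \<alpha> \<beta> zs \<rho>"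
    using in_space[of zs] by (auto simp: curve_L3_def init_space_def a0 c_def)
  have not_qp: "pt_tilde2 \<alpha> \<beta> zs \<rho> (0, c) \<notin> range pt_qp"
    by (auto simp: pt_tilde2_def centre3_def pt_qp_def)
  have same_point: "\<forall>\<^sub>F t in at_left 1. \<forall>\<^sub>F z in nhds (\<gamma> t).
      pt_tilde2 \<alpha> \<beta> z \<rho> (a z, b z) = pt_qp (Q t z, P t z)"
    using tail by (elim eventually_mono) (simp add: pt_tilde2_eq_pt_qp')
  have tail': "\<forall>\<^sub>F t in at_left 1. \<forall>\<^sub>F z in nhds (\<gamma> t).
      Q t z = 1 / a z \<and> P t z = p_of \<alpha> \<beta> \<rho> z (a z) (b z)"
    using tail by (elim eventually_mono) simp
  \<comment> \<open>The witnesses are the second tilde chart of \<rho> with coordinates (a, b), c =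
    b zs, and for the Laurent series the functions 1 / a and \<open>p_of\<close>. The default value
    of 1 / a at zs does no harm, as the series are claimed on the punctured disc and the agreement
    with Q and P is taken where a is nonzero.\<close>
  show ?thesis
    apply (rule bexI[OF _ C], rule exI[of _ a], rule exI[of _ b])
    apply (intro conjI an)
    subgoal using in_space by simp
    subgoal using same_point by simp
    apply (rule bexI[OF _ \<rho>], rule exI[of _ "pt_tilde2 \<alpha> \<beta> zs \<rho> (0, c)"])
    apply (intro conjI)
    subgoal by (simp add: a0 c_def)
    subgoal by (rule pt_in)
    subgoal using not_qp by simp
    apply (rule exI[of _ c], intro conjI)
    subgoal by simp
    apply (rule exI[of _ "c / 2 + (- \<alpha> / 2 + 7 * \<rho> / 8 + \<beta> * cnj \<rho> / 2) * zs"])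
    apply (rule exI[of _ "c * \<rho> / 2 - 3 * cnj \<rho> * zs / 8"])
    apply (rule exI[of _ e], rule exI[of _ cs], rule exI[of _ ds])
    apply (rule exI[of _ "\<lambda>z. 1 / a z"], rule exI[of _ "\<lambda>z. p_of \<alpha> \<beta> \<rho> z (a z) (b z)"])
    apply (intro conjI e(1) refl tail')
    apply (intro ballI conjI)
    subgoal by (rule summable(1))
    subgoal by (rule summable(2))
    subgoal by (rule q_series)
    subgoal by (rule p_series)
    subgoal for z using pt_tilde2_eq_pt_qp'[OF anz[of z]] by simp
    done
qed

end
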